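(* Fix $\beta>0$, $\beta'=\beta/2$, and let $(\lambda_1,\dots,\lambda_n)$ be distributed according to the Hermite $\beta$-ensemble density $\mathbf P^H_{n,\beta}$ (see context). Let $$Y^H_{n,\beta}=\log\mathbf P^H_{n,\beta}(\lambda_1,\dots,\lambda_n)+nE^H_\beta,\qquad E^H_\beta=\log2\pi-\tfrac12-\beta'+\beta'\Psi(1+\beta')-\ell(1+\beta').$$ Then the sequence $\left(n^{-1/3}Y^H_{n,\beta}\right)_n$ converges mod-Gaussian on the strip $S_1=\{z\in\mathbb C:\Re z>-1\}$, as $n\to\infty$, with parameters $t_n^\beta=n^{1/3}\sigma_\beta^2$ and limiting function $$\psi^\beta(z)=e^{-A_\beta z^3/6},$$ where $$\sigma_\beta^2=\beta'-\beta'^2\,\ell''(1+\beta'),\qquad A_\beta=\beta'^3\,\ell'''(1+\beta')+\beta'.$$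
   Context: Hermite ensemble: with $H(x)=x^2/2$, $$\mathbf P^H_{n,\beta}(\lambda_1,\dots,\lambda_n)=\frac1{\mathcal Z^H_n(\beta)}\prod_{1\le j<k\le n}|\lambda_k-\lambda_j|^\beta\prod_{k=1}^ne^{-\frac\beta2nH(\lambda_k)}$$ with respect to Lebesgue measure on $\mathbb R^n$, $\mathcal Z_n^H(\beta)$ being the normalizing constant. $\ell(x)=\log\Gamma(x)$ and $\Psi=\ell'$ is the digamma function. Mod-Gaussian convergence: for $-\infty\le c<0<d\le\infty$ let $S_{(c,d)}=\{z\in\mathbb C:c<\Re z<d\}$. Real random variables $(X_n)$ whose moment generating functions $\mathbb E[e^{zX_n}]$ exist on $S_{(c,d)}$ converge mod-Gaussian on $S_{(c,d)}$ with parameters $t_n\to\infty$ and limiting function $\psi$ if $\psi$ is analytic on $S_{(c,d)}$, does not vanish on the real part of $S_{(c,d)}$, and $\mathbb E[e^{zX_n}]e^{-t_nz^2/2}\to\psi(z)$ locally uniformly on $S_{(c,d)}$. The strip $S_1$ is $S_{(-1,\infty)}$. *)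

theory Defs
  imports "HOL-Probability.Probability" "HOL-Complex_Analysis.Complex_Analysis"
begin

text \<open>Points of \<open>\<real>\<^sup>n\<close> are functions on the index set \<open>{1..n}\<close>, and Lebesgue measure on \<open>\<real>\<^sup>n\<close> is
  the product measure of \<open>n\<close> copies of \<^const>\<open>lborel\<close>.\<close>

definition lebesgue_Rn :: "nat \<Rightarrow> (nat \<Rightarrow> real) measure" where
  "lebesgue_Rn n = (\<Pi>\<^sub>M i\<in>{1..n}. (lborel :: real measure))"

definition hermite_potential :: "real \<Rightarrow> real" where
  "hermite_potential x = x\<^sup>2 / 2"

definition hermite_weight :: "real \<Rightarrow> nat \<Rightarrow> (nat \<Rightarrow> real) \<Rightarrow> real" where
  "hermite_weight \<beta> n x =
     (\<Prod>k\<in>{1..n}. \<Prod>j\<in>{1..<k}. \<bar>x k - x j\<bar> powr \<beta>) *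
     (\<Prod>k\<in>{1..n}. exp (- (\<beta> / 2) * real n * hermite_potential (x k)))"

definition hermite_partition :: "real \<Rightarrow> nat \<Rightarrow> real" where
  "hermite_partition \<beta> n = (LINT x|lebesgue_Rn n. hermite_weight \<beta> n x)"

definition hermite_density :: "real \<Rightarrow> nat \<Rightarrow> (nat \<Rightarrow> real) \<Rightarrow> real" where
  "hermite_density \<beta> n x = hermite_weight \<beta> n x / hermite_partition \<beta> n"

definition log_Gamma :: "real \<Rightarrow> real" where
  "log_Gamma x = ln (Gamma x)"

definition hermite_E :: "real \<Rightarrow> real" where
  "hermite_E \<beta> = (let b = \<beta> / 2 in
     ln (2 * pi) - 1 / 2 - b + b * Digamma (1 + b) - log_Gamma (1 + b))"

text \<open>On the null set where the density vanishes, the value of \<^const>\<open>ln\<close> at \<open>0\<close> is irrelevant.\<close>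

definition hermite_Y :: "real \<Rightarrow> nat \<Rightarrow> (nat \<Rightarrow> real) \<Rightarrow> real" where
  "hermite_Y \<beta> n x = ln (hermite_density \<beta> n x) + real n * hermite_E \<beta>"

definition hermite_sigma2 :: "real \<Rightarrow> real" where
  "hermite_sigma2 \<beta> = (let b = \<beta> / 2 in b - b\<^sup>2 * (deriv ^^ 2) log_Gamma (1 + b))"

definition hermite_A :: "real \<Rightarrow> real" where
  "hermite_A \<beta> = (let b = \<beta> / 2 in b ^ 3 * (deriv ^^ 3) log_Gamma (1 + b) + b)"

definition strip :: "ereal \<Rightarrow> ereal \<Rightarrow> complex set" where
  "strip c d = {z. c < ereal (Re z) \<and> ereal (Re z) < d}"

definition locally_uniform_limit ::
    "complex set \<Rightarrow> (nat \<Rightarrow> complex \<Rightarrow> complex) \<Rightarrow> (complex \<Rightarrow> complex) \<Rightarrow> bool" where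
  "locally_uniform_limit S f g \<longleftrightarrow>
     (\<forall>z\<in>S. \<exists>U. open U \<and> z \<in> U \<and> uniform_limit (U \<inter> S) f g sequentially)"

text \<open>Sequences are indexed by \<open>n \<ge> 1\<close>; the variables \<open>X n\<close> may live on different probability
  spaces \<open>M n\<close>.\<close>

definition mod_gaussian_convergent ::
    "ereal \<Rightarrow> ereal \<Rightarrow> (nat \<Rightarrow> 'a measure) \<Rightarrow> (nat \<Rightarrow> 'a \<Rightarrow> real) \<Rightarrow> (nat \<Rightarrow> real) \<Rightarrow>
     (complex \<Rightarrow> complex) \<Rightarrow> bool" where
  "mod_gaussian_convergent c d M X t \<psi> \<longleftrightarrow>
     c < 0 \<and> 0 < d \<and>
     (\<forall>n\<ge>1. prob_space (M n) \<and> X n \<in> borel_measurable (M n)) \<and>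
     (\<forall>n\<ge>1. \<forall>z\<in>strip c d. integrable (M n) (\<lambda>\<omega>. exp (z * complex_of_real (X n \<omega>)))) \<and>
     filterlim t at_top sequentially \<and>
     \<psi> analytic_on strip c d \<and>
     (\<forall>x::real. complex_of_real x \<in> strip c d \<longrightarrow> \<psi> (complex_of_real x) \<noteq> 0) \<and>
     locally_uniform_limit (strip c d)
       (\<lambda>n z. (LINT \<omega>|M n. exp (z * complex_of_real (X n \<omega>))) *
              exp (- (complex_of_real (t n) * z\<^sup>2 / 2))) \<psi>"

end

theory Submission
  imports Defs
begin

text \<open>Powers of the Hermite weight are Hermite weights: \<open>w\<^sub>\<beta>\<close> raised to the power \<open>1 + s\<close> is
\<open>w\<close> for the parameter \<open>\<beta> (1 + s)\<close>. Hence the moment generating function of \<^const>\<open>hermite_Y\<close> at a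
real \<open>s > -1\<close> is \<open>exp (s n E)\<close> times \<open>Z\<^sub>n(\<beta> (1 + s)) / Z\<^sub>n(\<beta>) powr (1 + s)\<close>, and the theorem becomes a
statement about the partition function \<open>Z\<^sub>n\<close>, for which there is a closed formula: Mehta's integral.

Mehta's integral (\<open>mehta_integral\<close>, for \<open>\<gamma> = \<beta> / 2 \<ge> 1\<close>) comes from the Laguerre integral
\<open>L\<^sub>n(a)\<close> of \<open>\<Prod>\<^sub>i x\<^sub>i\<^sup>a exp (- x\<^sub>i) \<Prod>\<^sub>i\<^sub><\<^sub>j \<bar>x\<^sub>i - x\<^sub>j\<bar> powr (2 \<gamma>)\<close> over the positive orthant.
Aomoto's integration by parts expresses \<open>L\<^sub>n(a + 1)\<close> by \<open>L\<^sub>n(a)\<close> (\<open>laguerre_integral_Suc\<close>), so that the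
quotient of \<open>L\<^sub>n(a)\<close> and \<open>\<Prod>\<^sub>r \<Gamma>(a + 1 + r \<gamma>)\<close> does not change under \<open>a \<mapsto> a + 1\<close>. Moving \<open>a\<close> to infinity
in unit steps and rescaling around the saddle point, the quotient tends to the Hermite integral up to
explicit factors; so for every starting point \<open>a \<ge> 0\<close> it already equals that limit
(\<open>hermite_integral_laguerre\<close>). At \<open>a = 0\<close> the integration by parts produces a boundary term, which gives
\<open>L\<^sub>n(0) = L\<^sub>n\<^sub>-\<^sub>1(2 \<gamma>)\<close> (\<open>laguerre_integral_0_insert\<close>). Comparing the starting points \<open>0\<close> and
\<open>2 \<gamma>\<close> turns this into a recursion in \<open>n\<close>. The case of one variable of the same limit is Stirling's formula.

The formula is carried over to all \<open>\<beta> > 0\<close> and to complex arguments at once: both sides of the identity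
for the moment generating function are holomorphic in \<open>Re z > -1\<close>, and they agree for large
real \<open>z\<close>, where \<open>\<beta> (1 + z) / 2 \<ge> 1\<close> (\<open>hermite_mgf\<close>).

For the asymptotics put \<open>b = \<beta> / 2\<close> and \<open>s = z / n\<^sup>1\<^sup>/\<^sup>3\<close>, and insert Stirling's formula into
\<open>\<Sum>\<^sub>j (ln \<Gamma>(1 + j b (1 + s)) - (1 + s) ln \<Gamma>(1 + j b))\<close>. The terms of order \<open>n\<^sup>2\<close> cancel against the
scaling factors of \<open>Z\<^sub>n\<close>, the constant \<open>E\<close> removes the part that is linear in \<open>s\<close>, and what remains is \<open>n F(s)\<close>
(\<open>log_mgf_eq\<close>), where \<open>F(s) = \<sigma>\<^sup>2 s\<^sup>2 / 2 - A s\<^sup>3 / 6 + O(s\<^sup>4)\<close>. Since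
\<open>n s\<^sup>2 = n\<^sup>1\<^sup>/\<^sup>3 z\<^sup>2\<close>, \<open>n s\<^sup>3 = z\<^sup>3\<close> and \<open>n s\<^sup>4\<close> tends to \<open>0\<close>, this is the claimed
Gaussian factor with the limiting function. The remainders in Stirling's formula enter through the difference
of a dilated and a scaled value, which is \<open>O(\<bar>s\<bar> / j)\<close> (\<open>stirling_remainder_dilation\<close>); their sum is
\<open>O(n\<^sup>-\<^sup>1\<^sup>/\<^sup>3 log n)\<close>.\<close>

section \<open>The Vandermonde interaction and product integrability\<close>

abbreviation lborel_on :: "nat set \<Rightarrow> (nat \<Rightarrow> real) measure" where
  "lborel_on I \<equiv> \<Pi>\<^sub>M i\<in>I. (lborel :: real measure)"

interpretation lborel_product: product_sigma_finite "\<lambda>_::nat. lborel :: real measure"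
  by (intro product_sigma_finite.intro allI) (rule lborel.sigma_finite_measure_axioms)

definition offdiag :: "nat set \<Rightarrow> (nat \<times> nat) set" where
  "offdiag I = {p \<in> I \<times> I. fst p \<noteq> snd p}"

text \<open>The product runs over ordered pairs, so each unordered pair contributes \<open>\<bar>x\<^sub>i - x\<^sub>j\<bar> powr (2 \<gamma>)\<close>. This makes
the symmetry in the coordinates a reindexing of the product.\<close>

definition interaction :: "real \<Rightarrow> nat set \<Rightarrow> (nat \<Rightarrow> real) \<Rightarrow> real" where
  "interaction \<gamma> I x = (\<Prod>p\<in>offdiag I. \<bar>x (fst p) - x (snd p)\<bar> powr \<gamma>)"

text \<open>For \<open>c = 2 \<gamma>\<close> this is the factor that a particle added at \<open>y\<close> contributes to the interaction. It is kept as a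
function of \<open>y\<close> because all integrations by parts take place in one coordinate.\<close>

definition repulsion :: "real \<Rightarrow> nat set \<Rightarrow> (nat \<Rightarrow> real) \<Rightarrow> real \<Rightarrow> real" where
  "repulsion c J x y = (\<Prod>j\<in>J. \<bar>y - x j\<bar> powr c)"

lemma finite_offdiag [simp]: "finite I \<Longrightarrow> finite (offdiag I)"
  unfolding offdiag_def by (rule finite_subset[of _ "I \<times> I"]) auto

lemma offdiag_insert:
  "i \<notin> I \<Longrightarrow> offdiag (insert i I) = offdiag I \<union> (Pair i ` I \<union> (\<lambda>j. (j, i)) ` I)"
  unfolding offdiag_def by auto

lemma card_offdiag: "finite I \<Longrightarrow> card (offdiag I) = card I * (card I - 1)"
proof -
  assume I: "finite I"
  have "offdiag I = I \<times> I - (\<lambda>i. (i, i)) ` I" unfolding offdiag_def by auto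
  also have "card \<dots> = card (I \<times> I) - card ((\<lambda>i. (i, i)) ` I)"
    using I by (intro card_Diff_subset) auto
  also have "card ((\<lambda>i. (i, i)) ` I) = card I" by (intro card_image inj_onI) auto
  finally show ?thesis by (simp add: card_cartesian_product algebra_simps)
qed

lemma interaction_insert:
  assumes I: "finite I" "i \<notin> I"
  shows "interaction \<gamma> (insert i I) x = interaction \<gamma> I x * repulsion (2 * \<gamma>) I x (x i)"
proof -
  let ?f = "\<lambda>p. \<bar>x (fst p) - x (snd p)\<bar> powr \<gamma>"
  have "interaction \<gamma> (insert i I) x = prod ?f (offdiag I) * prod ?f (Pair i ` I \<union> (\<lambda>j. (j, i)) ` I)"
    unfolding interaction_def offdiag_insert[OF I(2)]
    using I by (intro prod.union_disjoint) (auto simp: offdiag_def)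
  also have "prod ?f (Pair i ` I \<union> (\<lambda>j. (j, i)) ` I) = prod ?f (Pair i ` I) * prod ?f ((\<lambda>j. (j, i)) ` I)"
    using I by (intro prod.union_disjoint) auto
  also have "prod ?f (Pair i ` I) = (\<Prod>j\<in>I. \<bar>x i - x j\<bar> powr \<gamma>)"
    by (subst prod.reindex) (auto intro: inj_onI)
  also have "prod ?f ((\<lambda>j. (j, i)) ` I) = (\<Prod>j\<in>I. \<bar>x i - x j\<bar> powr \<gamma>)"
    by (subst prod.reindex) (auto intro: inj_onI simp: abs_minus_commute)
  also have "(\<Prod>j\<in>I. \<bar>x i - x j\<bar> powr \<gamma>) * (\<Prod>j\<in>I. \<bar>x i - x j\<bar> powr \<gamma>) = repulsion (2 * \<gamma>) I x (x i)"
    by (simp add: repulsion_def prod.distrib[symmetric] powr_add[symmetric])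
  finally show ?thesis by (simp add: interaction_def)
qed

lemma interaction_fun_upd: "i \<notin> I \<Longrightarrow> interaction \<gamma> I (x(i := y)) = interaction \<gamma> I x"
  unfolding interaction_def offdiag_def by (intro prod.cong) auto

lemma repulsion_fun_upd: "i \<notin> J \<Longrightarrow> repulsion c J (x(i := y)) = repulsion c J x"
  unfolding repulsion_def by (intro ext prod.cong) auto

lemma interaction_nonneg: "interaction \<gamma> I x \<ge> 0"
  unfolding interaction_def by (intro prod_nonneg) auto

lemma interaction_transpose:
  assumes "i \<in> I" "j \<in> I"
  shows "interaction \<gamma> I (x \<circ> Transposition.transpose i j) = interaction \<gamma> I x"
  unfolding interaction_def
proof (rule prod.reindex_bij_witness[where i = "map_prod (Transposition.transpose i j) (Transposition.transpose i j)"
        and j = "map_prod (Transposition.transpose i j) (Transposition.transpose i j)"])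
qed (use assms in \<open>auto simp: offdiag_def Transposition.transpose_def split: if_splits\<close>)

lemma interaction_eq_0:
  assumes "finite I" "i \<in> I" "j \<in> I" "i \<noteq> j" "x i = x j"
  shows "interaction \<gamma> I x = 0"
  unfolding interaction_def
  by (rule prod_zero) (use assms in \<open>auto simp: offdiag_def intro!: bexI[of _ "(i, j)"]\<close>)

lemma measurable_interaction [measurable]:
  assumes "I \<subseteq> J"
  shows "interaction \<gamma> I \<in> borel_measurable (lborel_on J)"
proof -
  have [measurable]: "(\<lambda>x. x i) \<in> borel_measurable (lborel_on J)" if "i \<in> I" for i
    using measurable_component_singleton[of i J "\<lambda>_. lborel :: real measure"] that assms by auto
  show ?thesis
    unfolding interaction_def by (intro borel_measurable_prod) (auto simp: offdiag_def)
qed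

text \<open>Polynomial growth is measured by \<open>1 + \<bar>t\<bar>\<close>, because it is submultiplicative for differences.\<close>

lemma abs_diff_le_growth: "\<bar>x - y\<bar> \<le> (1 + \<bar>x\<bar>) * (1 + \<bar>y\<bar>)" for x y :: real
proof -
  have "\<bar>x - y\<bar> \<le> \<bar>x\<bar> + \<bar>y\<bar>" by (rule abs_triangle_ineq4)
  also have "\<dots> \<le> (1 + \<bar>x\<bar>) * (1 + \<bar>y\<bar>)" by (simp add: algebra_simps)
  finally show ?thesis .
qed

lemma growth_ge_1: "(1 + \<bar>x\<bar>) * (1 + \<bar>y\<bar>) \<ge> (1::real)" for x y :: real
  by (simp add: algebra_simps)

lemma repulsion_bound:
  assumes "c \<ge> 0"
  shows "repulsion c J x y \<le> (\<Prod>k\<in>J. ((1 + \<bar>y\<bar>) * (1 + \<bar>x k\<bar>)) powr c)"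
  unfolding repulsion_def using assms abs_diff_le_growth
  by (intro prod_mono) (auto intro!: powr_mono2)

lemma repulsion_div_bound:
  assumes J: "finite J" "j \<in> J" and c: "c \<ge> 1"
  shows "\<bar>repulsion c J x y / (y - x j)\<bar> \<le> (\<Prod>k\<in>J. ((1 + \<bar>y\<bar>) * (1 + \<bar>x k\<bar>)) powr c)"
proof -
  let ?u = "\<bar>y - x j\<bar>" and ?g = "\<lambda>k. (1 + \<bar>y\<bar>) * (1 + \<bar>x k\<bar>)"
  have "\<bar>repulsion c J x y / (y - x j)\<bar> = (?u powr c / ?u) * (\<Prod>k\<in>J-{j}. \<bar>y - x k\<bar> powr c)"
    unfolding repulsion_def prod.remove[OF J] by (simp add: abs_mult abs_prod)
  also have "\<dots> \<le> ?g j powr c * (\<Prod>k\<in>J-{j}. ?g k powr c)"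
  proof (rule mult_mono)
    have "?u powr c / ?u \<le> ?u powr (c - 1)"
      by (cases "?u = 0") (auto simp: powr_diff)
    also have "\<dots> \<le> ?g j powr (c - 1)"
      using c abs_diff_le_growth by (intro powr_mono2) auto
    also have "\<dots> \<le> ?g j powr c" using growth_ge_1 by (intro powr_mono) auto
    finally show "?u powr c / ?u \<le> ?g j powr c" .
    show "(\<Prod>k\<in>J-{j}. \<bar>y - x k\<bar> powr c) \<le> (\<Prod>k\<in>J-{j}. ?g k powr c)"
      using c abs_diff_le_growth by (intro prod_mono) (auto intro!: powr_mono2)
  qed (auto intro!: prod_nonneg)
  also have "\<dots> = (\<Prod>k\<in>J. ?g k powr c)" by (rule prod.remove[OF J, symmetric])
  finally show ?thesis .
qed

text \<open>The exponent \<open>2 \<gamma> \<cdot> card I\<close> in the polynomial bound for the interaction is chosen to survive the addition of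
one particle.\<close>

lemma growth_step:
  fixes \<gamma> :: real
  assumes I: "finite I" "i \<notin> I" and \<gamma>: "\<gamma> \<ge> 0"
  shows "(\<Prod>k\<in>I. (1 + \<bar>x k\<bar>) powr (2 * \<gamma> * card I)) *
           (\<Prod>k\<in>I. ((1 + \<bar>x i\<bar>) * (1 + \<bar>x k\<bar>)) powr (2 * \<gamma>))
         \<le> (\<Prod>k\<in>insert i I. (1 + \<bar>x k\<bar>) powr (2 * \<gamma> * card (insert i I)))"
proof -
  have "(\<Prod>k\<in>I. (1 + \<bar>x k\<bar>) powr (2 * \<gamma> * card I)) *
           (\<Prod>k\<in>I. ((1 + \<bar>x i\<bar>) * (1 + \<bar>x k\<bar>)) powr (2 * \<gamma>))
      = (1 + \<bar>x i\<bar>) powr (2 * \<gamma> * card I) * (\<Prod>k\<in>I. (1 + \<bar>x k\<bar>) powr (2 * \<gamma> * card (insert i I)))"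
  proof -
    have "(\<Prod>k\<in>I. ((1 + \<bar>x i\<bar>) * (1 + \<bar>x k\<bar>)) powr (2 * \<gamma>))
        = (1 + \<bar>x i\<bar>) powr (2 * \<gamma> * card I) * (\<Prod>k\<in>I. (1 + \<bar>x k\<bar>) powr (2 * \<gamma>))"
      by (simp add: powr_mult prod.distrib powr_realpow[symmetric] powr_powr)
    moreover have "(\<Prod>k\<in>I. (1 + \<bar>x k\<bar>) powr (2 * \<gamma> * card (insert i I)))
        = (\<Prod>k\<in>I. (1 + \<bar>x k\<bar>) powr (2 * \<gamma> * card I)) * (\<Prod>k\<in>I. (1 + \<bar>x k\<bar>) powr (2 * \<gamma>))"
      unfolding prod.distrib[symmetric] using I by (simp add: powr_add[symmetric] algebra_simps)
    ultimately show ?thesis by simp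
  qed
  also have "\<dots> \<le> (1 + \<bar>x i\<bar>) powr (2 * \<gamma> * card (insert i I)) *
                   (\<Prod>k\<in>I. (1 + \<bar>x k\<bar>) powr (2 * \<gamma> * card (insert i I)))"
    using I \<gamma> by (intro mult_right_mono powr_mono prod_nonneg) (auto intro: mult_left_mono)
  also have "\<dots> = (\<Prod>k\<in>insert i I. (1 + \<bar>x k\<bar>) powr (2 * \<gamma> * card (insert i I)))"
    using I by simp
  finally show ?thesis .
qed

lemma interaction_bound:
  assumes "finite I" and \<gamma>: "\<gamma> \<ge> 0"
  shows "interaction \<gamma> I x \<le> (\<Prod>k\<in>I. (1 + \<bar>x k\<bar>) powr (2 * \<gamma> * card I))"
  using assms(1)
proof (induction I rule: finite_induct)
  case empty
  then show ?case by (simp add: interaction_def offdiag_def)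
next
  case (insert i I)
  have "interaction \<gamma> (insert i I) x \<le> (\<Prod>k\<in>I. (1 + \<bar>x k\<bar>) powr (2 * \<gamma> * card I)) *
           (\<Prod>k\<in>I. ((1 + \<bar>x i\<bar>) * (1 + \<bar>x k\<bar>)) powr (2 * \<gamma>))"
    unfolding interaction_insert[OF insert.hyps] using insert.IH repulsion_bound[of "2 * \<gamma>"] \<gamma>
    by (intro mult_mono) (auto intro!: prod_nonneg simp: repulsion_def)
  also note growth_step[OF insert.hyps \<gamma>]
  finally show ?case .
qed

text \<open>Dividing by one difference costs nothing as long as \<open>\<gamma> \<ge> 1\<close>: the singular quotient still
  carries the power \<open>2\<gamma> - 1 \<ge> 0\<close> of that difference. This makes every term of the integrations by
  parts below absolutely integrable.\<close>

lemma interaction_div_bound: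
  assumes I: "finite I" "i \<in> I" "j \<in> I" "i \<noteq> j" and \<gamma>: "\<gamma> \<ge> 1"
  shows "\<bar>interaction \<gamma> I x / (x i - x j)\<bar> \<le> (\<Prod>k\<in>I. (1 + \<bar>x k\<bar>) powr (2 * \<gamma> * card I))"
proof -
  define J where "J = I - {i}"
  have J: "finite J" "i \<notin> J" "j \<in> J" and IJ: "I = insert i J" using I by (auto simp: J_def)
  have "\<bar>interaction \<gamma> I x / (x i - x j)\<bar>
      = interaction \<gamma> J x * \<bar>repulsion (2 * \<gamma>) J x (x i) / (x i - x j)\<bar>"
    unfolding IJ interaction_insert[OF J(1,2)] using interaction_nonneg[of \<gamma> J x] by (simp add: abs_mult)
  also have "\<dots> \<le> (\<Prod>k\<in>J. (1 + \<bar>x k\<bar>) powr (2 * \<gamma> * card J)) *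
           (\<Prod>k\<in>J. ((1 + \<bar>x i\<bar>) * (1 + \<bar>x k\<bar>)) powr (2 * \<gamma>))"
    using interaction_bound[OF J(1), of \<gamma> x] repulsion_div_bound[OF J(1,3), of "2 * \<gamma>" x "x i"] \<gamma>
    by (intro mult_mono) (auto intro!: prod_nonneg)
  also have "\<dots> \<le> (\<Prod>k\<in>I. (1 + \<bar>x k\<bar>) powr (2 * \<gamma> * card I))"
    unfolding IJ by (rule growth_step[OF J(1,2)]) (use \<gamma> in auto)
  finally show ?thesis .
qed

lemma integrable_growth_exp:
  assumes c: "c > (0::real)"
  shows "integrable lborel (\<lambda>t::real. (1 + \<bar>t\<bar>) powr m * exp (- c * \<bar>t\<bar>))"
proof -
  have "((\<lambda>t::real. (1 + t\<^sup>2) * ((1 + t) powr m * exp (- c * t))) \<longlongrightarrow> 0) at_top"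
    using c by real_asymp
  then have "\<forall>\<^sub>F t in at_top. (1 + t\<^sup>2) * ((1 + t) powr m * exp (- c * t)) < 1"
    by (rule order_tendstoD) simp
  then obtain T where T: "\<And>t. t \<ge> T \<Longrightarrow> (1 + t\<^sup>2) * ((1 + t) powr m * exp (- c * t)) < 1"
    by (auto simp: eventually_at_top_linorder)
  have "compact ((\<lambda>t. (1 + t\<^sup>2) * ((1 + \<bar>t\<bar>) powr m * exp (- c * \<bar>t\<bar>))) ` {0..max 0 T})"
    by (intro compact_continuous_image continuous_intros) auto
  then have "bdd_above ((\<lambda>t. (1 + t\<^sup>2) * ((1 + \<bar>t\<bar>) powr m * exp (- c * \<bar>t\<bar>))) ` {0..max 0 T})"
    by (intro bounded_imp_bdd_above compact_imp_bounded)
  then obtain B where B: "\<And>t. t \<in> {0..max 0 T} \<Longrightarrow>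
      (1 + t\<^sup>2) * ((1 + \<bar>t\<bar>) powr m * exp (- c * \<bar>t\<bar>)) \<le> B"
    unfolding bdd_above_def by blast
  define K where "K = max 1 B"
  have K: "(1 + \<bar>t\<bar>) powr m * exp (- c * \<bar>t\<bar>) \<le> K * inverse (1 + t\<^sup>2)" for t :: real
  proof -
    have "(1 + \<bar>t\<bar>\<^sup>2) * ((1 + \<bar>t\<bar>) powr m * exp (- c * \<bar>t\<bar>)) \<le> K"
    proof (cases "\<bar>t\<bar> \<ge> T")
      case True then show ?thesis using T[of "\<bar>t\<bar>"] by (simp add: K_def)
    next
      case False then show ?thesis using B[of "\<bar>t\<bar>"] by (simp add: K_def)
    qed
    moreover have "1 + t\<^sup>2 > 0" by (simp add: add_pos_nonneg)
    ultimately show ?thesis by (simp add: field_simps)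
  qed
  have "integrable lborel (\<lambda>t::real. K * inverse (1 + t\<^sup>2))"
    using integrable_inverse_1_plus_square by (simp add: set_integrable_def)
  then show ?thesis
    by (rule Bochner_Integration.integrable_bound) (use K in \<open>auto simp: K_def\<close>)
qed

lemma integrable_product_bound:
  fixes f :: "(nat \<Rightarrow> real) \<Rightarrow> real"
  assumes I: "finite I" and c: "c > 0"
    and f: "f \<in> borel_measurable (lborel_on I)"
    and bound: "\<And>x. \<bar>f x\<bar> \<le> C * (\<Prod>i\<in>I. (1 + \<bar>x i\<bar>) powr m * exp (- c * \<bar>x i\<bar>))"
  shows "integrable (lborel_on I) f"
proof (rule Bochner_Integration.integrable_bound)
  show "integrable (lborel_on I) (\<lambda>x. C * (\<Prod>i\<in>I. (1 + \<bar>x i\<bar>) powr m * exp (- c * \<bar>x i\<bar>)))"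
    using c by (intro integrable_mult_right lborel_product.product_integrable_prod I integrable_growth_exp)
  show "AE x in lborel_on I. norm (f x) \<le> norm (C * (\<Prod>i\<in>I. (1 + \<bar>x i\<bar>) powr m * exp (- c * \<bar>x i\<bar>)))"
    unfolding real_norm_def by (intro AE_I2 order_trans[OF bound abs_ge_self])
qed (rule f)

lemma distr_lborel_on_permute:
  assumes I: "finite I" and \<pi>: "\<pi> permutes I"
  shows "distr (lborel_on I) (lborel_on I) (\<lambda>x. x \<circ> \<pi>) = lborel_on I"
proof (rule lborel_product.PiM_eqI[OF I])
  have ran: "\<pi> i \<in> I \<longleftrightarrow> i \<in> I" for i using \<pi> by (rule permutes_in_image)
  have m: "(\<lambda>x. x \<circ> \<pi>) \<in> measurable (lborel_on I) (lborel_on I)"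
    unfolding comp_def
  proof (rule measurable_PiM_single')
    show "(\<lambda>\<omega> i. \<omega> (\<pi> i)) \<in> space (lborel_on I) \<rightarrow> (\<Pi>\<^sub>E i\<in>I. space lborel)"
      by (auto simp: space_PiM ran PiE_def extensional_def)
  qed (use ran in auto)
  fix A :: "nat \<Rightarrow> real set" assume A: "\<And>i. i \<in> I \<Longrightarrow> A i \<in> sets lborel"
  have inv: "inv \<pi> permutes I" using \<pi> by (rule permutes_inv)
  have "(\<lambda>x. x \<circ> \<pi>) -` Pi\<^sub>E I A \<inter> space (lborel_on I) = Pi\<^sub>E I (A \<circ> inv \<pi>)"
  proof (intro set_eqI iffI)
    fix x assume x: "x \<in> (\<lambda>x. x \<circ> \<pi>) -` Pi\<^sub>E I A \<inter> space (lborel_on I)"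
    show "x \<in> Pi\<^sub>E I (A \<circ> inv \<pi>)"
    proof (rule PiE_I)
      fix i assume "i \<in> I"
      then have "inv \<pi> i \<in> I" using permutes_in_image[OF inv] by simp
      with x have "(x \<circ> \<pi>) (inv \<pi> i) \<in> A (inv \<pi> i)" by auto
      then show "x i \<in> (A \<circ> inv \<pi>) i" using permutes_inverses[OF \<pi>] by simp
    qed (use x in \<open>auto simp: space_PiM PiE_def extensional_def\<close>)
  next
    fix x assume x: "x \<in> Pi\<^sub>E I (A \<circ> inv \<pi>)"
    have "x (\<pi> i) \<in> A i" if "i \<in> I" for i
    proof -
      have "x (\<pi> i) \<in> (A \<circ> inv \<pi>) (\<pi> i)" using x that ran by (intro PiE_mem[OF x]) auto
      then show ?thesis using permutes_inverses[OF \<pi>] by simp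
    qed
    then show "x \<in> (\<lambda>x. x \<circ> \<pi>) -` Pi\<^sub>E I A \<inter> space (lborel_on I)"
      using x ran by (auto simp: space_PiM PiE_def extensional_def)
  qed
  moreover have "Pi\<^sub>E I A \<in> sets (lborel_on I)" using A I by (intro sets_PiM_I_finite) auto
  ultimately have "emeasure (distr (lborel_on I) (lborel_on I) (\<lambda>x. x \<circ> \<pi>)) (Pi\<^sub>E I A)
      = emeasure (lborel_on I) (Pi\<^sub>E I (A \<circ> inv \<pi>))"
    using m by (simp add: emeasure_distr)
  also have "\<dots> = (\<Prod>i\<in>I. emeasure lborel ((A \<circ> inv \<pi>) i))"
    using A I permutes_in_image[OF inv] by (intro lborel_product.emeasure_PiM) auto
  also have "\<dots> = (\<Prod>i\<in>I. emeasure lborel (A i))"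
    using prod.permute[OF inv, of "\<lambda>i. emeasure lborel (A i)"] by (simp add: comp_def)
  finally show "emeasure (distr (lborel_on I) (lborel_on I) (\<lambda>x. x \<circ> \<pi>)) (Pi\<^sub>E I A)
      = (\<Prod>i\<in>I. emeasure lborel (A i))" .
qed simp

lemma integral_lborel_on_transpose:
  fixes f :: "(nat \<Rightarrow> real) \<Rightarrow> real"
  assumes I: "finite I" "i \<in> I" "j \<in> I" and f: "f \<in> borel_measurable (lborel_on I)"
  shows "(LINT x|lborel_on I. f (x \<circ> Transposition.transpose i j)) = (LINT x|lborel_on I. f x)"
proof -
  have \<pi>: "Transposition.transpose i j permutes I" using I by (intro permutes_swap_id) auto
  have ran: "Transposition.transpose i j k \<in> I \<longleftrightarrow> k \<in> I" for k using \<pi> by (rule permutes_in_image)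
  have m: "(\<lambda>x. x \<circ> Transposition.transpose i j) \<in> measurable (lborel_on I) (lborel_on I)"
    unfolding comp_def
  proof (rule measurable_PiM_single')
    show "(\<lambda>\<omega> k. \<omega> (Transposition.transpose i j k)) \<in> space (lborel_on I) \<rightarrow> (\<Pi>\<^sub>E i\<in>I. space lborel)"
      by (auto simp: space_PiM ran PiE_def extensional_def)
  qed (use ran in auto)
  have "(LINT x|lborel_on I. f x)
      = (LINT x|distr (lborel_on I) (lborel_on I) (\<lambda>x. x \<circ> Transposition.transpose i j). f x)"
    by (simp only: distr_lborel_on_permute[OF I(1) \<pi>])
  also have "\<dots> = (LINT x|lborel_on I. f (x \<circ> Transposition.transpose i j))"
    by (rule integral_distr[OF m f])
  finally show ?thesis by simp
qed

section \<open>Integration by parts for the Laguerre weight\<close>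

definition gamma_weight :: "real \<Rightarrow> real \<Rightarrow> real" where
  "gamma_weight a t = indicator {0<..} t * t powr a * exp (- t)"

definition laguerre :: "real \<Rightarrow> real \<Rightarrow> nat set \<Rightarrow> (nat \<Rightarrow> real) \<Rightarrow> real" where
  "laguerre a \<gamma> I x = (\<Prod>i\<in>I. gamma_weight a (x i)) * interaction \<gamma> I x"

lemma gamma_weight_nonneg: "gamma_weight a t \<ge> 0"
  unfolding gamma_weight_def by simp

lemma gamma_weight_bound:
  assumes "a \<ge> 0"
  shows "gamma_weight a t \<le> (1 + \<bar>t\<bar>) powr a * exp (- \<bar>t\<bar>)"
  unfolding gamma_weight_def using assms
  by (cases "t > 0") (auto intro!: mult_right_mono powr_mono2)

lemma measurable_gamma_weight [measurable]: "gamma_weight a \<in> borel_measurable borel"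
  unfolding gamma_weight_def by measurable

lemma measurable_coordinate [measurable]:
  "i \<in> I \<Longrightarrow> (\<lambda>x. x i) \<in> borel_measurable (lborel_on I)"
  using measurable_component_singleton[of i I "\<lambda>_. lborel :: real measure"] by simp

lemma measurable_monomial [measurable]:
  assumes "S \<subseteq> I"
  shows "(\<lambda>x. \<Prod>k\<in>S. x k) \<in> borel_measurable (lborel_on I)"
  by (intro borel_measurable_prod) (use assms measurable_coordinate in auto)

lemma measurable_laguerre [measurable]: "laguerre a \<gamma> I \<in> borel_measurable (lborel_on I)"
  unfolding laguerre_def by measurable

lemma prod_le_prod_growth:
  assumes "finite I" "S \<subseteq> I"
  shows "\<bar>\<Prod>k\<in>S. x k\<bar> \<le> (\<Prod>k\<in>I. 1 + \<bar>x k :: real\<bar>)"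
proof -
  have "\<bar>\<Prod>k\<in>S. x k\<bar> = (\<Prod>k\<in>I. if k \<in> S then \<bar>x k\<bar> else 1)"
    using assms by (simp add: abs_prod prod.inter_restrict[symmetric] Int_absorb1)
  also have "\<dots> \<le> (\<Prod>k\<in>I. 1 + \<bar>x k\<bar>)" by (intro prod_mono) auto
  finally show ?thesis .
qed

lemma integrable_laguerre_mult:
  assumes I: "finite I" and a: "a \<ge> 0" and q [measurable]: "q \<in> borel_measurable (lborel_on I)"
    and bound: "\<And>x. \<bar>q x * interaction \<gamma> I x\<bar> \<le> (\<Prod>k\<in>I. (1 + \<bar>x k\<bar>) powr m)"
  shows "integrable (lborel_on I) (\<lambda>x. q x * laguerre a \<gamma> I x)"
proof (rule integrable_product_bound[OF I zero_less_one])
  show "(\<lambda>x. q x * laguerre a \<gamma> I x) \<in> borel_measurable (lborel_on I)" by measurable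
  fix x :: "nat \<Rightarrow> real"
  have "\<bar>q x * laguerre a \<gamma> I x\<bar> = \<bar>q x * interaction \<gamma> I x\<bar> * (\<Prod>i\<in>I. gamma_weight a (x i))"
    unfolding laguerre_def using gamma_weight_nonneg by (simp add: abs_mult prod_nonneg abs_prod)
  also have "\<dots> \<le> (\<Prod>k\<in>I. (1 + \<bar>x k\<bar>) powr m) * (\<Prod>k\<in>I. (1 + \<bar>x k\<bar>) powr a * exp (- \<bar>x k\<bar>))"
    using bound[of x] gamma_weight_bound[OF a]
    by (intro mult_mono prod_mono prod_nonneg) (auto intro: gamma_weight_nonneg)
  also have "\<dots> = 1 * (\<Prod>i\<in>I. (1 + \<bar>x i\<bar>) powr (m + a) * exp (- 1 * \<bar>x i\<bar>))"
    by (simp add: prod.distrib[symmetric] powr_add mult.assoc)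
  finally show "\<bar>q x * laguerre a \<gamma> I x\<bar> \<le> 1 * (\<Prod>i\<in>I. (1 + \<bar>x i\<bar>) powr (m + a) * exp (- 1 * \<bar>x i\<bar>))" .
qed

lemma integrable_laguerre_monomial:
  assumes I: "finite I" "S \<subseteq> I" and a: "a \<ge> 0" and \<gamma>: "\<gamma> \<ge> 0"
  shows "integrable (lborel_on I) (\<lambda>x. (\<Prod>k\<in>S. x k) * laguerre a \<gamma> I x)"
proof (rule integrable_laguerre_mult[OF I(1) a, where m = "1 + 2 * \<gamma> * card I"])
  fix x :: "nat \<Rightarrow> real"
  have "\<bar>(\<Prod>k\<in>S. x k) * interaction \<gamma> I x\<bar> = \<bar>\<Prod>k\<in>S. x k\<bar> * interaction \<gamma> I x"
    using interaction_nonneg[of \<gamma> I x] by (simp add: abs_mult)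
  also have "\<dots> \<le> (\<Prod>k\<in>I. 1 + \<bar>x k\<bar>) * (\<Prod>k\<in>I. (1 + \<bar>x k\<bar>) powr (2 * \<gamma> * card I))"
    by (intro mult_mono prod_le_prod_growth I interaction_bound \<gamma> interaction_nonneg prod_nonneg) auto
  also have "\<dots> = (\<Prod>k\<in>I. (1 + \<bar>x k\<bar>) powr (1 + 2 * \<gamma> * card I))"
    by (simp add: prod.distrib[symmetric] powr_add)
  finally show "\<bar>(\<Prod>k\<in>S. x k) * interaction \<gamma> I x\<bar> \<le> (\<Prod>k\<in>I. (1 + \<bar>x k\<bar>) powr (1 + 2 * \<gamma> * card I))" .
qed (use I measurable_monomial[OF I(2)] in \<open>auto intro!: borel_measurable_divide borel_measurable_diff\<close>)

lemma integrable_laguerre_quotient: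
  assumes I: "finite I" "S \<subseteq> I" "i \<in> I" "j \<in> I" "i \<noteq> j" and a: "a \<ge> 0" and \<gamma>: "\<gamma> \<ge> 1"
  shows "integrable (lborel_on I) (\<lambda>x. (\<Prod>k\<in>S. x k) / (x i - x j) * laguerre a \<gamma> I x)"
proof (rule integrable_laguerre_mult[OF I(1) a, where m = "1 + 2 * \<gamma> * card I"])
  fix x :: "nat \<Rightarrow> real"
  have "\<bar>(\<Prod>k\<in>S. x k) / (x i - x j) * interaction \<gamma> I x\<bar>
      = \<bar>\<Prod>k\<in>S. x k\<bar> * \<bar>interaction \<gamma> I x / (x i - x j)\<bar>"
    by (simp add: abs_mult)
  also have "\<dots> \<le> (\<Prod>k\<in>I. 1 + \<bar>x k\<bar>) * (\<Prod>k\<in>I. (1 + \<bar>x k\<bar>) powr (2 * \<gamma> * card I))"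
    by (intro mult_mono prod_le_prod_growth I interaction_div_bound \<gamma> prod_nonneg) auto
  also have "\<dots> = (\<Prod>k\<in>I. (1 + \<bar>x k\<bar>) powr (1 + 2 * \<gamma> * card I))"
    by (simp add: prod.distrib[symmetric] powr_add)
  finally show "\<bar>(\<Prod>k\<in>S. x k) / (x i - x j) * interaction \<gamma> I x\<bar>
      \<le> (\<Prod>k\<in>I. (1 + \<bar>x k\<bar>) powr (1 + 2 * \<gamma> * card I))" .
qed (use I measurable_monomial[OF I(2)] in \<open>auto intro!: borel_measurable_divide borel_measurable_diff\<close>)

text \<open>Writing the derivative as a quotient by \<open>y - a\<close> keeps it valid at \<open>y = a\<close>, where both sides vanish because
\<open>c > 1\<close> and division by zero is zero.\<close>

lemma has_real_derivative_abs_powr: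
  fixes c :: real
  assumes c: "c > 1"
  shows "((\<lambda>y. \<bar>y - a\<bar> powr c) has_real_derivative c * \<bar>y - a\<bar> powr c / (y - a)) (at y)"
proof -
  consider "y > a" | "y < a" | "y = a" by linarith
  then show ?thesis
  proof cases
    case 1
    have "((\<lambda>y. (y - a) powr c) has_real_derivative c * \<bar>y - a\<bar> powr c / (y - a)) (at y)"
      using 1 by (auto intro!: derivative_eq_intros simp: powr_diff)
    then show ?thesis
      by (rule has_field_derivative_transform_within_open[of _ _ _ "{a<..}"]) (use 1 in auto)
  next
    case 2
    have "((\<lambda>y. (a - y) powr c) has_real_derivative c * \<bar>y - a\<bar> powr c / (y - a)) (at y)"
      using 2 by (auto intro!: derivative_eq_intros simp: powr_diff divide_simps) (simp add: algebra_simps)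
    then show ?thesis
      by (rule has_field_derivative_transform_within_open[of _ _ _ "{..<a}"]) (use 2 in auto)
  next
    case 3
    have "((\<lambda>h. \<bar>h\<bar> powr c / h) \<longlongrightarrow> 0) (at (0::real))"
    proof (rule Lim_null_comparison)
      show "\<forall>\<^sub>F h in at 0. norm (\<bar>h\<bar> powr c / h) \<le> \<bar>h\<bar> powr (c - 1)"
        by (auto simp: powr_diff abs_mult eventually_at_filter)
      have "((\<lambda>h::real. \<bar>h\<bar>) \<longlongrightarrow> 0) (at 0)" by (auto intro!: tendsto_eq_intros)
      then show "((\<lambda>h::real. \<bar>h\<bar> powr (c - 1)) \<longlongrightarrow> 0) (at 0)"
        using c by (intro tendsto_zero_powrI[where b = "c - 1"]) auto
    qed
    then show ?thesis using 3 c by (simp add: DERIV_def)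
  qed
qed

text \<open>The logarithmic derivative is the formula away from the points \<open>x\<^sub>j\<close>. At such a point the product and its
derivative are both zero, so the formula persists without exceptional points.\<close>

lemma has_real_derivative_repulsion:
  assumes J: "finite J" and c: "c > 1"
  shows "(repulsion c J x has_real_derivative repulsion c J x y * (\<Sum>j\<in>J. c / (y - x j))) (at y)"
  using J unfolding repulsion_def
proof (induction J rule: finite_induct)
  case (insert j J)
  show ?case using insert.hyps
      DERIV_mult[OF has_real_derivative_abs_powr[OF c, of "x j" y] insert.IH]
    by (simp add: algebra_simps)
qed simp

lemma continuous_on_repulsion: "finite J \<Longrightarrow> c > 1 \<Longrightarrow> continuous_on A (repulsion c J x)"
  using has_real_derivative_repulsion[THEN DERIV_isCont] by (intro continuous_at_imp_continuous_on) auto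

lemma measurable_repulsion [measurable]: "repulsion c J x \<in> borel_measurable borel"
  unfolding repulsion_def by measurable

lemma repulsion_growth:
  fixes c :: real
  shows "(\<Prod>k\<in>J. ((1 + \<bar>y\<bar>) * (1 + \<bar>x k\<bar>)) powr c)
      = (\<Prod>k\<in>J. (1 + \<bar>x k\<bar>) powr c) * (1 + \<bar>y\<bar>) powr (c * card J)"
  by (simp add: powr_mult prod.distrib powr_power mult.commute)

lemma integral_derivative_halfline:
  fixes F f :: "real \<Rightarrow> real"
  assumes cont: "continuous_on {0..} F"
    and deriv: "\<And>y. y > 0 \<Longrightarrow> (F has_real_derivative f y) (at y)"
    and int: "integrable lborel (\<lambda>y. indicator {0<..} y * f y)"
    and lim: "(F \<longlongrightarrow> 0) at_top"
  shows "(LINT y|lborel. indicator {0<..} y * f y) = - F 0"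
proof -
  define g where "g = (\<lambda>y. indicator {0<..} y * f y)"
  have int_g: "integrable lborel g" using int by (simp add: g_def)
  have eq: "(LINT y|lborel. indicator {..T} y *\<^sub>R g y) = F T - F 0" if "T > 0" for T
  proof -
    have si: "set_integrable lborel {0..T} g"
      unfolding set_integrable_def using int_g by (intro integrable_mult_indicator) auto
    have "(LINT y|lborel. indicator {..T} y *\<^sub>R g y) = (LINT y:{0..T}|lborel. g y)"
      unfolding set_lebesgue_integral_def
      by (intro Bochner_Integration.integral_cong) (auto simp: g_def indicator_def)
    also have "\<dots> = integral {0..T} g" by (rule set_borel_integral_eq_integral(2)[OF si])
    also have "\<dots> = F T - F 0"
    proof (rule integral_unique, rule fundamental_theorem_of_calculus_interior)
      show "continuous_on {0..T} F" by (rule continuous_on_subset[OF cont]) auto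
      fix y assume y: "y \<in> {0<..<T}"
      then show "(F has_vector_derivative g y) (at y)"
        using deriv[of y] by (simp add: g_def has_real_derivative_iff_has_vector_derivative)
    qed (use that in auto)
    finally show ?thesis .
  qed
  have "((\<lambda>T. LINT y|lborel. indicator {..T} y *\<^sub>R g y) \<longlongrightarrow> (LINT y|lborel. g y)) at_top"
    by (rule tendsto_integral_at_top[OF _ int_g]) simp
  moreover have "((\<lambda>T. LINT y|lborel. indicator {..T} y *\<^sub>R g y) \<longlongrightarrow> 0 - F 0) at_top"
  proof (rule Lim_transform_eventually)
    show "((\<lambda>T. F T - F 0) \<longlongrightarrow> 0 - F 0) at_top" by (intro tendsto_intros lim)
    show "\<forall>\<^sub>F T in at_top. F T - F 0 = (LINT y|lborel. indicator {..T} y *\<^sub>R g y)"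
      using eventually_gt_at_top[of 0] by eventually_elim (rule eq[symmetric])
  qed
  ultimately have "(LINT y|lborel. g y) = 0 - F 0" by (rule tendsto_unique[rotated]) simp
  then show ?thesis by (simp add: g_def)
qed

lemma integrable_gamma_weight_mult:
  assumes a: "a \<ge> 0" and q [measurable]: "q \<in> borel_measurable borel"
    and bound: "\<And>y. \<bar>q y\<bar> \<le> C * (1 + \<bar>y\<bar>) powr m"
  shows "integrable lborel (\<lambda>y. gamma_weight a y * q y)"
proof (rule Bochner_Integration.integrable_bound)
  show "integrable lborel (\<lambda>y::real. C * ((1 + \<bar>y\<bar>) powr (m + a) * exp (- 1 * \<bar>y\<bar>)))"
    by (intro integrable_mult_right integrable_growth_exp) auto
  have "norm (gamma_weight a y * q y) \<le> C * ((1 + \<bar>y\<bar>) powr (m + a) * exp (- 1 * \<bar>y\<bar>))" for y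
  proof -
    have "norm (gamma_weight a y * q y) = gamma_weight a y * \<bar>q y\<bar>"
      using gamma_weight_nonneg[of a y] by (simp add: abs_mult)
    also have "\<dots> \<le> ((1 + \<bar>y\<bar>) powr a * exp (- \<bar>y\<bar>)) * (C * (1 + \<bar>y\<bar>) powr m)"
      by (intro mult_mono gamma_weight_bound a bound) auto
    also have "\<dots> = C * ((1 + \<bar>y\<bar>) powr (m + a) * exp (- 1 * \<bar>y\<bar>))" by (simp add: powr_add)
    finally show ?thesis .
  qed
  then show "AE y in lborel. norm (gamma_weight a y * q y)
      \<le> norm (C * ((1 + \<bar>y\<bar>) powr (m + a) * exp (- 1 * \<bar>y\<bar>)))"
    by (intro AE_I2) (metis abs_ge_self order_trans real_norm_def)
qed simp

context
  fixes J :: "nat set" and \<gamma> a :: real and x :: "nat \<Rightarrow> real"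
  assumes J: "finite J" and \<gamma>: "\<gamma> \<ge> 1" and a: "a \<ge> 0"
begin

lemma repulsion_poly_bound:
  obtains C m where "C \<ge> 0" "m \<ge> 0" "\<And>y. repulsion (2 * \<gamma>) J x y \<le> C * (1 + \<bar>y\<bar>) powr m"
    "\<And>y j. j \<in> J \<Longrightarrow> \<bar>repulsion (2 * \<gamma>) J x y / (y - x j)\<bar> \<le> C * (1 + \<bar>y\<bar>) powr m"
  using repulsion_bound[of "2 * \<gamma>" J x] repulsion_div_bound[OF J, of _ "2 * \<gamma>" x] \<gamma>
  by (intro that[of "\<Prod>k\<in>J. (1 + \<bar>x k\<bar>) powr (2 * \<gamma>)" "2 * \<gamma> * card J"])
     (auto simp: repulsion_growth[symmetric] intro!: prod_nonneg)

lemma integrable_gamma_weight_repulsion: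
  assumes "e \<in> {0, 1::nat}"
  shows "integrable lborel (\<lambda>y. gamma_weight a y * (y ^ e * repulsion (2 * \<gamma>) J x y))" (is ?A)
    and "j \<in> J \<Longrightarrow> integrable lborel (\<lambda>y. gamma_weight a y * (y ^ e * (repulsion (2 * \<gamma>) J x y / (y - x j))))" (is "_ \<Longrightarrow> ?B")
proof -
  obtain C m where C: "C \<ge> 0" "m \<ge> 0" and
    b: "\<And>y. repulsion (2 * \<gamma>) J x y \<le> C * (1 + \<bar>y\<bar>) powr m"
    "\<And>y j. j \<in> J \<Longrightarrow> \<bar>repulsion (2 * \<gamma>) J x y / (y - x j)\<bar> \<le> C * (1 + \<bar>y\<bar>) powr m"
    by (rule repulsion_poly_bound) blast
  have e: "\<bar>y ^ e\<bar> \<le> 1 + \<bar>y\<bar>" for y :: real using assms by auto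
  have step: "\<bar>y ^ e * r\<bar> \<le> C * (1 + \<bar>y\<bar>) powr (1 + m)" if "\<bar>r\<bar> \<le> C * (1 + \<bar>y\<bar>) powr m" for y r :: real
  proof -
    have "\<bar>y ^ e * r\<bar> \<le> (1 + \<bar>y\<bar>) * (C * (1 + \<bar>y\<bar>) powr m)"
      unfolding abs_mult by (intro mult_mono e that) auto
    then show ?thesis by (simp add: powr_add algebra_simps)
  qed
  have nn: "repulsion (2 * \<gamma>) J x y \<ge> 0" for y unfolding repulsion_def by (intro prod_nonneg) auto
  show ?A
    by (rule integrable_gamma_weight_mult[OF a, where C = C and m = "1 + m"])
       (use step b(1) nn in \<open>auto\<close>)
  show ?B if "j \<in> J"
    by (rule integrable_gamma_weight_mult[OF a, where C = C and m = "1 + m"])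
       (use step[OF b(2)[OF that]] in \<open>auto simp: mult.assoc\<close>)
qed

lemma repulsion_exp_tendsto_0:
  "((\<lambda>y. y powr p * exp (- y) * repulsion (2 * \<gamma>) J x y) \<longlongrightarrow> 0) at_top"
proof -
  obtain C m where C: "C \<ge> 0" "m \<ge> 0" and
    b: "\<And>y. repulsion (2 * \<gamma>) J x y \<le> C * (1 + \<bar>y\<bar>) powr m"
    by (rule repulsion_poly_bound) blast
  have nn: "repulsion (2 * \<gamma>) J x y \<ge> 0" for y unfolding repulsion_def by (intro prod_nonneg) auto
  have "((\<lambda>y::real. y powr p * exp (- y) * (1 + y) powr m) \<longlongrightarrow> 0) at_top" by real_asymp
  from tendsto_mult_right_zero[OF this, of C]
  have lim: "((\<lambda>y. C * (y powr p * exp (- y) * (1 + y) powr m)) \<longlongrightarrow> 0) at_top" .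
  show ?thesis
  proof (rule Lim_null_comparison[OF _ lim])
    show "\<forall>\<^sub>F y in at_top. norm (y powr p * exp (- y) * repulsion (2 * \<gamma>) J x y)
        \<le> C * (y powr p * exp (- y) * (1 + y) powr m)"
      using eventually_ge_at_top[of 0]
    proof eventually_elim
      case (elim y)
      have "y powr p * exp (- y) * repulsion (2 * \<gamma>) J x y \<le> y powr p * exp (- y) * (C * (1 + y) powr m)"
        using b[of y] elim by (intro mult_left_mono) auto
      then show ?case using nn[of y] by (simp add: abs_mult algebra_simps)
    qed
  qed
qed

text \<open>The integrand is the derivative of \<open>y powr (a + 1) * exp (- y)\<close> times the repulsion; that function vanishes
at \<open>0\<close> and at infinity.\<close>

lemma integral_laguerre_slice:
  "(LINT y|lborel. gamma_weight a y * (repulsion (2 * \<gamma>) J x y * (a + 1 - y + (\<Sum>j\<in>J. 2 * \<gamma> * y / (y - x j))))) = 0"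
proof -
  let ?R = "repulsion (2 * \<gamma>) J x"
  define F where "F = (\<lambda>y. y powr (a + 1) * exp (- y) * ?R y)"
  define f where "f = (\<lambda>y. y powr a * exp (- y) * (?R y * (a + 1 - y + (\<Sum>j\<in>J. 2 * \<gamma> * y / (y - x j)))))"
  have fe: "indicator {0<..} y * f y = gamma_weight a y * (?R y * (a + 1 - y + (\<Sum>j\<in>J. 2 * \<gamma> * y / (y - x j))))" for y
    by (simp add: f_def gamma_weight_def)
  have "(LINT y|lborel. indicator {0<..} y * f y) = - F 0"
  proof (rule integral_derivative_halfline)
    show "continuous_on {0..} F" unfolding F_def
      using a \<gamma> J by (intro continuous_intros continuous_on_powr' continuous_on_repulsion) auto
    show "(F has_real_derivative f y) (at y)" if "y > 0" for y
    proof -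
      have S: "(\<Sum>j\<in>J. 2 * \<gamma> * y / (y - x j)) = y * (\<Sum>j\<in>J. 2 * \<gamma> / (y - x j))"
        by (simp add: sum_distrib_left algebra_simps)
      have "(F has_real_derivative ((a + 1) * y powr a * exp (- y) - y powr (a + 1) * exp (- y)) * ?R y
           + y powr (a + 1) * exp (- y) * (?R y * (\<Sum>j\<in>J. 2 * \<gamma> / (y - x j)))) (at y)"
        unfolding F_def using that \<gamma> has_real_derivative_repulsion[OF J, of "2 * \<gamma>" x y]
        by (auto intro!: derivative_eq_intros simp: algebra_simps)
      also have "((a + 1) * y powr a * exp (- y) - y powr (a + 1) * exp (- y)) * ?R y
           + y powr (a + 1) * exp (- y) * (?R y * (\<Sum>j\<in>J. 2 * \<gamma> / (y - x j))) = f y"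
        using that unfolding f_def S by (simp add: powr_add algebra_simps)
      finally show ?thesis .
    qed
    have "integrable lborel (\<lambda>y. (a + 1) * (gamma_weight a y * (y ^ 0 * ?R y)) - gamma_weight a y * (y ^ 1 * ?R y)
        + (\<Sum>j\<in>J. 2 * \<gamma> * (gamma_weight a y * (y ^ 1 * (?R y / (y - x j))))))"
      by (intro Bochner_Integration.integrable_add Bochner_Integration.integrable_diff
          Bochner_Integration.integrable_sum integrable_mult_right integrable_gamma_weight_repulsion) auto
    then show "integrable lborel (\<lambda>y. indicator {0<..} y * f y)"
      unfolding fe by (rule Bochner_Integration.integrable_cong[THEN iffD1, rotated -1])
         (auto simp: algebra_simps sum_distrib_left sum_distrib_right sum_divide_distrib)
    show "(F \<longlongrightarrow> 0) at_top" unfolding F_def by (rule repulsion_exp_tendsto_0)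
  qed
  then show ?thesis using a by (simp add: fe F_def)
qed

end

text \<open>The analogue without the factor \<open>y\<close>, for \<open>a = 0\<close>: the primitive is now nonzero at \<open>y = 0\<close>.\<close>

lemma integral_laguerre_slice_boundary:
  assumes J: "finite J" and \<gamma>: "\<gamma> \<ge> 1"
  shows "(LINT y|lborel. gamma_weight 0 y * (repulsion (2 * \<gamma>) J x y * (- 1 + (\<Sum>j\<in>J. 2 * \<gamma> / (y - x j)))))
     = - repulsion (2 * \<gamma>) J x 0"
proof -
  let ?R = "repulsion (2 * \<gamma>) J x"
  define F where "F = (\<lambda>y. exp (- y) * ?R y)"
  define f where "f = (\<lambda>y. exp (- y) * (?R y * (- 1 + (\<Sum>j\<in>J. 2 * \<gamma> / (y - x j)))))"
  have fe: "indicator {0<..} y * f y = gamma_weight 0 y * (?R y * (- 1 + (\<Sum>j\<in>J. 2 * \<gamma> / (y - x j))))" for y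
    by (simp add: f_def gamma_weight_def indicator_def)
  have "(LINT y|lborel. indicator {0<..} y * f y) = - F 0"
  proof (rule integral_derivative_halfline)
    show "continuous_on {0..} F" unfolding F_def
      using \<gamma> J by (intro continuous_intros continuous_on_repulsion) auto
    show "(F has_real_derivative f y) (at y)" if "y > 0" for y
      unfolding F_def f_def using \<gamma> has_real_derivative_repulsion[OF J, of "2 * \<gamma>" x y]
      by (auto intro!: derivative_eq_intros simp: algebra_simps)
    have "integrable lborel (\<lambda>y. - (gamma_weight 0 y * (y ^ 0 * ?R y))
        + (\<Sum>j\<in>J. 2 * \<gamma> * (gamma_weight 0 y * (y ^ 0 * (?R y / (y - x j))))))"
      by (intro Bochner_Integration.integrable_add Bochner_Integration.integrable_minus
          Bochner_Integration.integrable_sum integrable_mult_right integrable_gamma_weight_repulsion J \<gamma>) auto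
    then show "integrable lborel (\<lambda>y. indicator {0<..} y * f y)"
      unfolding fe by (rule Bochner_Integration.integrable_cong[THEN iffD1, rotated -1])
         (auto simp: algebra_simps sum_distrib_left sum_distrib_right sum_divide_distrib)
    have "(F \<longlongrightarrow> 0) at_top \<longleftrightarrow> ((\<lambda>y. y powr 0 * exp (- y) * ?R y) \<longlongrightarrow> 0) at_top"
      unfolding F_def by (intro tendsto_cong eventually_mono[OF eventually_gt_at_top[of 0]]) auto
    then show "(F \<longlongrightarrow> 0) at_top" using repulsion_exp_tendsto_0[OF J \<gamma>, of 0] by blast
  qed
  then show ?thesis by (simp add: fe F_def)
qed

section \<open>Aomoto's recursion for the Laguerre moments\<close>

definition laguerre_moment :: "real \<Rightarrow> real \<Rightarrow> nat set \<Rightarrow> nat set \<Rightarrow> real" where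
  "laguerre_moment a \<gamma> I S = (LINT x|lborel_on I. (\<Prod>k\<in>S. x k) * laguerre a \<gamma> I x)"

abbreviation laguerre_integral :: "real \<Rightarrow> real \<Rightarrow> nat set \<Rightarrow> real" where
  "laguerre_integral a \<gamma> I \<equiv> laguerre_moment a \<gamma> I {}"

lemma laguerre_fun_upd_insert:
  assumes J: "finite J" "i \<notin> J"
  shows "laguerre a \<gamma> (insert i J) (x(i := y)) = laguerre a \<gamma> J x * (gamma_weight a y * repulsion (2 * \<gamma>) J x y)"
proof -
  have "(\<Prod>k\<in>J. gamma_weight a ((x(i := y)) k)) = (\<Prod>k\<in>J. gamma_weight a (x k))"
    using J by (intro prod.cong) auto
  then show ?thesis
    using J unfolding laguerre_def interaction_insert[OF J] interaction_fun_upd[OF J(2)] repulsion_fun_upd[OF J(2)]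
    by (simp add: algebra_simps)
qed

lemma laguerre_transpose:
  assumes "finite I" "i \<in> I" "j \<in> I"
  shows "laguerre a \<gamma> I (x \<circ> Transposition.transpose i j) = laguerre a \<gamma> I x"
proof -
  have "(\<Prod>k\<in>I. gamma_weight a ((x \<circ> Transposition.transpose i j) k)) = (\<Prod>k\<in>I. gamma_weight a (x k))"
    using prod.permute[OF permutes_swap_id[of i I j], of "\<lambda>k. gamma_weight a (x k)"] assms
    by (simp add: comp_def)
  then show ?thesis using assms by (simp add: laguerre_def interaction_transpose)
qed

lemma laguerre_eq_0:
  "finite I \<Longrightarrow> i \<in> I \<Longrightarrow> j \<in> I \<Longrightarrow> i \<noteq> j \<Longrightarrow> x i = x j \<Longrightarrow> laguerre a \<gamma> I x = 0"
  by (simp add: laguerre_def interaction_eq_0)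

text \<open>In \<open>\<Prod>\<^sub>S x \<cdot> x\<^sub>i / (x\<^sub>i - x\<^sub>j)\<close> exchanging \<open>i\<close> and \<open>j\<close> either changes the sign (if \<open>j \<in> S\<close>, so that
  the numerator is symmetric) or gives a second term that adds up with the first to \<open>\<Prod>\<^sub>S x\<close>.\<close>

lemma laguerre_quotient_moment:
  assumes I: "finite I" "i \<in> I" "j \<in> I" "i \<noteq> j" and S: "S \<subseteq> I" "i \<notin> S"
    and a: "a \<ge> 0" and \<gamma>: "\<gamma> \<ge> 1"
  shows "(LINT x|lborel_on I. (\<Prod>k\<in>insert i S. x k) / (x i - x j) * laguerre a \<gamma> I x)
           = (if j \<in> S then 0 else laguerre_moment a \<gamma> I S / 2)"
proof -
  let ?\<tau> = "Transposition.transpose i j"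
  define f where "f x = (\<Prod>k\<in>insert i S. x k) / (x i - x j) * laguerre a \<gamma> I x" for x :: "nat \<Rightarrow> real"
  have fS: "finite S" using I S finite_subset by blast
  have int: "integrable (lborel_on I) f"
    unfolding f_def by (rule integrable_laguerre_quotient) (use assms in auto)
  have sw: "(LINT x|lborel_on I. f (x \<circ> ?\<tau>)) = (LINT x|lborel_on I. f x)"
    by (rule integral_lborel_on_transpose[OF I(1-3)]) (use int in auto)
  have f\<tau>: "f (x \<circ> ?\<tau>) = (\<Prod>k\<in>insert i S. x (?\<tau> k)) / (x j - x i) * laguerre a \<gamma> I x" for x
    unfolding f_def laguerre_transpose[OF I(1-3)] by simp
  show ?thesis
  proof (cases "j \<in> S")
    case True
    have "(\<Prod>k\<in>insert i S. x (?\<tau> k)) = (\<Prod>k\<in>insert i S. x k)" for x :: "nat \<Rightarrow> real"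
      using prod.permute[OF permutes_swap_id[of i "insert i S" j], of x] True by (simp add: comp_def)
    then have "f (x \<circ> ?\<tau>) = - f x" for x
      unfolding f\<tau> unfolding f_def by (simp add: minus_divide_right[symmetric] divide_minus_left
          minus_diff_eq[of "x i" "x j", symmetric] del: minus_diff_eq)
    then have "(LINT x|lborel_on I. f x) = - (LINT x|lborel_on I. f x)"
      using sw by simp
    then show ?thesis using True by (simp add: f_def)
  next
    case False
    have num: "(\<Prod>k\<in>insert i S. x (?\<tau> k)) = x j * (\<Prod>k\<in>S. x k)" for x :: "nat \<Rightarrow> real"
    proof -
      have "(\<Prod>k\<in>S. x (?\<tau> k)) = (\<Prod>k\<in>S. x k)"
        using S False by (intro prod.cong) (auto simp: Transposition.transpose_def)
      then show ?thesis using S fS by simp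
    qed
    have "f x + f (x \<circ> ?\<tau>) = (\<Prod>k\<in>S. x k) * laguerre a \<gamma> I x" for x
    proof (cases "x i = x j")
      case True then show ?thesis using I by (simp add: f_def f\<tau> laguerre_eq_0)
    next
      case neq: False
      have "f x + f (x \<circ> ?\<tau>) = ((x i) / (x i - x j) + x j / (x j - x i)) * ((\<Prod>k\<in>S. x k) * laguerre a \<gamma> I x)"
        unfolding f\<tau> num unfolding f_def using S fS
        by (simp add: algebra_simps)
      also have "x j / (x j - x i) = - (x j / (x i - x j))"
        by (metis minus_diff_eq minus_divide_right)
      also have "x i / (x i - x j) + - (x j / (x i - x j)) = 1"
        using neq by (simp add: diff_divide_distrib[symmetric])
      finally show ?thesis by (simp only: mult_1)
    qed
    moreover have "integrable (lborel_on I) (\<lambda>x. f (x \<circ> ?\<tau>))"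
    proof -
      have "(\<lambda>x. f (x \<circ> ?\<tau>)) = (\<lambda>x. (\<Prod>k\<in>S. x k) * laguerre a \<gamma> I x - f x)"
        using calculation by (auto simp: fun_eq_iff algebra_simps)
      then show ?thesis
        using int integrable_laguerre_monomial[OF I(1) S(1) a, of \<gamma>] \<gamma> by simp
    qed
    ultimately have "2 * (LINT x|lborel_on I. f x) = laguerre_moment a \<gamma> I S"
      unfolding laguerre_moment_def using sw int
        Bochner_Integration.integral_add[OF int \<open>integrable (lborel_on I) (\<lambda>x. f (x \<circ> ?\<tau>))\<close>] by simp
    then show ?thesis using False by (simp add: f_def)
  qed
qed

text \<open>Aomoto's step. Integrating by parts in the coordinate \<open>i\<close> gives
\<open>(a + 1) J(S) - J(S \<union> {i})\<close> plus one quotient moment for each other coordinate \<open>j\<close>; by symmetry that moment is \<open>0\<close>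
for \<open>j \<in> S\<close> and half of \<open>J(S)\<close> for each of the remaining \<open>card I - 1 - card S\<close> coordinates.\<close>

lemma laguerre_moment_insert:
  assumes I: "finite I" "i \<in> I" and S: "S \<subseteq> I" "i \<notin> S" and a: "a \<ge> 0" and \<gamma>: "\<gamma> \<ge> 1"
  shows "laguerre_moment a \<gamma> I (insert i S)
           = (a + 1 + \<gamma> * real (card I - 1 - card S)) * laguerre_moment a \<gamma> I S"
proof -
  define J where "J = I - {i}"
  have J: "finite J" "i \<notin> J" "S \<subseteq> J" and IJ: "I = insert i J" using I S by (auto simp: J_def)
  have fS: "finite S" using J finite_subset by blast
  define p where "p x = (\<Prod>k\<in>S. x k)" for x :: "nat \<Rightarrow> real"
  define q where "q j x = (\<Prod>k\<in>insert i S. x k) / (x i - x j) * laguerre a \<gamma> I x" for j and x :: "nat \<Rightarrow> real"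
  define D where "D x = (a + 1) * (p x * laguerre a \<gamma> I x) - (\<Prod>k\<in>insert i S. x k) * laguerre a \<gamma> I x
      + (\<Sum>j\<in>J. 2 * \<gamma> * q j x)" for x
  have int1: "integrable (lborel_on I) (\<lambda>x. p x * laguerre a \<gamma> I x)"
    unfolding p_def using I S a \<gamma> by (intro integrable_laguerre_monomial) auto
  have int2: "integrable (lborel_on I) (\<lambda>x. (\<Prod>k\<in>insert i S. x k) * laguerre a \<gamma> I x)"
    using I S a \<gamma> by (intro integrable_laguerre_monomial) auto
  have int3: "integrable (lborel_on I) (q j)" if "j \<in> J" for j
    unfolding q_def using I S a \<gamma> that IJ J by (intro integrable_laguerre_quotient) auto
  have intD: "integrable (lborel_on I) D"
    unfolding D_def using int1 int2 int3
    by (intro Bochner_Integration.integrable_add Bochner_Integration.integrable_diff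
          Bochner_Integration.integrable_sum integrable_mult_right) auto
  have D_slice: "D (x(i := y)) = (p x * laguerre a \<gamma> J x) * (gamma_weight a y *
      (repulsion (2 * \<gamma>) J x y * (a + 1 - y + (\<Sum>j\<in>J. 2 * \<gamma> * y / (y - x j)))))" for x y
  proof -
    have p: "p (x(i := y)) = p x" unfolding p_def using S by (intro prod.cong) auto
    have p': "(\<Prod>k\<in>insert i S. (x(i := y)) k) = y * p x"
      using fS S p unfolding p_def by (simp add: prod.insert)
    have s: "(\<Sum>j\<in>J. 2 * \<gamma> * (y * p x / (y - (x(i := y)) j) * laguerre a \<gamma> I (x(i := y))))
        = (p x * laguerre a \<gamma> I (x(i := y))) * (\<Sum>j\<in>J. 2 * \<gamma> * y / (y - x j))"
      using J unfolding sum_distrib_left by (intro sum.cong) (auto simp: algebra_simps)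
    have "D (x(i := y)) = (p x * laguerre a \<gamma> I (x(i := y))) * (a + 1 - y + (\<Sum>j\<in>J. 2 * \<gamma> * y / (y - x j)))"
      unfolding D_def q_def p p' fun_upd_same s by (simp add: algebra_simps)
    then show ?thesis unfolding IJ laguerre_fun_upd_insert[OF J(1,2)] by (simp add: algebra_simps)
  qed
  \<comment> \<open>\<open>D\<close> is, up to a factor free of \<open>x i\<close>, the integrand of \<open>integral_laguerre_slice\<close>.\<close>
  have "(LINT x|lborel_on I. D x) = 0"
    using intD unfolding IJ
    by (subst lborel_product.product_integral_insert[OF J(1,2)])
       (simp_all add: D_slice[unfolded IJ] integral_laguerre_slice[OF J(1) \<gamma> a])
  moreover have "(LINT x|lborel_on I. D x) = (a + 1) * laguerre_moment a \<gamma> I S - laguerre_moment a \<gamma> I (insert i S)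
      + (\<Sum>j\<in>J. 2 * \<gamma> * (LINT x|lborel_on I. q j x))"
    unfolding D_def laguerre_moment_def p_def[symmetric] using int1 int2 int3
    by (simp add: Bochner_Integration.integral_sum)
  moreover have "(\<Sum>j\<in>J. 2 * \<gamma> * (LINT x|lborel_on I. q j x)) = \<gamma> * real (card I - 1 - card S) * laguerre_moment a \<gamma> I S"
  proof -
    have "(\<Sum>j\<in>J. 2 * \<gamma> * (LINT x|lborel_on I. q j x)) = (\<Sum>j\<in>J. if j \<in> S then 0 else \<gamma> * laguerre_moment a \<gamma> I S)"
      unfolding q_def
      by (rule sum.cong[OF refl], subst laguerre_quotient_moment) (use I S J IJ a \<gamma> in auto)
    also have "\<dots> = (\<Sum>j\<in>J - S. \<gamma> * laguerre_moment a \<gamma> I S)"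
      using J by (intro sum.mono_neutral_cong_right) auto
    also have "\<dots> = \<gamma> * real (card I - 1 - card S) * laguerre_moment a \<gamma> I S"
      using J fS IJ by (simp add: card_Diff_subset)
    finally show ?thesis .
  qed
  ultimately show ?thesis by (simp add: algebra_simps)
qed

lemma laguerre_moment_eq:
  assumes I: "finite I" and a: "a \<ge> 0" and \<gamma>: "\<gamma> \<ge> 1" and S: "S \<subseteq> I"
  shows "laguerre_moment a \<gamma> I S = (\<Prod>r<card S. a + 1 + \<gamma> * real (card I - 1 - r)) * laguerre_integral a \<gamma> I"
proof -
  have "finite S" using S I by (rule finite_subset)
  then show ?thesis using S
  proof (induction S rule: finite_induct)
    case (insert i S)
    then have "laguerre_moment a \<gamma> I (insert i S)
           = (a + 1 + \<gamma> * real (card I - 1 - card S)) * laguerre_moment a \<gamma> I S"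
      using I a \<gamma> by (intro laguerre_moment_insert) auto
    with insert show ?case by (simp add: algebra_simps)
  qed simp
qed

lemma laguerre_Suc_parameter:
  "(\<Prod>k\<in>I. x k) * laguerre a \<gamma> I x = laguerre (a + 1) \<gamma> I x"
proof -
  have "x k * gamma_weight a (x k) = gamma_weight (a + 1) (x k)" for k
    by (auto simp: gamma_weight_def powr_add indicator_def)
  then show ?thesis unfolding laguerre_def by (simp add: prod.distrib[symmetric] mult.assoc[symmetric])
qed

text \<open>Multiplying the weight by all coordinates raises \<open>a\<close> by one, so this is Aomoto's step iterated from \<open>{}\<close>
to \<open>I\<close>.\<close>

theorem laguerre_integral_Suc:
  assumes I: "finite I" and a: "a \<ge> 0" and \<gamma>: "\<gamma> \<ge> 1"
  shows "laguerre_integral (a + 1) \<gamma> I = (\<Prod>r<card I. a + 1 + \<gamma> * real r) * laguerre_integral a \<gamma> I"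
proof -
  have "laguerre_integral (a + 1) \<gamma> I = laguerre_moment a \<gamma> I I"
    unfolding laguerre_moment_def by (simp add: laguerre_Suc_parameter)
  also have "\<dots> = (\<Prod>r<card I. a + 1 + \<gamma> * real (card I - 1 - r)) * laguerre_integral a \<gamma> I"
    by (rule laguerre_moment_eq[OF I a \<gamma> order_refl])
  also have "(\<Prod>r<card I. a + 1 + \<gamma> * real (card I - 1 - r)) = (\<Prod>r<card I. a + 1 + \<gamma> * real r)"
    by (rule prod.reindex_bij_witness[where i = "\<lambda>r. card I - 1 - r" and j = "\<lambda>r. card I - 1 - r"]) auto
  finally show ?thesis .
qed

text \<open>For \<open>a = 0\<close> the density does not vanish on the boundary, and the same integration by parts
  turns the boundary value into an integral with one variable less.\<close>

theorem laguerre_integral_0_insert: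
  assumes J: "finite J" "i \<notin> J" and \<gamma>: "\<gamma> \<ge> 1"
  shows "laguerre_integral 0 \<gamma> (insert i J) = laguerre_integral (2 * \<gamma>) \<gamma> J"
proof -
  define I where "I = insert i J"
  have I: "finite I" "i \<in> I" using J by (auto simp: I_def)
  define q where "q j x = 1 / (x i - x j) * laguerre 0 \<gamma> I x" for j and x :: "nat \<Rightarrow> real"
  define D where "D x = - laguerre 0 \<gamma> I x + (\<Sum>j\<in>J. 2 * \<gamma> * q j x)" for x
  have int1: "integrable (lborel_on I) (laguerre 0 \<gamma> I)"
    using integrable_laguerre_monomial[OF I(1), of "{}" 0 \<gamma>] \<gamma> by simp
  have int3: "integrable (lborel_on I) (q j)" if "j \<in> J" for j
    using integrable_laguerre_quotient[OF I(1), of "{}" i j 0 \<gamma>] \<gamma> that J I unfolding q_def by (auto simp: I_def)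
  have intD: "integrable (lborel_on I) D"
    unfolding D_def using int1 int3
    by (intro Bochner_Integration.integrable_add Bochner_Integration.integrable_minus
          Bochner_Integration.integrable_sum integrable_mult_right) auto
  have D_slice: "D (x(i := y)) = laguerre 0 \<gamma> J x * (gamma_weight 0 y *
      (repulsion (2 * \<gamma>) J x y * (- 1 + (\<Sum>j\<in>J. 2 * \<gamma> / (y - x j)))))" for x y
  proof -
    have s: "(\<Sum>j\<in>J. 2 * \<gamma> * (1 / (y - (x(i := y)) j) * laguerre 0 \<gamma> I (x(i := y))))
        = laguerre 0 \<gamma> I (x(i := y)) * (\<Sum>j\<in>J. 2 * \<gamma> / (y - x j))"
      using J unfolding sum_distrib_left by (intro sum.cong) (auto simp: algebra_simps)
    have "D (x(i := y)) = laguerre 0 \<gamma> I (x(i := y)) * (- 1 + (\<Sum>j\<in>J. 2 * \<gamma> / (y - x j)))"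
      unfolding D_def q_def fun_upd_same s by (simp add: algebra_simps)
    then show ?thesis unfolding I_def laguerre_fun_upd_insert[OF J(1,2)] by (simp add: algebra_simps)
  qed
  have q0: "(LINT x|lborel_on I. q j x) = 0" if j: "j \<in> J" for j
  proof -
    have "q j (x \<circ> Transposition.transpose i j) = - q j x" for x
      unfolding q_def using I j
      by (simp add: laguerre_transpose I_def minus_divide_right[symmetric]
          minus_diff_eq[of "x i" "x j", symmetric] del: minus_diff_eq)
    moreover have "(LINT x|lborel_on I. q j (x \<circ> Transposition.transpose i j)) = (LINT x|lborel_on I. q j x)"
      by (rule integral_lborel_on_transpose) (use I j int3[OF j] in \<open>auto simp: I_def\<close>)
    ultimately have "(LINT x|lborel_on I. q j x) = - (LINT x|lborel_on I. q j x)" by simp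
    then show ?thesis by simp
  qed
  have "(LINT x|lborel_on I. D x) = - laguerre_integral 0 \<gamma> I"
    unfolding D_def laguerre_moment_def using int1 int3 q0
    by (simp add: Bochner_Integration.integral_sum)
  moreover have "(LINT x|lborel_on I. D x) = (LINT x|lborel_on J. laguerre 0 \<gamma> J x * (- repulsion (2 * \<gamma>) J x 0))"
    using intD unfolding I_def
    by (subst lborel_product.product_integral_insert[OF J(1,2)])
       (simp_all only: D_slice[unfolded I_def] integral_mult_right_zero integral_laguerre_slice_boundary[OF J(1) \<gamma>])
  moreover have "laguerre 0 \<gamma> J x * repulsion (2 * \<gamma>) J x 0 = laguerre (2 * \<gamma>) \<gamma> J x" for x
  proof -
    have "gamma_weight 0 (x j) * \<bar>0 - x j\<bar> powr (2 * \<gamma>) = gamma_weight (2 * \<gamma>) (x j)" for j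
      by (auto simp: gamma_weight_def indicator_def)
    then show ?thesis unfolding laguerre_def repulsion_def
      by (simp add: prod.distrib[symmetric] mult.commute mult.left_commute)
  qed
  ultimately show ?thesis unfolding I_def laguerre_moment_def by simp
qed

section \<open>From the Laguerre to the Hermite weight\<close>

lemma lborel_on_affine:
  assumes I: "finite I" and c: "c > 0"
  shows "lborel_on I = density (distr (lborel_on I) (lborel_on I) (\<lambda>x. \<lambda>i\<in>I. t + c * x i)) (\<lambda>_. ennreal (c ^ card I))"
    (is "_ = ?P")
proof (rule lborel_product.PiM_eqI[OF I, symmetric])
  let ?T = "\<lambda>x. \<lambda>i\<in>I. t + c * x i"
  have m: "?T \<in> measurable (lborel_on I) (lborel_on I)"
    by (rule measurable_restrict) (use measurable_coordinate in auto)
  fix A :: "nat \<Rightarrow> real set" assume A: "\<And>i. i \<in> I \<Longrightarrow> A i \<in> sets lborel"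
  let ?B = "\<lambda>i. (\<lambda>y. t + c * y) -` A i"
  have B: "?B i \<in> sets lborel" if "i \<in> I" for i
    using measurable_sets_borel[of "\<lambda>y. t + c * y" borel "A i"] A[OF that] by simp
  have vim: "?T -` Pi\<^sub>E I A \<inter> space (lborel_on I) = Pi\<^sub>E I ?B"
    by (auto simp: space_PiM PiE_def Pi_def extensional_def)
  have one: "emeasure lborel (A i) = ennreal c * emeasure lborel (?B i)" if "i \<in> I" for i
  proof -
    have "emeasure lborel (A i) = (\<integral>\<^sup>+x. indicator (A i) x \<partial>lborel)" using A[OF that] by simp
    also have "\<dots> = ennreal \<bar>c\<bar> * (\<integral>\<^sup>+x. indicator (A i) (t + c * x) \<partial>lborel)"
      using A[OF that] c by (intro nn_integral_real_affine) auto
    also have "(\<integral>\<^sup>+x. indicator (A i) (t + c * x) \<partial>lborel) = (\<integral>\<^sup>+x. indicator (?B i) x \<partial>lborel)"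
      by (intro nn_integral_cong) (auto simp: indicator_def)
    finally show ?thesis using B[OF that] c by simp
  qed
  have PA: "Pi\<^sub>E I A \<in> sets (lborel_on I)" using A I by (intro sets_PiM_I_finite) auto
  have "emeasure ?P (Pi\<^sub>E I A) = ennreal (c ^ card I) * emeasure (lborel_on I) (Pi\<^sub>E I ?B)"
    using PA m vim by (simp add: emeasure_density nn_integral_cmult_indicator emeasure_distr)
  also have "emeasure (lborel_on I) (Pi\<^sub>E I ?B) = (\<Prod>i\<in>I. emeasure lborel (?B i))"
    using B I by (intro lborel_product.emeasure_PiM) auto
  also have "ennreal (c ^ card I) * (\<Prod>i\<in>I. emeasure lborel (?B i)) = (\<Prod>i\<in>I. ennreal c * emeasure lborel (?B i))"
    using c by (simp add: prod.distrib ennreal_power)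
  also have "\<dots> = (\<Prod>i\<in>I. emeasure lborel (A i))" using one by (intro prod.cong) auto
  finally show "emeasure ?P (Pi\<^sub>E I A) = (\<Prod>i\<in>I. emeasure lborel (A i))" .
qed simp

lemma integral_lborel_on_affine:
  fixes f :: "(nat \<Rightarrow> real) \<Rightarrow> real"
  assumes I: "finite I" and c: "c > 0" and f [measurable]: "f \<in> borel_measurable (lborel_on I)"
  shows "(LINT x|lborel_on I. f x) = c ^ card I * (LINT x|lborel_on I. f (\<lambda>i\<in>I. t + c * x i))"
proof -
  let ?T = "\<lambda>x. \<lambda>i\<in>I. t + c * x i"
  have m: "?T \<in> measurable (lborel_on I) (lborel_on I)"
    by (rule measurable_restrict) (use measurable_coordinate in auto)
  have "(LINT x|lborel_on I. f x) = (LINT x|density (distr (lborel_on I) (lborel_on I) ?T) (\<lambda>_. ennreal (c ^ card I)). f x)"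
    using lborel_on_affine[OF I c, of t] by simp
  also have "\<dots> = (LINT x|distr (lborel_on I) (lborel_on I) ?T. c ^ card I * f x)"
    using c by (subst integral_density) auto
  also have "\<dots> = c ^ card I * (LINT x|lborel_on I. f (?T x))"
    by (subst integral_distr[OF m]) auto
  finally show ?thesis .
qed

text \<open>The one-particle weight around its maximum at \<open>a\<close>, normalized to have value \<open>1\<close> there, in a scale in which it
tends to the Gaussian \<open>exp (- \<kappa> y\<^sup>2 / 2)\<close>.\<close>

definition scaled_gamma_weight :: "real \<Rightarrow> real \<Rightarrow> real \<Rightarrow> real" where
  "scaled_gamma_weight \<kappa> a y = gamma_weight a (a + sqrt (a * \<kappa>) * y) / (a powr a * exp (- a))"

definition hermite_integral :: "real \<Rightarrow> real \<Rightarrow> nat set \<Rightarrow> real" where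
  "hermite_integral \<kappa> \<gamma> I = (LINT x|lborel_on I. (\<Prod>i\<in>I. exp (- \<kappa> * (x i)\<^sup>2 / 2)) * interaction \<gamma> I x)"

lemma sqrt_mult_eq_mult_sqrt_divide:
  assumes "a > 0"
  shows "sqrt (a * \<kappa>) = a * sqrt (\<kappa> / a)"
proof -
  have "a * sqrt (\<kappa> / a) = (a / sqrt a) * sqrt \<kappa>" by (simp add: real_sqrt_divide)
  also have "a / sqrt a = sqrt a" using assms by (intro real_div_sqrt) auto
  finally show ?thesis by (simp add: real_sqrt_mult)
qed

lemma scaled_gamma_weight_eq:
  assumes a: "a > 0" and \<kappa>: "\<kappa> > 0" and y: "y * sqrt (\<kappa> / a) > - 1"
  shows "scaled_gamma_weight \<kappa> a y = exp (a * (ln (1 + y * sqrt (\<kappa> / a)) - y * sqrt (\<kappa> / a)))"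
proof -
  let ?u = "y * sqrt (\<kappa> / a)"
  have e: "a + sqrt (a * \<kappa>) * y = a * (1 + ?u)"
    using a sqrt_mult_eq_mult_sqrt_divide[of a \<kappa>] by (simp add: algebra_simps)
  have p: "a * (1 + ?u) > 0" using a y by simp
  have "gamma_weight a (a * (1 + ?u)) = (a * (1 + ?u)) powr a * exp (- (a * (1 + ?u)))"
    using p by (simp add: gamma_weight_def)
  also have "\<dots> = (a powr a * exp (- a)) * ((1 + ?u) powr a * exp (- (a * ?u)))"
  proof -
    have "(a * (1 + ?u)) powr a = a powr a * (1 + ?u) powr a" by (rule powr_mult)
    moreover have "exp (- (a * (1 + ?u))) = exp (- a) * exp (- (a * ?u))"
      by (simp add: exp_add[symmetric] algebra_simps)
    ultimately show ?thesis by (simp only: mult_ac)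
  qed
  also have "(1 + ?u) powr a * exp (- (a * ?u)) = exp (a * (ln (1 + ?u) - ?u))"
    using y by (simp add: powr_def exp_add[symmetric] algebra_simps)
  finally show ?thesis unfolding scaled_gamma_weight_def e using a by simp
qed

text \<open>Both bounds have the form "quadratic near \<open>0\<close>"; the second one keeps only linear decay at infinity, which is what
the right tail of the Gamma weight really has.\<close>

lemma ln_1p_upper:
  fixes u :: real
  shows "- 1 < u \<Longrightarrow> u \<le> 0 \<Longrightarrow> ln (1 + u) \<le> u - u\<^sup>2 / 2"
    and "0 \<le> u \<Longrightarrow> ln (1 + u) \<le> u - u\<^sup>2 / (2 * (1 + u))"
proof -
  assume u: "- 1 < u" "u \<le> 0"
  have "(\<lambda>u. u - u\<^sup>2 / 2 - ln (1 + u)) 0 \<le> (\<lambda>u. u - u\<^sup>2 / 2 - ln (1 + u)) u"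
  proof (rule DERIV_nonpos_imp_nonincreasing[OF u(2)])
    fix x assume x: "u \<le> x" "x \<le> 0"
    then have "((\<lambda>u. u - u\<^sup>2 / 2 - ln (1 + u)) has_real_derivative - (x\<^sup>2 / (1 + x))) (at x)"
      using u by (auto intro!: derivative_eq_intros simp: divide_simps power2_eq_square algebra_simps)
    moreover have "- (x\<^sup>2 / (1 + x)) \<le> 0" using x u by simp
    ultimately show "\<exists>y. ((\<lambda>u. u - u\<^sup>2 / 2 - ln (1 + u)) has_real_derivative y) (at x) \<and> y \<le> 0" by blast
  qed
  then show "ln (1 + u) \<le> u - u\<^sup>2 / 2" by simp
next
  assume u: "0 \<le> u"
  have "(\<lambda>u. u - u\<^sup>2 / (2 * (1 + u)) - ln (1 + u)) 0 \<le> (\<lambda>u. u - u\<^sup>2 / (2 * (1 + u)) - ln (1 + u)) u"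
  proof (rule DERIV_nonneg_imp_nondecreasing[OF u])
    fix x assume x: "0 \<le> x" "x \<le> u"
    then have "((\<lambda>u. u - u\<^sup>2 / (2 * (1 + u)) - ln (1 + u)) has_real_derivative
       (1 - (2 * x * (2 * (1 + x)) - x\<^sup>2 * 2) / (2 * (1 + x))\<^sup>2 - 1 / (1 + x))) (at x)"
      by (auto intro!: derivative_eq_intros simp: power2_eq_square)
    moreover have "1 - (2 * x * (2 * (1 + x)) - x\<^sup>2 * 2) / (2 * (1 + x))\<^sup>2 - 1 / (1 + x) = x\<^sup>2 / (2 * (1 + x)\<^sup>2)"
      using x by (simp add: divide_simps) (simp add: power2_eq_square algebra_simps)
    moreover have "x\<^sup>2 / (2 * (1 + x)\<^sup>2) \<ge> 0" by simp
    ultimately show "\<exists>y. ((\<lambda>u. u - u\<^sup>2 / (2 * (1 + u)) - ln (1 + u)) has_real_derivative y) (at x) \<and> y \<ge> 0"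
      by (metis (no_types, lifting))
  qed
  then show "ln (1 + u) \<le> u - u\<^sup>2 / (2 * (1 + u))" by simp
qed

text \<open>A bound that is uniform in \<open>a \<ge> 1\<close> cannot be Gaussian, since the right tail of the weight is only exponential.
With \<open>v = sqrt \<kappa> y\<close> the exponent is at most \<open>- v\<^sup>2 / (2 (1 + \<bar>v\<bar>))\<close>, hence at most \<open>(1 - \<bar>v\<bar>) / 2\<close>.\<close>

lemma scaled_gamma_weight_bound:
  assumes a: "a \<ge> 1" and \<kappa>: "\<kappa> > 0"
  shows "scaled_gamma_weight \<kappa> a y \<le> exp (1 / 2) * exp (- (sqrt \<kappa> / 2) * \<bar>y\<bar>)"
proof (cases "y * sqrt (\<kappa> / a) > - 1")
  case False
  then have "\<not> a + sqrt (a * \<kappa>) * y > 0"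
  proof -
    have "a + sqrt (a * \<kappa>) * y = a * (1 + y * sqrt (\<kappa> / a))"
      using a sqrt_mult_eq_mult_sqrt_divide[of a \<kappa>] by (simp add: algebra_simps)
    moreover have "1 + y * sqrt (\<kappa> / a) \<le> 0" using False by simp
    ultimately show ?thesis using a by (simp add: mult_nonneg_nonpos not_less)
  qed
  then show ?thesis by (simp add: scaled_gamma_weight_def gamma_weight_def)
next
  case True
  define v where "v = sqrt \<kappa> * y"
  define u where "u = y * sqrt (\<kappa> / a)"
  have u: "u = v / sqrt a" "u > - 1" using True by (auto simp: u_def v_def real_sqrt_divide)
  have au: "a * u\<^sup>2 = v\<^sup>2" using a by (simp add: u(1) power_divide)
  have key: "a * (ln (1 + u) - u) \<le> (1 - \<bar>v\<bar>) / 2"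
  proof (cases "u \<le> 0")
    case neg: True
    have "v \<le> 0" using neg a by (simp add: u(1) divide_le_0_iff)
    have "a * (ln (1 + u) - u) \<le> a * (- (u\<^sup>2 / 2))"
      using ln_1p_upper(1)[OF u(2) neg] a by (intro mult_left_mono) auto
    also have "\<dots> = - (v\<^sup>2 / 2)" using au by simp
    also have "\<dots> \<le> (1 - \<bar>v\<bar>) / 2"
    proof -
      have "0 \<le> (\<bar>v\<bar> - 1 / 2)\<^sup>2 + 3 / 4" by simp
      then show ?thesis by (simp add: power2_eq_square algebra_simps)
    qed
    finally show ?thesis .
  next
    case False
    then have v: "v > 0" using a by (simp add: u(1) zero_less_divide_iff not_le)
    have uv: "u \<le> v" unfolding u(1) using v a by (simp add: divide_le_eq)
    have "a * (ln (1 + u) - u) \<le> a * (- (u\<^sup>2 / (2 * (1 + u))))"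
      using ln_1p_upper(2)[of u] False a by (intro mult_left_mono) auto
    also have "\<dots> = - (v\<^sup>2 / (2 * (1 + u)))" using au by simp
    also have "\<dots> \<le> - (v\<^sup>2 / (2 * (1 + v)))"
      using uv False v by (simp add: frac_le)
    also have "\<dots> \<le> (1 - \<bar>v\<bar>) / 2" using v by (simp add: field_simps power2_eq_square)
    finally show ?thesis .
  qed
  have "scaled_gamma_weight \<kappa> a y = exp (a * (ln (1 + u) - u))"
    unfolding u_def by (rule scaled_gamma_weight_eq) (use a \<kappa> True in auto)
  also have "\<dots> \<le> exp ((1 - \<bar>v\<bar>) / 2)" using key by simp
  also have "\<dots> = exp (1 / 2) * exp (- (sqrt \<kappa> / 2) * \<bar>y\<bar>)"
    using \<kappa> by (simp add: v_def abs_mult exp_add[symmetric] field_simps)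
  finally show ?thesis .
qed

lemma scaled_gamma_weight_tendsto:
  assumes \<kappa>: "\<kappa> > 0"
  shows "((\<lambda>a. scaled_gamma_weight \<kappa> a y) \<longlongrightarrow> exp (- \<kappa> * y\<^sup>2 / 2)) at_top"
proof -
  define v where "v = y * sqrt \<kappa>"
  have v2: "v\<^sup>2 = \<kappa> * y\<^sup>2" using \<kappa> by (simp add: v_def power_mult_distrib)
  have "((\<lambda>a. a * (ln (1 + v / sqrt a) - v / sqrt a)) \<longlongrightarrow> - (v\<^sup>2) / 2) at_top"
  proof -
    consider "v > 0" | "v < 0" | "v = 0" by linarith
    then show ?thesis by cases (real_asymp simp: power2_eq_square, real_asymp simp: power2_eq_square, simp)
  qed
  then have "((\<lambda>a. exp (a * (ln (1 + v / sqrt a) - v / sqrt a))) \<longlongrightarrow> exp (- (v\<^sup>2) / 2)) at_top"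
    by (intro tendsto_intros)
  then have *: "((\<lambda>a. exp (a * (ln (1 + v / sqrt a) - v / sqrt a))) \<longlongrightarrow> exp (- \<kappa> * y\<^sup>2 / 2)) at_top"
    by (simp add: v2)
  have "((\<lambda>a. v / sqrt a) \<longlongrightarrow> 0) at_top" by real_asymp
  then have ev: "\<forall>\<^sub>F a in at_top. v / sqrt a > - 1" by (rule order_tendstoD) simp
  show ?thesis
  proof (rule Lim_transform_eventually[OF *])
    show "\<forall>\<^sub>F a in at_top. exp (a * (ln (1 + v / sqrt a) - v / sqrt a)) = scaled_gamma_weight \<kappa> a y"
      using ev eventually_gt_at_top[of 0]
    proof eventually_elim
      case (elim a)
      then show ?case using scaled_gamma_weight_eq[of a \<kappa> y] \<kappa> by (simp add: v_def real_sqrt_divide)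
    qed
  qed
qed

lemma interaction_affine:
  assumes I: "finite I" and c: "c > 0"
  shows "interaction \<gamma> I (\<lambda>i\<in>I. t + c * x i) = c powr (\<gamma> * real (card I * (card I - 1))) * interaction \<gamma> I x"
proof -
  have "interaction \<gamma> I (\<lambda>i\<in>I. t + c * x i) = (\<Prod>p\<in>offdiag I. c powr \<gamma> * \<bar>x (fst p) - x (snd p)\<bar> powr \<gamma>)"
    unfolding interaction_def
  proof (rule prod.cong[OF refl])
    fix p assume p: "p \<in> offdiag I"
    have "\<bar>(t + c * x (fst p)) - (t + c * x (snd p))\<bar> = c * \<bar>x (fst p) - x (snd p)\<bar>"
      using c by (simp add: right_diff_distrib[symmetric] abs_mult)
    then show "\<bar>(\<lambda>i\<in>I. t + c * x i) (fst p) - (\<lambda>i\<in>I. t + c * x i) (snd p)\<bar> powr \<gamma>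
        = c powr \<gamma> * \<bar>x (fst p) - x (snd p)\<bar> powr \<gamma>"
      using p c by (auto simp: offdiag_def powr_mult)
  qed
  also have "\<dots> = c powr (\<gamma> * real (card I * (card I - 1))) * interaction \<gamma> I x"
    using c by (simp add: prod.distrib interaction_def card_offdiag[OF I] powr_power mult.commute)
  finally show ?thesis .
qed

lemma integral_scaled_laguerre_tendsto:
  assumes I: "finite I" and \<kappa>: "\<kappa> > 0" and \<gamma>: "\<gamma> \<ge> 0"
  shows "((\<lambda>a. LINT x|lborel_on I. (\<Prod>i\<in>I. scaled_gamma_weight \<kappa> a (x i)) * interaction \<gamma> I x)
           \<longlongrightarrow> hermite_integral \<kappa> \<gamma> I) at_top"
  unfolding hermite_integral_def
proof (rule integral_dominated_convergence_at_top)
  let ?b = "\<lambda>x. exp (1 / 2) ^ card I * (\<Prod>i\<in>I. (1 + \<bar>x i :: real\<bar>) powr (2 * \<gamma> * card I) * exp (- (sqrt \<kappa> / 2) * \<bar>x i\<bar>))"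
  show "integrable (lborel_on I) ?b"
    using \<kappa> by (intro integrable_mult_right lborel_product.product_integrable_prod I integrable_growth_exp) auto
  have [measurable]: "scaled_gamma_weight \<kappa> a \<in> borel_measurable borel" for a
    unfolding scaled_gamma_weight_def by measurable
  show "(\<lambda>x. (\<Prod>i\<in>I. scaled_gamma_weight \<kappa> a (x i)) * interaction \<gamma> I x) \<in> borel_measurable (lborel_on I)" for a
    by measurable
  show "(\<lambda>x. (\<Prod>i\<in>I. exp (- \<kappa> * (x i)\<^sup>2 / 2)) * interaction \<gamma> I x) \<in> borel_measurable (lborel_on I)"
    by measurable
  show "AE x in lborel_on I. ((\<lambda>a. (\<Prod>i\<in>I. scaled_gamma_weight \<kappa> a (x i)) * interaction \<gamma> I x)
      \<longlongrightarrow> (\<Prod>i\<in>I. exp (- \<kappa> * (x i)\<^sup>2 / 2)) * interaction \<gamma> I x) at_top"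
    by (intro AE_I2 tendsto_intros scaled_gamma_weight_tendsto \<kappa>)
  show "\<forall>\<^sub>F a in at_top. AE x in lborel_on I. norm ((\<Prod>i\<in>I. scaled_gamma_weight \<kappa> a (x i)) * interaction \<gamma> I x) \<le> ?b x"
    using eventually_ge_at_top[of 1]
  proof eventually_elim
    case (elim a)
    have nn: "scaled_gamma_weight \<kappa> a y \<ge> 0" for y
      unfolding scaled_gamma_weight_def using gamma_weight_nonneg by simp
    show ?case
    proof (rule AE_I2)
      fix x
      have "norm ((\<Prod>i\<in>I. scaled_gamma_weight \<kappa> a (x i)) * interaction \<gamma> I x)
          = (\<Prod>i\<in>I. scaled_gamma_weight \<kappa> a (x i)) * interaction \<gamma> I x"
        using interaction_nonneg[of \<gamma> I x] nn by (simp add: abs_mult prod_nonneg abs_prod)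
      also have "\<dots> \<le> (\<Prod>i\<in>I. exp (1 / 2) * exp (- (sqrt \<kappa> / 2) * \<bar>x i\<bar>)) * (\<Prod>i\<in>I. (1 + \<bar>x i\<bar>) powr (2 * \<gamma> * card I))"
        by (intro mult_mono prod_mono conjI nn scaled_gamma_weight_bound elim \<kappa> interaction_bound I \<gamma>
            interaction_nonneg prod_nonneg) auto
      also have "\<dots> = ?b x" by (simp add: prod.distrib mult_ac)
      finally show "norm ((\<Prod>i\<in>I. scaled_gamma_weight \<kappa> a (x i)) * interaction \<gamma> I x) \<le> ?b x" .
    qed
  qed
qed

lemma laguerre_integral_rescale:
  assumes I: "finite I" and a: "a > 0" and \<kappa>: "\<kappa> > 0"
  shows "laguerre_integral a \<gamma> I
      = (a * \<kappa>) powr ((card I + \<gamma> * real (card I * (card I - 1))) / 2) * (a powr a * exp (- a)) ^ card I *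
        (LINT x|lborel_on I. (\<Prod>i\<in>I. scaled_gamma_weight \<kappa> a (x i)) * interaction \<gamma> I x)"
proof -
  define c where "c = sqrt (a * \<kappa>)"
  define g where "g = \<gamma> * real (card I * (card I - 1))"
  have c: "c > 0" using a \<kappa> by (simp add: c_def)
  have c': "c = (a * \<kappa>) powr (1 / 2)" using a \<kappa> by (simp add: c_def powr_half_sqrt)
  have "laguerre_integral a \<gamma> I = c ^ card I * (LINT x|lborel_on I. laguerre a \<gamma> I (\<lambda>i\<in>I. a + c * x i))"
    unfolding laguerre_moment_def using integral_lborel_on_affine[OF I c, of "laguerre a \<gamma> I" a] by simp
  also have "(\<lambda>x. laguerre a \<gamma> I (\<lambda>i\<in>I. a + c * x i))
      = (\<lambda>x. (c powr g * (a powr a * exp (- a)) ^ card I) *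
            ((\<Prod>i\<in>I. scaled_gamma_weight \<kappa> a (x i)) * interaction \<gamma> I x))"
  proof
    fix x :: "nat \<Rightarrow> real"
    have "(\<Prod>i\<in>I. gamma_weight a ((\<lambda>i\<in>I. a + c * x i) i)) = (\<Prod>i\<in>I. (a powr a * exp (- a)) * scaled_gamma_weight \<kappa> a (x i))"
      using a by (intro prod.cong) (auto simp: scaled_gamma_weight_def c_def)
    also have "\<dots> = (a powr a * exp (- a)) ^ card I * (\<Prod>i\<in>I. scaled_gamma_weight \<kappa> a (x i))"
      by (simp add: prod.distrib)
    finally show "laguerre a \<gamma> I (\<lambda>i\<in>I. a + c * x i) = (c powr g * (a powr a * exp (- a)) ^ card I) *
            ((\<Prod>i\<in>I. scaled_gamma_weight \<kappa> a (x i)) * interaction \<gamma> I x)"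
      unfolding laguerre_def interaction_affine[OF I c] g_def by (simp add: mult_ac)
  qed
  also have "(LINT x|lborel_on I. (c powr g * (a powr a * exp (- a)) ^ card I) *
            ((\<Prod>i\<in>I. scaled_gamma_weight \<kappa> a (x i)) * interaction \<gamma> I x))
      = (c powr g * (a powr a * exp (- a)) ^ card I) *
        (LINT x|lborel_on I. (\<Prod>i\<in>I. scaled_gamma_weight \<kappa> a (x i)) * interaction \<gamma> I x)"
    by (rule integral_mult_right_zero)
  also have "c ^ card I * (c powr g * (a powr a * exp (- a)) ^ card I * X)
      = (a * \<kappa>) powr ((card I + g) / 2) * (a powr a * exp (- a)) ^ card I * X" for X
  proof -
    have "c ^ card I * c powr g = (a * \<kappa>) powr ((card I + g) / 2)"
      using c unfolding powr_realpow[OF c, symmetric] powr_add[symmetric]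
      by (simp add: c' powr_powr)
    then show ?thesis by (simp add: mult.assoc[symmetric])
  qed
  finally show ?thesis by (simp add: g_def)
qed

theorem laguerre_integral_tendsto_hermite:
  assumes I: "finite I" and \<kappa>: "\<kappa> > 0" and \<gamma>: "\<gamma> \<ge> 0"
  shows "((\<lambda>a. laguerre_integral a \<gamma> I /
           ((a * \<kappa>) powr ((card I + \<gamma> * real (card I * (card I - 1))) / 2) * (a powr a * exp (- a)) ^ card I))
           \<longlongrightarrow> hermite_integral \<kappa> \<gamma> I) at_top"
proof (rule Lim_transform_eventually[OF integral_scaled_laguerre_tendsto[OF assms]])
  show "\<forall>\<^sub>F a in at_top. (LINT x|lborel_on I. (\<Prod>i\<in>I. scaled_gamma_weight \<kappa> a (x i)) * interaction \<gamma> I x)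
     = laguerre_integral a \<gamma> I /
           ((a * \<kappa>) powr ((card I + \<gamma> * real (card I * (card I - 1))) / 2) * (a powr a * exp (- a)) ^ card I)"
    using eventually_gt_at_top[of 0]
  proof eventually_elim
    case (elim a)
    then show ?case unfolding laguerre_integral_rescale[OF I elim \<kappa>] using \<kappa> by simp
  qed
qed

section \<open>Stirling's formula and Mehta's integral\<close>

lemma laguerre_integral_singleton:
  assumes a: "a \<ge> 0"
  shows "laguerre_integral a \<gamma> {i} = Gamma (a + 1)"
proof -
  have off: "offdiag {i} = {}" by (auto simp: offdiag_def)
  have "laguerre_integral a \<gamma> {i} = (LINT x|lborel_on {i}. gamma_weight a (x i))"
    by (simp add: laguerre_moment_def laguerre_def interaction_def off)
  also have "\<dots> = (LINT t|lborel. gamma_weight a t)"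
    by (rule lborel_product.product_integral_singleton) simp
  also have "\<dots> = enn2real (\<integral>\<^sup>+t. ennreal (gamma_weight a t) \<partial>lborel)"
    by (rule integral_eq_nn_integral) (auto simp: gamma_weight_nonneg)
  also have "(\<integral>\<^sup>+t. ennreal (gamma_weight a t) \<partial>lborel)
      = (\<integral>\<^sup>+t. ennreal (indicator {0..} t * t powr (a + 1 - 1) / exp t) \<partial>lborel)"
    by (intro nn_integral_cong) (auto simp: gamma_weight_def indicator_def exp_minus divide_inverse)
  also have "\<dots> = ennreal (Gamma (a + 1))"
    using a by (intro Gamma_conv_nn_integral_real[symmetric]) auto
  finally show ?thesis using a by (simp add: Gamma_real_nonneg)
qed

lemma hermite_integral_singleton: "hermite_integral 1 \<gamma> {i} = sqrt (2 * pi)"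
proof -
  have off: "offdiag {i} = {}" by (auto simp: offdiag_def)
  have "hermite_integral 1 \<gamma> {i} = (LINT x|lborel_on {i}. exp (- ((x i)\<^sup>2 / 2)))"
    by (simp add: hermite_integral_def interaction_def off)
  also have "\<dots> = (LINT t|lborel. exp (- (t\<^sup>2 / 2)))"
    by (rule lborel_product.product_integral_singleton) simp
  also have "\<dots> = (LINT t|lborel. sqrt (2 * pi) * std_normal_density t)"
    by (simp add: std_normal_density_def)
  also have "\<dots> = sqrt (2 * pi)"
    by (simp add: integral_std_normal_moment_even[of 0, simplified])
  finally show ?thesis .
qed

text \<open>The asymptotics of the Laguerre integral in one variable is Stirling's formula.\<close>

theorem Gamma_stirling:
  "((\<lambda>a. Gamma (a + 1) / (a powr (a + 1 / 2) * exp (- a))) \<longlongrightarrow> sqrt (2 * pi)) at_top"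
proof (rule Lim_transform_eventually)
  show "((\<lambda>a. laguerre_integral a 0 {0} /
           ((a * 1) powr ((card {0::nat} + 0 * real (card {0::nat} * (card {0::nat} - 1))) / 2) * (a powr a * exp (- a)) ^ card {0::nat}))
           \<longlongrightarrow> sqrt (2 * pi)) at_top"
    unfolding hermite_integral_singleton[of 0 0, symmetric]
    by (rule laguerre_integral_tendsto_hermite) auto
  show "\<forall>\<^sub>F a in at_top. laguerre_integral a 0 {0} /
           ((a * 1) powr ((card {0::nat} + 0 * real (card {0::nat} * (card {0::nat} - 1))) / 2) * (a powr a * exp (- a)) ^ card {0::nat})
     = Gamma (a + 1) / (a powr (a + 1 / 2) * exp (- a))"
    using eventually_ge_at_top[of 0]
    by eventually_elim (simp add: laguerre_integral_singleton powr_add mult_ac)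
qed

lemma Gamma_stirling_shift:
  assumes \<delta>: "\<delta> \<ge> 0"
  shows "((\<lambda>a. Gamma (a + 1 + \<delta>) / (a powr (1 / 2 + \<delta>) * (a powr a * exp (- a)))) \<longlongrightarrow> sqrt (2 * pi)) at_top"
proof -
  have "filterlim (\<lambda>a::real. a + \<delta>) at_top at_top" by real_asymp
  from filterlim_compose[OF Gamma_stirling this]
  have 1: "((\<lambda>a. Gamma (a + \<delta> + 1) / ((a + \<delta>) powr (a + \<delta> + 1 / 2) * exp (- (a + \<delta>)))) \<longlongrightarrow> sqrt (2 * pi)) at_top" .
  have 2: "((\<lambda>a. (a + \<delta>) powr (a + \<delta> + 1 / 2) * exp (- (a + \<delta>)) / (a powr (1 / 2 + \<delta>) * (a powr a * exp (- a)))) \<longlongrightarrow> 1) at_top"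
  proof -
    have lim: "((\<lambda>a. (a + \<delta> + 1 / 2) * ln (1 + \<delta> / a) - \<delta>) \<longlongrightarrow> 0) at_top"
      by real_asymp
    have "((\<lambda>a. exp ((a + \<delta> + 1 / 2) * ln (1 + \<delta> / a) - \<delta>)) \<longlongrightarrow> exp 0) at_top"
      by (intro tendsto_intros lim)
    moreover have "\<forall>\<^sub>F a in at_top. exp ((a + \<delta> + 1 / 2) * ln (1 + \<delta> / a) - \<delta>)
        = (a + \<delta>) powr (a + \<delta> + 1 / 2) * exp (- (a + \<delta>)) / (a powr (1 / 2 + \<delta>) * (a powr a * exp (- a)))"
      using eventually_gt_at_top[of 0]
    proof eventually_elim
      case (elim a)
      have l: "ln (1 + \<delta> / a) = ln (a + \<delta>) - ln a"
      proof -
        have "1 + \<delta> / a = (a + \<delta>) / a" using elim by (simp add: field_simps)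
        then show ?thesis using elim \<delta> by (simp add: ln_div)
      qed
      show ?case using elim \<delta> unfolding l
        by (simp add: powr_def exp_add[symmetric] exp_diff[symmetric] algebra_simps)
    qed
    ultimately show ?thesis by (simp add: Lim_transform_eventually)
  qed
  show ?thesis
  proof (rule Lim_transform_eventually)
    show "((\<lambda>a. Gamma (a + \<delta> + 1) / ((a + \<delta>) powr (a + \<delta> + 1 / 2) * exp (- (a + \<delta>))) *
       ((a + \<delta>) powr (a + \<delta> + 1 / 2) * exp (- (a + \<delta>)) / (a powr (1 / 2 + \<delta>) * (a powr a * exp (- a))))) \<longlongrightarrow> sqrt (2 * pi)) at_top"
      using tendsto_mult[OF 1 2] by simp
    show "\<forall>\<^sub>F a in at_top. Gamma (a + \<delta> + 1) / ((a + \<delta>) powr (a + \<delta> + 1 / 2) * exp (- (a + \<delta>))) *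
       ((a + \<delta>) powr (a + \<delta> + 1 / 2) * exp (- (a + \<delta>)) / (a powr (1 / 2 + \<delta>) * (a powr a * exp (- a))))
       = Gamma (a + 1 + \<delta>) / (a powr (1 / 2 + \<delta>) * (a powr a * exp (- a)))"
      using eventually_gt_at_top[of 0] by eventually_elim (use \<delta> in \<open>simp add: add_ac\<close>)
  qed
qed

text \<open>This product solves the recursion of \<open>laguerre_integral\<close> in the parameter \<open>a\<close>.\<close>

definition gamma_product :: "real \<Rightarrow> real \<Rightarrow> nat \<Rightarrow> real" where
  "gamma_product a \<gamma> n = (\<Prod>r<n. Gamma (a + 1 + \<gamma> * real r))"

lemma gamma_argument_pos: "a \<ge> 0 \<Longrightarrow> \<gamma> \<ge> 0 \<Longrightarrow> a + 1 + \<gamma> * real r > 0"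
  by (rule add_pos_nonneg) auto

lemma gamma_product_pos: "a \<ge> 0 \<Longrightarrow> \<gamma> \<ge> 0 \<Longrightarrow> gamma_product a \<gamma> n > 0"
  unfolding gamma_product_def by (intro prod_pos ballI Gamma_real_pos gamma_argument_pos)

lemma gamma_product_Suc_parameter:
  assumes "a \<ge> 0" "\<gamma> \<ge> 0"
  shows "gamma_product (a + 1) \<gamma> n = (\<Prod>r<n. a + 1 + \<gamma> * real r) * gamma_product a \<gamma> n"
  unfolding gamma_product_def prod.distrib[symmetric]
proof (rule prod.cong[OF refl])
  fix r
  have "a + 1 + \<gamma> * real r > 0" using assms by (rule gamma_argument_pos)
  then have "a + 1 + \<gamma> * real r \<notin> \<int>\<^sub>\<le>\<^sub>0" by (auto dest: nonpos_Ints_nonpos)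
  from Gamma_plus1[OF this]
  show "Gamma (a + 1 + 1 + \<gamma> * real r) = (a + 1 + \<gamma> * real r) * Gamma (a + 1 + \<gamma> * real r)"
    by (simp add: add_ac)
qed

text \<open>Numerator and denominator satisfy the same first order recursion in \<open>a\<close>.\<close>

lemma laguerre_ratio_periodic:
  assumes I: "finite I" and a: "a \<ge> 0" and \<gamma>: "\<gamma> \<ge> 1"
  shows "laguerre_integral (a + real N) \<gamma> I / gamma_product (a + real N) \<gamma> (card I)
       = laguerre_integral a \<gamma> I / gamma_product a \<gamma> (card I)"
proof (induction N)
  case (Suc N)
  have aN: "a + real N \<ge> 0" using a by simp
  have P: "(\<Prod>r<card I. a + real N + 1 + \<gamma> * real r) > 0"
    using aN \<gamma> by (intro prod_pos ballI gamma_argument_pos) auto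
  have "laguerre_integral (a + real N + 1) \<gamma> I / gamma_product (a + real N + 1) \<gamma> (card I)
      = laguerre_integral (a + real N) \<gamma> I / gamma_product (a + real N) \<gamma> (card I)"
  proof -
    have G: "gamma_product (a + real N + 1) \<gamma> (card I)
        = (\<Prod>r<card I. a + real N + 1 + \<gamma> * real r) * gamma_product (a + real N) \<gamma> (card I)"
      using aN \<gamma> by (intro gamma_product_Suc_parameter) auto
    show ?thesis
      unfolding laguerre_integral_Suc[OF I aN \<gamma>] G
      by (rule mult_divide_mult_cancel_left[OF less_imp_neq[OF P, symmetric]])
  qed
  then show ?case using Suc by (simp add: add_ac)
qed simp

lemma gamma_product_stirling:
  assumes \<gamma>: "\<gamma> \<ge> 0"
  shows "((\<lambda>a. gamma_product a \<gamma> n /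
           (a powr ((n + \<gamma> * real (n * (n - 1))) / 2) * (a powr a * exp (- a)) ^ n))
           \<longlongrightarrow> sqrt (2 * pi) ^ n) at_top"
proof (rule Lim_transform_eventually)
  show "((\<lambda>a. \<Prod>r<n. Gamma (a + 1 + \<gamma> * real r) / (a powr (1 / 2 + \<gamma> * real r) * (a powr a * exp (- a)))) \<longlongrightarrow> sqrt (2 * pi) ^ n) at_top"
    using tendsto_prod[of "{..<n}" _ "\<lambda>_. sqrt (2 * pi)", OF Gamma_stirling_shift] \<gamma> by simp
  show "\<forall>\<^sub>F a in at_top. (\<Prod>r<n. Gamma (a + 1 + \<gamma> * real r) / (a powr (1 / 2 + \<gamma> * real r) * (a powr a * exp (- a))))
      = gamma_product a \<gamma> n / (a powr ((n + \<gamma> * real (n * (n - 1))) / 2) * (a powr a * exp (- a)) ^ n)"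
    using eventually_gt_at_top[of 0]
  proof eventually_elim
    case (elim a)
    have "(\<Prod>r<n. a powr (1 / 2 + \<gamma> * real r)) = a powr ((n + \<gamma> * real (n * (n - 1))) / 2)"
    proof (induction n)
      case (Suc n)
      have r: "real (n * (n - 1)) = real n * (real n - 1)" by (cases n) (auto simp: algebra_simps)
      have e: "(real n + \<gamma> * real (n * (n - 1))) / 2 + (1 / 2 + \<gamma> * real n)
          = (real (Suc n) + \<gamma> * real (Suc n * (Suc n - 1))) / 2"
        unfolding r by (simp add: field_simps)
      show ?case unfolding prod.lessThan_Suc Suc.IH powr_add[symmetric] e ..
    qed (use elim in simp)
    then show ?case by (simp add: prod_dividef prod.distrib gamma_product_def)
  qed
qed

text \<open>Along \<open>a, a + 1, a + 2, \<dots>\<close> the quotient on the left is constant, while the asymptotics of its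
numerator and denominator identify its limit. No regularity in \<open>a\<close> is involved, so \<open>a \<ge> 0\<close> can be any starting point.\<close>

theorem hermite_integral_laguerre:
  assumes I: "finite I" and a: "a \<ge> 0" and \<gamma>: "\<gamma> \<ge> 1" and \<kappa>: "\<kappa> > 0"
  shows "laguerre_integral a \<gamma> I / gamma_product a \<gamma> (card I)
       = \<kappa> powr ((card I + \<gamma> * real (card I * (card I - 1))) / 2) * hermite_integral \<kappa> \<gamma> I / sqrt (2 * pi) ^ card I"
proof -
  define n where "n = card I"
  define e where "e = (n + \<gamma> * real (n * (n - 1))) / 2"
  have "((\<lambda>a. (laguerre_integral a \<gamma> I / ((a * \<kappa>) powr e * (a powr a * exp (- a)) ^ n)) /
      (gamma_product a \<gamma> n / (a powr e * (a powr a * exp (- a)) ^ n)))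
      \<longlongrightarrow> hermite_integral \<kappa> \<gamma> I / sqrt (2 * pi) ^ n) at_top"
    unfolding e_def n_def using \<gamma> \<kappa>
    by (intro tendsto_divide laguerre_integral_tendsto_hermite I gamma_product_stirling) auto
  moreover have "\<forall>\<^sub>F a in at_top. (laguerre_integral a \<gamma> I / ((a * \<kappa>) powr e * (a powr a * exp (- a)) ^ n)) /
      (gamma_product a \<gamma> n / (a powr e * (a powr a * exp (- a)) ^ n))
      = (laguerre_integral a \<gamma> I / gamma_product a \<gamma> n) / \<kappa> powr e"
    using eventually_gt_at_top[of 0] by eventually_elim (use \<kappa> in \<open>simp add: powr_mult\<close>)
  ultimately have "((\<lambda>a. (laguerre_integral a \<gamma> I / gamma_product a \<gamma> n) / \<kappa> powr e)
      \<longlongrightarrow> hermite_integral \<kappa> \<gamma> I / sqrt (2 * pi) ^ n) at_top"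
    by (rule Lim_transform_eventually)
  moreover have "filterlim (\<lambda>N. a + real N) at_top sequentially"
    by (rule filterlim_tendsto_add_at_top[OF tendsto_const filterlim_real_sequentially])
  ultimately have "(\<lambda>N. (laguerre_integral (a + real N) \<gamma> I / gamma_product (a + real N) \<gamma> n) / \<kappa> powr e)
      \<longlonglongrightarrow> hermite_integral \<kappa> \<gamma> I / sqrt (2 * pi) ^ n"
    by (rule filterlim_compose)
  then have "(\<lambda>N::nat. (laguerre_integral a \<gamma> I / gamma_product a \<gamma> n) / \<kappa> powr e)
      \<longlonglongrightarrow> hermite_integral \<kappa> \<gamma> I / sqrt (2 * pi) ^ n"
    unfolding n_def laguerre_ratio_periodic[OF I a \<gamma>] .
  then have "(laguerre_integral a \<gamma> I / gamma_product a \<gamma> n) / \<kappa> powr e = hermite_integral \<kappa> \<gamma> I / sqrt (2 * pi) ^ n"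
    by (simp add: LIMSEQ_const_iff)
  then have "laguerre_integral a \<gamma> I / gamma_product a \<gamma> n = hermite_integral \<kappa> \<gamma> I / sqrt (2 * pi) ^ n * \<kappa> powr e"
    by (subst (asm) nonzero_divide_eq_eq) (use \<kappa> in auto)
  then show ?thesis unfolding n_def[symmetric] e_def[symmetric]
    by (metis times_divide_eq_right mult.commute)
qed

text \<open>By \<open>hermite_integral_laguerre\<close> the quotient of Laguerre integral and Gamma product takes the same value at \<open>a = 0\<close> and
at \<open>a = 2 \<gamma>\<close>, and the boundary identity leads from \<open>a = 0\<close> with \<open>n + 1\<close> particles to \<open>a = 2 \<gamma>\<close> with
\<open>n\<close> particles. The two Gamma products overlap except for one factor each.\<close>

theorem mehta_ratio:
  assumes I: "finite I" and \<gamma>: "\<gamma> \<ge> 1"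
  shows "laguerre_integral 0 \<gamma> I / gamma_product 0 \<gamma> (card I)
       = (\<Prod>j\<in>{1..card I}. Gamma (1 + real j * \<gamma>) / Gamma (1 + \<gamma>))"
  using I
proof (induction I rule: finite_induct)
  case empty
  have "laguerre_integral 0 \<gamma> {} = 1"
    using lborel_product.product_integral_prod[of "{}" "\<lambda>_ _. 1 :: real"]
    by (simp add: laguerre_moment_def laguerre_def interaction_def offdiag_def)
  then show ?case by (simp add: gamma_product_def)
next
  case (insert i J)
  let ?n = "card J"
  have \<gamma>0: "\<gamma> \<ge> 0" "2 * \<gamma> \<ge> 0" using \<gamma> by auto
  have "laguerre_integral 0 \<gamma> (insert i J) = laguerre_integral (2 * \<gamma>) \<gamma> J"
    using insert \<gamma> by (intro laguerre_integral_0_insert) auto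
  then have 1: "laguerre_integral 0 \<gamma> (insert i J) / gamma_product 0 \<gamma> (Suc ?n)
      = (laguerre_integral (2 * \<gamma>) \<gamma> J / gamma_product (2 * \<gamma>) \<gamma> ?n) *
        (gamma_product (2 * \<gamma>) \<gamma> ?n / gamma_product 0 \<gamma> (Suc ?n))"
    using gamma_product_pos[OF \<gamma>0(2,1), of ?n] by simp
  have 2: "laguerre_integral (2 * \<gamma>) \<gamma> J / gamma_product (2 * \<gamma>) \<gamma> ?n = laguerre_integral 0 \<gamma> J / gamma_product 0 \<gamma> ?n"
    unfolding hermite_integral_laguerre[OF insert(1) \<gamma>0(2) \<gamma> zero_less_one]
      hermite_integral_laguerre[OF insert(1) order_refl \<gamma> zero_less_one] ..
  have 3: "gamma_product (2 * \<gamma>) \<gamma> ?n / gamma_product 0 \<gamma> (Suc ?n) = Gamma (1 + real (Suc ?n) * \<gamma>) / Gamma (1 + \<gamma>)"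
  proof -
    let ?g = "\<lambda>r::nat. Gamma (1 + \<gamma> * real r)"
    have pos: "?g r > 0" for r using \<gamma> by (intro Gamma_real_pos add_pos_nonneg) auto
    have "?g 0 * ?g 1 * gamma_product (2 * \<gamma>) \<gamma> ?n = prod ?g {..<Suc (Suc ?n)}"
      unfolding gamma_product_def prod.lessThan_Suc_shift
      by (simp add: algebra_simps)
    also have "\<dots> = gamma_product 0 \<gamma> (Suc ?n) * ?g (Suc ?n)"
      by (simp add: gamma_product_def)
    finally have "Gamma (1 + \<gamma>) * gamma_product (2 * \<gamma>) \<gamma> ?n = gamma_product 0 \<gamma> (Suc ?n) * ?g (Suc ?n)"
      by simp
    moreover have "gamma_product 0 \<gamma> (Suc ?n) > 0" using \<gamma>0 by (intro gamma_product_pos) auto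
    moreover have "Gamma (1 + \<gamma>) > 0" using pos[of 1] by simp
    ultimately show ?thesis by (simp add: field_simps)
  qed
  show ?case using insert 1 unfolding 2 3 by (simp add: mult.commute)
qed

theorem mehta_integral:
  assumes I: "finite I" and \<gamma>: "\<gamma> \<ge> 1" and \<kappa>: "\<kappa> > 0"
  shows "hermite_integral \<kappa> \<gamma> I = \<kappa> powr (- (card I + \<gamma> * real (card I * (card I - 1))) / 2) * sqrt (2 * pi) ^ card I *
           (\<Prod>j\<in>{1..card I}. Gamma (1 + real j * \<gamma>) / Gamma (1 + \<gamma>))"
  unfolding mehta_ratio[OF I \<gamma>, symmetric] hermite_integral_laguerre[OF I order_refl \<gamma> \<kappa>]
  using \<kappa> by (simp add: powr_minus field_simps powr_add[symmetric])

section \<open>Moment generating functions in the complex domain\<close>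

lemma norm_exp_diff_one_le: "cmod (exp w - 1) \<le> cmod w * exp (cmod w)"
proof -
  have "cmod (exp w - exp 0) \<le> exp (cmod w) * cmod (w - 0)"
  proof (rule field_differentiable_bound[of "cball 0 (cmod w)" exp exp])
    show "cmod (exp z) \<le> exp (cmod w)" if "z \<in> cball 0 (cmod w)" for z
      using that complex_Re_le_cmod[of z] by simp
  qed (auto intro!: derivative_eq_intros)
  then show ?thesis by (simp add: mult.commute)
qed

lemma integrable_exp_complex:
  fixes Y :: "'a \<Rightarrow> real"
  assumes Y [measurable]: "Y \<in> borel_measurable M" and int: "integrable M (\<lambda>\<omega>. exp (Re z * Y \<omega>))"
  shows "integrable M (\<lambda>\<omega>. exp (z * complex_of_real (Y \<omega>)))"
  by (rule Bochner_Integration.integrable_bound[OF int]) simp_all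

text \<open>The dominating function uses the real moment generating function at the two points \<open>Re z \<plusminus> 2 \<delta>\<close>: one \<open>\<delta>\<close>
absorbs the factor \<open>\<bar>y\<bar>\<close>, the other one the increment \<open>h\<close>.\<close>

lemma mgf_difference_quotient_bound:
  fixes y \<delta> :: real
  assumes \<delta>: "\<delta> > 0" and h: "h \<noteq> 0" "cmod h < \<delta>"
  shows "cmod ((exp ((z + h) * of_real y) - exp (z * of_real y)) / h)
           \<le> (exp ((Re z + 2 * \<delta>) * y) + exp ((Re z - 2 * \<delta>) * y)) / \<delta>"
proof -
  have "exp ((z + h) * of_real y) - exp (z * of_real y) = exp (z * of_real y) * (exp (h * of_real y) - 1)"
    by (simp add: algebra_simps exp_add)
  then have "cmod ((exp ((z + h) * of_real y) - exp (z * of_real y)) / h)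
      = exp (Re z * y) * (cmod (exp (h * of_real y) - 1) / cmod h)"
    by (simp add: norm_mult norm_divide)
  also have "\<dots> \<le> exp (Re z * y) * (\<bar>y\<bar> * exp (\<delta> * \<bar>y\<bar>))"
  proof (rule mult_left_mono)
    have "cmod (exp (h * of_real y) - 1) \<le> (cmod h * \<bar>y\<bar>) * exp (cmod h * \<bar>y\<bar>)"
      using norm_exp_diff_one_le[of "h * of_real y"] by (simp add: norm_mult)
    also have "\<dots> \<le> (cmod h * \<bar>y\<bar>) * exp (\<delta> * \<bar>y\<bar>)"
      using h by (intro mult_left_mono) (auto intro!: mult_right_mono)
    finally show "cmod (exp (h * of_real y) - 1) / cmod h \<le> \<bar>y\<bar> * exp (\<delta> * \<bar>y\<bar>)"
      using h by (simp add: divide_le_eq mult_ac)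
  qed simp
  also have "\<dots> \<le> exp (Re z * y) * (exp (2 * \<delta> * \<bar>y\<bar>) / \<delta>)"
  proof (rule mult_left_mono)
    have "\<delta> * \<bar>y\<bar> \<le> exp (\<delta> * \<bar>y\<bar>)" using exp_ge_add_one_self[of "\<delta> * \<bar>y\<bar>"] by linarith
    then have "\<delta> * \<bar>y\<bar> * exp (\<delta> * \<bar>y\<bar>) \<le> exp (\<delta> * \<bar>y\<bar>) * exp (\<delta> * \<bar>y\<bar>)"
      by (rule mult_right_mono) simp
    then show "\<bar>y\<bar> * exp (\<delta> * \<bar>y\<bar>) \<le> exp (2 * \<delta> * \<bar>y\<bar>) / \<delta>"
      using \<delta> by (simp add: exp_add[symmetric] field_simps)
  qed simp
  also have "\<dots> = exp (Re z * y + 2 * \<delta> * \<bar>y\<bar>) / \<delta>" by (simp add: exp_add)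
  also have "\<dots> \<le> (exp ((Re z + 2 * \<delta>) * y) + exp ((Re z - 2 * \<delta>) * y)) / \<delta>"
    using \<delta> by (intro divide_right_mono) (cases "y \<ge> 0"; simp add: algebra_simps)+
  finally show ?thesis .
qed

lemma holomorphic_mgf:
  fixes Y :: "'a \<Rightarrow> real"
  assumes Y [measurable]: "Y \<in> borel_measurable M"
    and int: "\<And>s. s > c \<Longrightarrow> integrable M (\<lambda>\<omega>. exp (s * Y \<omega>))"
  shows "(\<lambda>z. LINT \<omega>|M. exp (z * complex_of_real (Y \<omega>))) holomorphic_on {z. c < Re z}"
proof -
  let ?\<phi> = "\<lambda>z. LINT \<omega>|M. exp (z * complex_of_real (Y \<omega>))"
  have intc: "integrable M (\<lambda>\<omega>. exp (z * complex_of_real (Y \<omega>)))" if "c < Re z" for z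
    by (rule integrable_exp_complex[OF Y int[OF that]])
  have "(?\<phi> has_field_derivative (LINT \<omega>|M. of_real (Y \<omega>) * exp (z * complex_of_real (Y \<omega>)))) (at z)"
    if z: "c < Re z" for z
  proof -
    define \<delta> where "\<delta> = (Re z - c) / 3"
    have \<delta>: "\<delta> > 0" "c < Re z - 2 * \<delta>" using z by (auto simp: \<delta>_def field_simps)
    let ?q = "\<lambda>h \<omega>. (exp ((z + h) * complex_of_real (Y \<omega>)) - exp (z * complex_of_real (Y \<omega>))) / h"
    have "((\<lambda>h. (?\<phi> (z + h) - ?\<phi> z) / h) \<longlongrightarrow> (LINT \<omega>|M. of_real (Y \<omega>) * exp (z * complex_of_real (Y \<omega>)))) (at 0)"
      unfolding tendsto_at_iff_sequentially
    proof (intro allI impI)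
      fix h :: "nat \<Rightarrow> complex"
      assume h0: "\<forall>i. h i \<in> UNIV - {0}" and lim: "h \<longlonglongrightarrow> 0"
      have "\<forall>\<^sub>F i in sequentially. dist (h i) 0 < \<delta>" using lim \<delta>(1) by (rule tendstoD)
      then obtain N where N: "\<And>i. i \<ge> N \<Longrightarrow> cmod (h i) < \<delta>"
        by (auto simp: eventually_sequentially)
      define k where "k i = h (i + N)" for i
      have k: "k i \<noteq> 0" "cmod (k i) < \<delta>" for i using h0 N[of "i + N"] by (auto simp: k_def)
      have k_lim: "k \<longlonglongrightarrow> 0" unfolding k_def by (rule LIMSEQ_ignore_initial_segment[OF lim])
      have q_lim: "(\<lambda>i. LINT \<omega>|M. ?q (k i) \<omega>) \<longlonglongrightarrow> (LINT \<omega>|M. of_real (Y \<omega>) * exp (z * complex_of_real (Y \<omega>)))"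
      proof (rule integral_dominated_convergence)
        show "integrable M (\<lambda>\<omega>. (exp ((Re z + 2 * \<delta>) * Y \<omega>) + exp ((Re z - 2 * \<delta>) * Y \<omega>)) / \<delta>)"
          using \<delta> z by (intro integrable_divide Bochner_Integration.integrable_add int) auto
        show "AE \<omega> in M. cmod (?q (k i) \<omega>) \<le> (exp ((Re z + 2 * \<delta>) * Y \<omega>) + exp ((Re z - 2 * \<delta>) * Y \<omega>)) / \<delta>" for i
          by (intro AE_I2 mgf_difference_quotient_bound \<delta> k)
        show "AE \<omega> in M. (\<lambda>i. ?q (k i) \<omega>) \<longlonglongrightarrow> of_real (Y \<omega>) * exp (z * complex_of_real (Y \<omega>))"
        proof (rule AE_I2)
          fix \<omega>
          have "((\<lambda>z. exp (z * complex_of_real (Y \<omega>))) has_field_derivative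
              of_real (Y \<omega>) * exp (z * complex_of_real (Y \<omega>))) (at z)"
            by (auto intro!: derivative_eq_intros simp: mult.commute)
          then have "((\<lambda>h. ?q h \<omega>) \<longlongrightarrow> of_real (Y \<omega>) * exp (z * complex_of_real (Y \<omega>))) (at 0)"
            by (simp add: DERIV_def)
          then show "(\<lambda>i. ?q (k i) \<omega>) \<longlonglongrightarrow> of_real (Y \<omega>) * exp (z * complex_of_real (Y \<omega>))"
            by (rule filterlim_compose) (use k k_lim in \<open>auto simp: filterlim_at\<close>)
        qed
      qed measurable
      have q_eq: "(LINT \<omega>|M. ?q (k i) \<omega>) = (?\<phi> (z + k i) - ?\<phi> z) / k i" for i
      proof -
        have "c < Re (z + k i)" using k(2)[of i] abs_Re_le_cmod[of "k i"] \<delta> by (simp add: \<delta>_def)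
        then show ?thesis using intc z by (simp add: Bochner_Integration.integral_diff)
      qed
      from q_lim have "(\<lambda>i. (?\<phi> (z + h (i + N)) - ?\<phi> z) / h (i + N)) \<longlonglongrightarrow> (LINT \<omega>|M. of_real (Y \<omega>) * exp (z * complex_of_real (Y \<omega>)))"
        unfolding q_eq unfolding k_def .
      then show "((\<lambda>h. (?\<phi> (z + h) - ?\<phi> z) / h) \<circ> h) \<longlonglongrightarrow> (LINT \<omega>|M. of_real (Y \<omega>) * exp (z * complex_of_real (Y \<omega>)))"
        unfolding comp_def by (rule LIMSEQ_offset)
    qed
    then show ?thesis by (simp add: DERIV_def)
  qed
  then show ?thesis
    by (auto simp: holomorphic_on_def field_differentiable_def intro: has_field_derivative_at_within)
qed

section \<open>The partition function of the Hermite ensemble\<close>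

lemma interaction_atLeastAtMost:
  "interaction (\<beta> / 2) {1..n} x = (\<Prod>k\<in>{1..n}. \<Prod>j\<in>{1..<k}. \<bar>x k - x j\<bar> powr \<beta>)"
proof (induction n)
  case 0 show ?case by (simp add: interaction_def offdiag_def)
next
  case (Suc n)
  have I: "{1..Suc n} = insert (Suc n) {1..n}" by auto
  have "interaction (\<beta> / 2) {1..Suc n} x = interaction (\<beta> / 2) {1..n} x * repulsion \<beta> {1..n} x (x (Suc n))"
    unfolding I by (subst interaction_insert) auto
  also have "\<dots> = (\<Prod>k\<in>{1..n}. \<Prod>j\<in>{1..<k}. \<bar>x k - x j\<bar> powr \<beta>) * (\<Prod>j\<in>{1..<Suc n}. \<bar>x (Suc n) - x j\<bar> powr \<beta>)"
    unfolding Suc.IH repulsion_def atLeastLessThanSuc_atLeastAtMost ..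
  finally show ?case unfolding I by (simp add: mult.commute)
qed

lemma hermite_weight_eq:
  "hermite_weight \<beta> n x = (\<Prod>i\<in>{1..n}. exp (- (\<beta> / 2 * real n) * (x i)\<^sup>2 / 2)) * interaction (\<beta> / 2) {1..n} x"
  unfolding hermite_weight_def interaction_atLeastAtMost hermite_potential_def
  by (simp add: mult.commute)

lemma hermite_partition_eq: "hermite_partition \<beta> n = hermite_integral (\<beta> / 2 * real n) (\<beta> / 2) {1..n}"
  unfolding hermite_partition_def hermite_integral_def lebesgue_Rn_def hermite_weight_eq ..

lemma measurable_hermite_weight [measurable]: "hermite_weight \<beta> n \<in> borel_measurable (lborel_on {1..n})"
  unfolding hermite_weight_eq[abs_def] by measurable

lemma hermite_weight_nonneg: "hermite_weight \<beta> n x \<ge> 0"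
  unfolding hermite_weight_eq using interaction_nonneg by (simp add: prod_nonneg)

lemma integrable_hermite_weight:
  assumes \<beta>: "\<beta> > 0" and n: "n \<ge> 1"
  shows "integrable (lborel_on {1..n}) (hermite_weight \<beta> n)"
proof -
  let ?\<kappa> = "\<beta> / 2 * real n"
  have \<kappa>: "?\<kappa> > 0" using assms by simp
  show ?thesis
  proof (rule integrable_product_bound[where C = "exp (1 / 2) ^ n" and m = "2 * (\<beta> / 2) * card {1..n}" and c = "sqrt ?\<kappa> / 2"])
    fix x :: "nat \<Rightarrow> real"
    \<comment> \<open>The exponential rate is the one that matches the completed square \<open>(sqrt \<kappa> \<bar>t\<bar> - 1/2)\<^sup>2\<close>.\<close>
    have g: "exp (- ?\<kappa> * t\<^sup>2 / 2) \<le> exp (1 / 2) * exp (- (sqrt ?\<kappa> / 2) * \<bar>t\<bar>)" for t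
    proof -
      have "0 \<le> (sqrt ?\<kappa> * \<bar>t\<bar> - 1 / 2)\<^sup>2 + 3 / 4" by simp
      also have "(sqrt ?\<kappa> * \<bar>t\<bar> - 1 / 2)\<^sup>2 = ?\<kappa> * t\<^sup>2 - sqrt ?\<kappa> * \<bar>t\<bar> + 1 / 4"
        using \<kappa> by (simp add: power2_diff power_mult_distrib power2_eq_square[of "1/2"])
      finally have "- ?\<kappa> * t\<^sup>2 / 2 \<le> 1 / 2 + - (sqrt ?\<kappa> / 2) * \<bar>t\<bar>" by (simp add: field_simps)
      then show ?thesis unfolding exp_add[symmetric] by simp
    qed
    have "\<bar>hermite_weight \<beta> n x\<bar> = (\<Prod>i\<in>{1..n}. exp (- ?\<kappa> * (x i)\<^sup>2 / 2)) * interaction (\<beta> / 2) {1..n} x"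
      unfolding hermite_weight_eq using interaction_nonneg by (simp add: abs_mult abs_prod)
    also have "\<dots> \<le> (\<Prod>i\<in>{1..n}. exp (1 / 2) * exp (- (sqrt ?\<kappa> / 2) * \<bar>x i\<bar>)) *
        (\<Prod>i\<in>{1..n}. (1 + \<bar>x i\<bar>) powr (2 * (\<beta> / 2) * card {1..n}))"
      by (intro mult_mono prod_mono conjI g interaction_bound interaction_nonneg prod_nonneg) (use \<beta> in auto)
    also have "\<dots> = exp (1 / 2) ^ n * (\<Prod>i\<in>{1..n}. (1 + \<bar>x i\<bar>) powr (2 * (\<beta> / 2) * card {1..n}) * exp (- (sqrt ?\<kappa> / 2) * \<bar>x i\<bar>))"
      by (simp add: prod.distrib mult_ac)
    finally show "\<bar>hermite_weight \<beta> n x\<bar> \<le> \<dots>" .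
  qed (use \<kappa> measurable_hermite_weight[of \<beta> n] in auto)
qed

lemma hermite_weight_powr:
  "hermite_weight \<beta> n x powr (1 + s) = hermite_weight (\<beta> * (1 + s)) n x"
  unfolding hermite_weight_def powr_mult prod_powr_distrib powr_powr exp_powr_real
  by (simp add: mult_ac)

text \<open>If the partition function were zero, the density would vanish identically and could not have total mass \<open>1\<close>.\<close>

lemma hermite_partition_pos:
  assumes \<beta>: "\<beta> > 0" and n: "n \<ge> 1" and M: "prob_space M"
    and dist: "distributed M (lebesgue_Rn n) \<Lambda> (\<lambda>x. ennreal (hermite_density \<beta> n x))"
  shows "hermite_partition \<beta> n > 0"
proof -
  have "hermite_partition \<beta> n \<ge> 0"
    unfolding hermite_partition_def by (intro integral_nonneg_AE AE_I2 hermite_weight_nonneg)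
  moreover have "hermite_partition \<beta> n \<noteq> 0"
  proof
    assume Z: "hermite_partition \<beta> n = 0"
    interpret prob_space M by (rule M)
    have "(\<integral>\<^sup>+x. ennreal (hermite_density \<beta> n x) * 1 \<partial>lebesgue_Rn n) = (\<integral>\<^sup>+\<omega>. 1 \<partial>M)"
      using distributed_nn_integral[OF dist, of "\<lambda>_. 1"] by simp
    then show False using Z by (simp add: hermite_density_def emeasure_space_1)
  qed
  ultimately show ?thesis by simp
qed

lemma hermite_mgf_real:
  assumes \<beta>: "\<beta> > 0" and n: "n \<ge> 1" and s: "s > -1" and M: "prob_space M"
    and dist: "distributed M (lebesgue_Rn n) \<Lambda> (\<lambda>x. ennreal (hermite_density \<beta> n x))"
  shows "integrable M (\<lambda>\<omega>. exp (s * hermite_Y \<beta> n (\<Lambda> \<omega>)))"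
    and "(LINT \<omega>|M. exp (s * hermite_Y \<beta> n (\<Lambda> \<omega>)))
          = exp (s * real n * hermite_E \<beta>) * hermite_partition (\<beta> * (1 + s)) n / hermite_partition \<beta> n powr (1 + s)"
proof -
  let ?Z = "hermite_partition \<beta> n"
  have Z: "?Z > 0" by (rule hermite_partition_pos[OF \<beta> n M dist])
  have leb: "lebesgue_Rn n = lborel_on {1..n}" by (simp add: lebesgue_Rn_def)
  have dens_nonneg: "hermite_density \<beta> n x \<ge> 0" for x
    unfolding hermite_density_def using Z hermite_weight_nonneg by simp
  have Y_meas: "(\<lambda>x. exp (s * hermite_Y \<beta> n x)) \<in> borel_measurable (lebesgue_Rn n)"
    unfolding leb hermite_Y_def hermite_density_def by measurable
  have eq: "hermite_density \<beta> n x * exp (s * hermite_Y \<beta> n x)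
      = exp (s * real n * hermite_E \<beta>) / ?Z powr (1 + s) * hermite_weight (\<beta> * (1 + s)) n x" for x
  proof (cases "hermite_density \<beta> n x = 0")
    case True
    then have "hermite_weight \<beta> n x = 0" using Z by (simp add: hermite_density_def)
    then have "hermite_weight (\<beta> * (1 + s)) n x = 0" using hermite_weight_powr[of \<beta> n x] by simp
    then show ?thesis using True by simp
  next
    case False
    let ?p = "hermite_density \<beta> n x"
    have p: "?p > 0" using False dens_nonneg[of x] by linarith
    have "?p * exp (s * hermite_Y \<beta> n x) = exp (s * real n * hermite_E \<beta>) * ?p powr (1 + s)"
      unfolding hermite_Y_def using p by (simp add: powr_def exp_add algebra_simps)
    also have "?p powr (1 + s) = hermite_weight (\<beta> * (1 + s)) n x / ?Z powr (1 + s)"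
      unfolding hermite_density_def using Z hermite_weight_nonneg[of \<beta> n x]
      by (simp add: powr_divide hermite_weight_powr[symmetric])
    finally show ?thesis by simp
  qed
  have \<beta>s: "\<beta> * (1 + s) > 0" using \<beta> s by simp
  show "integrable M (\<lambda>\<omega>. exp (s * hermite_Y \<beta> n (\<Lambda> \<omega>)))"
    unfolding distributed_integrable[OF dist Y_meas dens_nonneg, symmetric] eq leb
    by (intro integrable_mult_right integrable_hermite_weight \<beta>s n)
  have "(LINT \<omega>|M. exp (s * hermite_Y \<beta> n (\<Lambda> \<omega>)))
      = (LINT x|lebesgue_Rn n. hermite_density \<beta> n x * exp (s * hermite_Y \<beta> n x))"
    by (rule distributed_integral[OF dist Y_meas dens_nonneg, symmetric])
  also have "\<dots> = exp (s * real n * hermite_E \<beta>) / ?Z powr (1 + s) * hermite_partition (\<beta> * (1 + s)) n"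
    unfolding eq hermite_partition_def by (rule integral_mult_right_zero)
  finally show "(LINT \<omega>|M. exp (s * hermite_Y \<beta> n (\<Lambda> \<omega>)))
          = exp (s * real n * hermite_E \<beta>) * hermite_partition (\<beta> * (1 + s)) n / ?Z powr (1 + s)"
    by simp
qed

lemma measurable_hermite_Y:
  assumes "distributed M (lebesgue_Rn n) \<Lambda> (\<lambda>x. ennreal (hermite_density \<beta> n x))"
  shows "(\<lambda>\<omega>. hermite_Y \<beta> n (\<Lambda> \<omega>)) \<in> borel_measurable M"
proof (rule measurable_compose[of \<Lambda> _ "lborel_on {1..n}" "hermite_Y \<beta> n"])
  show "\<Lambda> \<in> measurable M (lborel_on {1..n})"
    using distributed_measurable[OF assms] by (simp add: lebesgue_Rn_def)
  show "hermite_Y \<beta> n \<in> borel_measurable (lborel_on {1..n})"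
    unfolding hermite_Y_def[abs_def] hermite_density_def by measurable
qed

text \<open>The logarithm of Mehta's formula for the partition function with parameter \<open>\<beta> = 2 b\<close>, written so that it makes
sense and is holomorphic for complex \<open>b\<close> with positive real part.\<close>

definition log_partition :: "nat \<Rightarrow> complex \<Rightarrow> complex" where
  "log_partition n b = - (of_nat n + b * of_nat (n * (n - 1))) / 2 * (Ln b + of_real (ln (real n)))
     + of_real (real n * ln (2 * pi) / 2) + (\<Sum>j\<in>{1..n}. ln_Gamma (1 + of_nat j * b))
     - of_nat n * ln_Gamma (1 + b)"

lemma log_partition_of_real:
  assumes b: "b > 0"
  shows "log_partition n (of_real b) = of_real (- (real n + b * real (n * (n - 1))) / 2 * (ln b + ln (real n))
     + real n * ln (2 * pi) / 2 + (\<Sum>j\<in>{1..n}. ln_Gamma (1 + real j * b)) - real n * ln_Gamma (1 + b))"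
proof -
  have "ln_Gamma (1 + of_nat j * complex_of_real b) = of_real (ln_Gamma (1 + real j * b))" for j
  proof -
    have "1 + real j * b > 0" using b by (intro add_pos_nonneg) auto
    then show ?thesis using ln_Gamma_complex_of_real[of "1 + real j * b"] by simp
  qed
  moreover have "ln_Gamma (1 + complex_of_real b) = of_real (ln_Gamma (1 + b))"
    using ln_Gamma_complex_of_real[of "1 + b"] b by simp
  ultimately show ?thesis unfolding log_partition_def using b by (simp add: Ln_of_real)
qed

lemma exp_log_partition:
  assumes b: "b \<ge> 1" and n: "n \<ge> 1"
  shows "exp (log_partition n (of_real b)) = of_real (hermite_partition (2 * b) n)"
proof -
  have b0: "b > 0" using b by simp
  have \<kappa>: "b * real n > 0" using b n by simp
  have G: "Gamma (1 + real j * b) = exp (ln_Gamma (1 + real j * b))" for j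
  proof (rule Gamma_real_pos_exp)
    show "1 + real j * b > 0" using b by (intro add_pos_nonneg) auto
  qed
  have "hermite_partition (2 * b) n = (b * real n) powr (- (real n + b * real (n * (n - 1))) / 2) * sqrt (2 * pi) ^ n *
           (\<Prod>j\<in>{1..n}. Gamma (1 + real j * b) / Gamma (1 + b))"
    unfolding hermite_partition_eq using mehta_integral[of "{1..n}" b "b * real n"] b \<kappa> by simp
  also have "(b * real n) powr (- (real n + b * real (n * (n - 1))) / 2)
      = exp (- (real n + b * real (n * (n - 1))) / 2 * (ln b + ln (real n)))"
    using b n by (simp add: powr_def ln_mult)
  also have "sqrt (2 * pi) ^ n = exp (real n * ln (2 * pi) / 2)"
  proof -
    have "sqrt (2 * pi) = exp (ln (2 * pi) / 2)"
      by (subst ln_sqrt[symmetric]) auto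
    then show ?thesis by (simp add: exp_of_nat_mult[symmetric])
  qed
  also have "(\<Prod>j\<in>{1..n}. Gamma (1 + real j * b) / Gamma (1 + b))
      = exp ((\<Sum>j\<in>{1..n}. ln_Gamma (1 + real j * b)) - real n * ln_Gamma (1 + b))"
    unfolding G using G[of 1] by (simp add: prod_dividef exp_sum exp_diff exp_of_nat_mult)
  finally have "hermite_partition (2 * b) n = exp (- (real n + b * real (n * (n - 1))) / 2 * (ln b + ln (real n))
     + real n * ln (2 * pi) / 2 + (\<Sum>j\<in>{1..n}. ln_Gamma (1 + real j * b)) - real n * ln_Gamma (1 + b))"
    by (simp only: exp_add[symmetric] exp_diff[symmetric] add.assoc add_diff_eq)
  then show ?thesis unfolding log_partition_of_real[OF b0] exp_of_real by simp
qed

lemma log_partition_holomorphic: "log_partition n holomorphic_on {b. Re b > 0}"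
  unfolding log_partition_def[abs_def]
proof (intro holomorphic_intros)
  have pos: "Re (1 + of_nat j * b) > 0" if "Re b > 0" for j b
    using that by (auto intro!: add_pos_nonneg)
  fix j
  show "(\<lambda>b. ln_Gamma (1 + of_nat j * b)) holomorphic_on {b. Re b > 0}"
  proof (rule holomorphic_on_compose_gen[of "\<lambda>b. 1 + of_nat j * b" _ ln_Gamma "{w. Re w > 0}", unfolded comp_def])
    show "ln_Gamma holomorphic_on {w. Re w > 0}"
      by (rule holomorphic_ln_Gamma) (auto simp: complex_nonpos_Reals_iff)
  qed (use pos in \<open>auto intro!: holomorphic_intros\<close>)
next
  show "(\<lambda>b. ln_Gamma (1 + b)) holomorphic_on {b. Re b > 0}"
  proof (rule holomorphic_on_compose_gen[of "\<lambda>b. 1 + b" _ ln_Gamma "{w. Re w > 0}", unfolded comp_def])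
    show "ln_Gamma holomorphic_on {w. Re w > 0}"
      by (rule holomorphic_ln_Gamma) (auto simp: complex_nonpos_Reals_iff)
  qed (auto intro!: holomorphic_intros)
qed (auto simp: complex_nonpos_Reals_iff)

text \<open>Both sides are holomorphic in the half plane \<open>Re z > -1\<close> and agree on a real half-line, where Mehta's formula is
available for the exponent \<open>\<beta> (1 + z) / 2\<close>.\<close>

theorem hermite_mgf:
  assumes \<beta>: "\<beta> > 0" and n: "n \<ge> 1" and M: "prob_space M"
    and dist: "distributed M (lebesgue_Rn n) \<Lambda> (\<lambda>x. ennreal (hermite_density \<beta> n x))"
    and z: "Re z > -1"
  shows "(LINT \<omega>|M. exp (z * of_real (hermite_Y \<beta> n (\<Lambda> \<omega>))))
      = exp (z * of_real (real n * hermite_E \<beta>) - (1 + z) * log_partition n (of_real (\<beta> / 2))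
             + log_partition n (of_real (\<beta> / 2) * (1 + z)))"
proof -
  interpret prob_space M by (rule M)
  define b where "b = \<beta> / 2"
  have b: "b > 0" using \<beta> by (simp add: b_def)
  define \<phi> where "\<phi> z = (LINT \<omega>|M. exp (z * complex_of_real (hermite_Y \<beta> n (\<Lambda> \<omega>))))" for z
  have Z: "hermite_partition \<beta> n > 0" by (rule hermite_partition_pos[OF \<beta> n M dist])
  define l where "l = ln (hermite_partition \<beta> n)"
  define H where "H z = exp (z * of_real (real n * hermite_E \<beta>) - (1 + z) * of_real l
             + log_partition n (of_real b * (1 + z)))" for z
  have Y_meas: "(\<lambda>\<omega>. hermite_Y \<beta> n (\<Lambda> \<omega>)) \<in> borel_measurable M"
    by (rule measurable_hermite_Y[OF dist])
  have eq_real: "\<phi> (of_real s) = H (of_real s)" if s: "s > -1" "b * (1 + s) \<ge> 1" for s :: real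
  proof -
    have "\<phi> (of_real s) = of_real (LINT \<omega>|M. exp (s * hermite_Y \<beta> n (\<Lambda> \<omega>)))"
      unfolding \<phi>_def of_real_mult[symmetric] exp_of_real by (rule integral_complex_of_real)
    also have "(LINT \<omega>|M. exp (s * hermite_Y \<beta> n (\<Lambda> \<omega>)))
          = exp (s * real n * hermite_E \<beta>) * hermite_partition (2 * (b * (1 + s))) n / exp ((1 + s) * l)"
      using hermite_mgf_real(2)[OF \<beta> n s(1) M dist] Z by (simp add: b_def powr_def l_def)
    also have "complex_of_real \<dots> = exp (of_real (s * real n * hermite_E \<beta>)) *
        exp (log_partition n (of_real (b * (1 + s)))) / exp (of_real ((1 + s) * l))"
      unfolding exp_log_partition[OF s(2) n] by (simp add: exp_of_real[symmetric])
    also have "\<dots> = H (of_real s)"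
      unfolding H_def by (simp add: exp_add exp_diff mult_ac)
    finally show ?thesis .
  qed
  have all: "\<phi> w - H w = 0" if w: "Re w > -1" for w
  proof (rule analytic_continuation[of "\<lambda>w. \<phi> w - H w" "{w. Re w > -1}" "complex_of_real ` {max 0 (1 / b)<..}"
        "of_real (max 0 (1 / b) + 1)"])
    have "\<phi> holomorphic_on {w. -1 < Re w}"
      unfolding \<phi>_def by (rule holomorphic_mgf[OF Y_meas]) (rule hermite_mgf_real(1)[OF \<beta> n _ M dist])
    moreover have "H holomorphic_on {w. -1 < Re w}"
    proof -
      have "(\<lambda>w. log_partition n (of_real b * (1 + w))) holomorphic_on {w. -1 < Re w}"
        by (rule holomorphic_on_compose_gen[of "\<lambda>w. of_real b * (1 + w)" _ "log_partition n" "{b. Re b > 0}", unfolded comp_def])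
           (use b in \<open>auto intro!: holomorphic_intros log_partition_holomorphic\<close>)
      then show ?thesis unfolding H_def by (intro holomorphic_intros)
    qed
    ultimately show "(\<lambda>w. \<phi> w - H w) holomorphic_on {w. Re w > -1}" by (intro holomorphic_intros)
    show "connected {w. -1 < Re w}" by (intro convex_connected convex_halfspace_Re_gt)
    show "complex_of_real ` {max 0 (1 / b)<..} \<subseteq> {w. -1 < Re w}" by auto
    show "of_real (max 0 (1 / b) + 1) \<in> {w. -1 < Re w}" by auto
    show "complex_of_real (max 0 (1 / b) + 1) islimpt complex_of_real ` {max 0 (1 / b)<..}"
      unfolding islimpt_approachable
    proof (intro allI impI)
      fix e :: real assume "e > 0"
      then show "\<exists>x'\<in>complex_of_real ` {max 0 (1 / b)<..}. x' \<noteq> of_real (max 0 (1 / b) + 1) \<and> dist x' (of_real (max 0 (1 / b) + 1)) < e"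
        by (intro bexI[OF _ imageI[of "max 0 (1 / b) + 1 + e / 2"]])
           (auto simp del: of_real_add simp add: dist_of_real dist_real_def)
    qed
    fix w assume "w \<in> complex_of_real ` {max 0 (1 / b)<..}"
    then obtain s where s: "w = of_real s" "s > 0" "s > 1 / b" by auto
    have "b * (1 + s) \<ge> 1" using s(3) b by (simp add: field_simps)
    then show "\<phi> w - H w = 0" using eq_real[of s] s by simp
  next
    show "open {w. -1 < Re w}" by (rule open_halfspace_Re_gt)
  qed (use w in auto)
  \<comment> \<open>At \<open>z = 0\<close> this identifies the normalizing constant also where \<open>\<beta>\<close> is small.\<close>
  have "H 0 = 1" using all[of 0] by (simp add: \<phi>_def prob_space)
  then have e: "exp (log_partition n (of_real b)) = exp (complex_of_real l)"
    by (simp add: H_def exp_diff exp_add exp_minus divide_simps)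
  have "log_partition n (of_real b) = of_real l"
    using e unfolding log_partition_of_real[OF b] exp_of_real of_real_eq_iff by simp
  then show ?thesis using all[OF z] by (simp add: \<phi>_def H_def b_def)
qed

section \<open>Stirling's remainder in the right half plane\<close>

text \<open>The error in Stirling's formula for \<open>ln \<Gamma>(1 + x)\<close>; the primed functions are its first two derivatives.\<close>

definition stirling_remainder :: "complex \<Rightarrow> complex" where
  "stirling_remainder x = ln_Gamma (1 + x) - (x + 1 / 2) * Ln x + x - of_real (ln (2 * pi) / 2)"

definition stirling_remainder' :: "complex \<Rightarrow> complex" where
  "stirling_remainder' x = Digamma (1 + x) - Ln x - 1 / (2 * x)"

definition stirling_remainder'' :: "complex \<Rightarrow> complex" where
  "stirling_remainder'' x = Polygamma 1 (1 + x) - 1 / x + 1 / (2 * x\<^sup>2)"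

lemma Re_pos_nonpos: "Re z > 0 \<Longrightarrow> z \<notin> \<real>\<^sub>\<le>\<^sub>0" "Re z > 0 \<Longrightarrow> z \<notin> \<int>\<^sub>\<le>\<^sub>0" "Re z > 0 \<Longrightarrow> z \<noteq> 0"
  by (auto simp: complex_nonpos_Reals_iff elim!: nonpos_Ints_cases')

lemma stirling_remainder_deriv:
  assumes x: "Re x > 0"
  shows "(stirling_remainder has_field_derivative stirling_remainder' x) (at x)"
    and "(stirling_remainder' has_field_derivative stirling_remainder'' x) (at x)"
proof -
  have nz: "x \<noteq> 0" "1 + x \<notin> \<real>\<^sub>\<le>\<^sub>0" "x \<notin> \<real>\<^sub>\<le>\<^sub>0" "1 + x \<notin> \<int>\<^sub>\<le>\<^sub>0"
    using Re_pos_nonpos[of x] Re_pos_nonpos[of "1 + x"] x by auto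
  have "(stirling_remainder has_field_derivative
      Digamma (1 + x) * 1 - (1 * Ln x + (1 / x) * (x + 1 / 2)) + 1 - 0) (at x)"
    unfolding stirling_remainder_def[abs_def]
  proof (intro DERIV_diff DERIV_add DERIV_mult DERIV_ident DERIV_const)
    show "((\<lambda>x. ln_Gamma (1 + x)) has_field_derivative Digamma (1 + x) * 1) (at x)"
      by (rule DERIV_chain2[OF has_field_derivative_ln_Gamma_complex]) (use nz in \<open>auto intro!: derivative_eq_intros\<close>)
    show "((\<lambda>x. x + 1 / 2) has_field_derivative 1) (at x)" by (auto intro!: derivative_eq_intros)
    show "(Ln has_field_derivative 1 / x) (at x)"
      using nz by (auto intro!: derivative_eq_intros simp: divide_inverse)
  qed
  then show "(stirling_remainder has_field_derivative stirling_remainder' x) (at x)"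
    by (rule DERIV_cong) (use nz in \<open>simp add: stirling_remainder'_def field_simps\<close>)
  have "(stirling_remainder' has_field_derivative
      Polygamma (Suc 0) (1 + x) * 1 - 1 / x - (- (2 / (2 * x)\<^sup>2))) (at x)"
    unfolding stirling_remainder'_def[abs_def]
  proof (intro DERIV_diff)
    show "((\<lambda>x. Digamma (1 + x)) has_field_derivative Polygamma (Suc 0) (1 + x) * 1) (at x)"
      by (rule DERIV_chain2[OF has_field_derivative_Polygamma]) (use nz in \<open>auto intro!: derivative_eq_intros\<close>)
    show "(Ln has_field_derivative 1 / x) (at x)"
      using nz by (auto intro!: derivative_eq_intros simp: divide_inverse)
    show "((\<lambda>x. 1 / (2 * x)) has_field_derivative - (2 / (2 * x)\<^sup>2)) (at x)"
      using nz by (auto intro!: derivative_eq_intros simp: power2_eq_square)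
  qed
  then show "(stirling_remainder' has_field_derivative stirling_remainder'' x) (at x)"
    by (rule DERIV_cong) (use nz in \<open>simp add: stirling_remainder''_def power2_eq_square field_simps\<close>)
qed

text \<open>With \<open>u\<^sub>k = 1 / (x + k)\<close> one has \<open>u\<^sub>k - u\<^sub>k\<^sub>+\<^sub>1 = u\<^sub>k u\<^sub>k\<^sub>+\<^sub>1\<close>. Telescoping \<open>1 / x\<close> and \<open>1 / x\<^sup>2\<close> along the
series of the trigamma function therefore gives \<open>R''(x) = \<Sum>\<^sub>k (u\<^sub>k u\<^sub>k\<^sub>+\<^sub>1)\<^sup>2 / 2\<close>, and the same telescoping
sums the resulting bound.\<close>

lemma stirling_remainder''_bound:
  assumes x: "Re x > 0"
  shows "cmod (stirling_remainder'' x) \<le> 1 / (2 * Re x ^ 3)"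
proof -
  define u where "u k = 1 / (x + of_nat k)" for k
  define v where "v k = 1 / (Re x + of_nat k)" for k
  have nz: "x + of_nat k \<noteq> 0" for k
    using Re_pos_nonpos(3)[of "x + of_nat k"] x by simp
  have inf: "filterlim (\<lambda>k. x + of_nat k) at_infinity sequentially"
    by (intro tendsto_add_filterlim_at_infinity[OF tendsto_const] tendsto_of_nat)
  have u_lim: "u \<longlonglongrightarrow> 0"
    unfolding u_def by (rule tendsto_divide_0[OF tendsto_const inf])
  have v_lim: "v \<longlonglongrightarrow> 0"
    unfolding v_def using x by real_asymp
  have diff: "u k - u (Suc k) = u k * u (Suc k)" for k
    using nz[of k] nz[of "Suc k"] unfolding u_def by (simp add: field_simps)
  have diff_v: "v k - v (Suc k) = v k * v (Suc k)" for k
    using x unfolding v_def by (simp add: field_simps add_pos_nonneg)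
  have s1: "(\<lambda>k. (u (Suc k))\<^sup>2) sums Polygamma 1 (1 + x)"
    using Polygamma_LIMSEQ[of "1 + x" 1] Re_pos_nonpos(3)[of "1 + x"] x
    by (simp add: u_def add_ac power2_eq_square divide_inverse)
  have s2: "(\<lambda>k. u k - u (Suc k)) sums (u 0 - 0)" by (rule telescope_sums'[OF u_lim])
  have s3: "(\<lambda>k. (u k)\<^sup>2 - (u (Suc k))\<^sup>2) sums ((u 0)\<^sup>2 - 0)"
    using telescope_sums'[of "\<lambda>k. (u k)\<^sup>2" 0] tendsto_power[OF u_lim, of 2] by simp
  have "(\<lambda>k. (u (Suc k))\<^sup>2 - (u k - u (Suc k)) + 1 / 2 * ((u k)\<^sup>2 - (u (Suc k))\<^sup>2))
      sums (Polygamma 1 (1 + x) - (u 0 - 0) + 1 / 2 * ((u 0)\<^sup>2 - 0))"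
    by (intro sums_add sums_diff sums_mult s1 s2 s3)
  also have "(\<lambda>k. (u (Suc k))\<^sup>2 - (u k - u (Suc k)) + 1 / 2 * ((u k)\<^sup>2 - (u (Suc k))\<^sup>2))
      = (\<lambda>k. 1 / 2 * (u k * u (Suc k))\<^sup>2)"
  proof
    fix k
    have "1 / 2 * (u k - u (Suc k))\<^sup>2 = (u (Suc k))\<^sup>2 - u k * u (Suc k) + 1 / 2 * ((u k)\<^sup>2 - (u (Suc k))\<^sup>2)"
      by (simp add: power2_eq_square algebra_simps)
    then show "(u (Suc k))\<^sup>2 - (u k - u (Suc k)) + 1 / 2 * ((u k)\<^sup>2 - (u (Suc k))\<^sup>2) = 1 / 2 * (u k * u (Suc k))\<^sup>2"
      by (simp only: diff)
  qed
  also have "Polygamma 1 (1 + x) - (u 0 - 0) + 1 / 2 * ((u 0)\<^sup>2 - 0) = stirling_remainder'' x"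
    by (simp add: stirling_remainder''_def u_def power_divide)
  finally have S: "(\<lambda>k. 1 / 2 * (u k * u (Suc k))\<^sup>2) sums stirling_remainder'' x" .
  have T: "(\<lambda>k. 1 / (2 * Re x ^ 2) * (v k - v (Suc k))) sums (1 / (2 * Re x ^ 2) * (v 0 - 0))"
    by (intro sums_mult telescope_sums'[OF v_lim])
  have bound: "cmod (1 / 2 * (u k * u (Suc k))\<^sup>2) \<le> 1 / (2 * Re x ^ 2) * (v k - v (Suc k))" for k
  proof -
    have v0: "v k > 0" "v k \<le> 1 / Re x" for k using x by (auto simp: v_def intro!: divide_left_mono add_pos_nonneg)
    have uv: "cmod (u k) \<le> v k" for k
    proof -
      have "Re x + real k \<le> cmod (x + of_nat k)" using complex_Re_le_cmod[of "x + of_nat k"] by simp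
      then show ?thesis unfolding u_def v_def using x by (simp add: norm_divide frac_le add_pos_nonneg)
    qed
    have "cmod (1 / 2 * (u k * u (Suc k))\<^sup>2) = 1 / 2 * (cmod (u k) * cmod (u (Suc k)))\<^sup>2"
      by (simp add: norm_mult norm_power norm_divide)
    also have "\<dots> \<le> 1 / 2 * (v k * v (Suc k))\<^sup>2"
      using uv[of k] uv[of "Suc k"] v0(1)[of k] by (intro mult_left_mono power_mono mult_mono) auto
    also have "\<dots> = 1 / 2 * ((v k * v (Suc k)) * (v k * v (Suc k)))" by (simp add: power2_eq_square)
    also have "\<dots> \<le> 1 / 2 * ((1 / Re x * (1 / Re x)) * (v k * v (Suc k)))"
      using v0[of k] v0[of "Suc k"] x by (intro mult_left_mono mult_right_mono mult_mono) auto
    also have "\<dots> = 1 / (2 * Re x ^ 2) * (v k - v (Suc k))"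
      by (simp add: diff_v power2_eq_square)
    finally show ?thesis .
  qed
  have "cmod (stirling_remainder'' x) \<le> 1 / (2 * Re x ^ 2) * (v 0 - 0)"
    by (rule norm_sums_le[OF S T bound])
  also have "\<dots> = 1 / (2 * Re x ^ 3)" by (simp add: v_def power2_eq_square power3_eq_cube)
  finally show ?thesis .
qed

text \<open>A function that tends to \<open>0\<close> is controlled by the tail integral of its derivative; here the tail integral is replaced
by a primitive \<open>G\<close> that also tends to \<open>0\<close>, so that \<open>f + G\<close> decreases and \<open>f - G\<close> increases.\<close>

lemma decay_from_derivative:
  fixes f f' G G' :: "real \<Rightarrow> real"
  assumes f: "\<And>x. x > 0 \<Longrightarrow> (f has_real_derivative f' x) (at x)"
    and G: "\<And>x. x > 0 \<Longrightarrow> (G has_real_derivative G' x) (at x)"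
    and bound: "\<And>x. x > 0 \<Longrightarrow> \<bar>f' x\<bar> \<le> - G' x"
    and lim: "(f \<longlongrightarrow> 0) at_top" "(G \<longlongrightarrow> 0) at_top" and x: "x > 0"
  shows "\<bar>f x\<bar> \<le> G x"
proof -
  have "f x + G x \<ge> 0"
  proof (rule tendsto_le[OF trivial_limit_at_top_linorder tendsto_const])
    show "((\<lambda>y. f y + G y) \<longlongrightarrow> 0) at_top" using tendsto_add[OF lim] by simp
    show "\<forall>\<^sub>F y in at_top. f y + G y \<le> f x + G x"
      using eventually_ge_at_top[of x]
    proof eventually_elim
      case (elim y)
      show ?case
      proof (rule DERIV_nonpos_imp_nonincreasing[OF elim])
        fix t assume "x \<le> t" "t \<le> y"
        then show "\<exists>d. ((\<lambda>y. f y + G y) has_real_derivative d) (at t) \<and> d \<le> 0"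
          using DERIV_add[OF f[of t] G[of t]] bound[of t] x by (intro exI[of _ "f' t + G' t"]) auto
      qed
    qed
  qed
  moreover have "f x - G x \<le> 0"
  proof (rule tendsto_le[OF trivial_limit_at_top_linorder _ tendsto_const])
    show "((\<lambda>y. f y - G y) \<longlongrightarrow> 0) at_top" using tendsto_diff[OF lim] by simp
    show "\<forall>\<^sub>F y in at_top. f x - G x \<le> f y - G y"
      using eventually_ge_at_top[of x]
    proof eventually_elim
      case (elim y)
      show ?case
      proof (rule DERIV_nonneg_imp_nondecreasing[OF elim])
        fix t assume "x \<le> t" "t \<le> y"
        then show "\<exists>d. ((\<lambda>y. f y - G y) has_real_derivative d) (at t) \<and> 0 \<le> d"
          using DERIV_diff[OF f[of t] G[of t]] bound[of t] x by (intro exI[of _ "f' t - G' t"]) auto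
      qed
    qed
  qed
  ultimately show ?thesis by linarith
qed

lemma Re_field_derivative:
  assumes "(f has_field_derivative f') (at (complex_of_real x))"
  shows "((\<lambda>x. Re (f (of_real x))) has_real_derivative Re f') (at x)"
proof -
  have "((f \<circ> complex_of_real) has_vector_derivative f') (at x)"
  proof -
    have "((\<lambda>x. complex_of_real x) has_vector_derivative of_real 1) (at x)"
      by (rule bounded_linear.has_vector_derivative[OF bounded_linear_of_real has_vector_derivative_id])
    from field_vector_diff_chain_at[OF this assms] show ?thesis by simp
  qed
  then have "((\<lambda>x. Re ((f \<circ> complex_of_real) x)) has_vector_derivative Re f') (at x)"
    by (rule bounded_linear.has_vector_derivative[OF bounded_linear_Re])
  then show ?thesis by (simp add: has_real_derivative_iff_has_vector_derivative)
qed

lemma stirling_remainder_real_tendsto: "((\<lambda>x. Re (stirling_remainder (of_real x))) \<longlongrightarrow> 0) at_top"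
proof -
  have "((\<lambda>a. ln (Gamma (a + 1) / (a powr (a + 1 / 2) * exp (- a)))) \<longlongrightarrow> ln (sqrt (2 * pi))) at_top"
    by (intro tendsto_ln Gamma_stirling) simp
  then have "((\<lambda>a. ln (Gamma (a + 1) / (a powr (a + 1 / 2) * exp (- a))) - ln (sqrt (2 * pi))) \<longlongrightarrow> 0) at_top"
    using tendsto_diff[OF _ tendsto_const[of "ln (sqrt (2 * pi))"]] by fastforce
  moreover have "\<forall>\<^sub>F a in at_top. ln (Gamma (a + 1) / (a powr (a + 1 / 2) * exp (- a))) - ln (sqrt (2 * pi))
      = Re (stirling_remainder (of_real a))"
    using eventually_gt_at_top[of 0]
  proof eventually_elim
    case (elim a)
    have G: "Gamma (a + 1) > 0" using elim by (intro Gamma_real_pos) auto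
    have l: "ln_Gamma (1 + complex_of_real a) = of_real (ln (Gamma (a + 1)))"
      using ln_Gamma_complex_of_real[of "1 + a"] ln_Gamma_real_pos[of "1 + a"] elim by (simp add: add.commute)
    have "ln (Gamma (a + 1) / (a powr (a + 1 / 2) * exp (- a))) = ln (Gamma (a + 1)) - (a + 1 / 2) * ln a + a"
      using less_imp_neq[OF G, symmetric] elim by (simp add: ln_div ln_mult ln_powr)
    moreover have "ln (sqrt (2 * pi)) = ln (2 * pi) / 2" by (intro ln_sqrt) auto
    moreover have "(complex_of_real a + 1 / 2) * Ln (complex_of_real a) = of_real ((a + 1 / 2) * ln a)"
      using elim by (simp add: Ln_of_real)
    ultimately show ?case unfolding stirling_remainder_def l by (simp del: of_real_mult)
  qed
  ultimately show ?thesis by (rule Lim_transform_eventually)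
qed

lemma stirling_remainder_real:
  assumes x: "x > 0"
  shows "stirling_remainder (of_real x) \<in> \<real>" "stirling_remainder' (of_real x) \<in> \<real>"
proof -
  have "ln_Gamma (1 + complex_of_real x) = of_real (ln_Gamma (1 + x))"
    using ln_Gamma_complex_of_real[of "1 + x"] x by simp
  then show "stirling_remainder (of_real x) \<in> \<real>"
    unfolding stirling_remainder_def using x by (simp add: Ln_of_real)
  have "Digamma (1 + complex_of_real x) = of_real (Digamma (1 + x))"
    using Polygamma_of_real[of "1 + x" 0] x by simp
  then show "stirling_remainder' (of_real x) \<in> \<real>"
    unfolding stirling_remainder'_def using x by (simp add: Ln_of_real)
qed

text \<open>The bound on \<open>R''\<close> is integrated twice from infinity. This needs that \<open>R\<close> and \<open>R'\<close> tend to \<open>0\<close> there: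
for \<open>R\<close> this is Stirling's formula, and for \<open>R'\<close> it follows from the mean value theorem because \<open>R''\<close> is small.\<close>

lemma stirling_remainder_real_bounds:
  assumes x: "x > 0"
  shows "cmod (stirling_remainder (of_real x)) \<le> 1 / (4 * x)"
    and "cmod (stirling_remainder' (of_real x)) \<le> 1 / (4 * x\<^sup>2)"
proof -
  define r where "r x = Re (stirling_remainder (of_real x))" for x
  define r' where "r' x = Re (stirling_remainder' (of_real x))" for x
  define r'' where "r'' x = Re (stirling_remainder'' (of_real x))" for x
  have d: "(r has_real_derivative r' x) (at x)" "(r' has_real_derivative r'' x) (at x)" if "x > 0" for x
    unfolding r_def[abs_def] r'_def[abs_def] r''_def using that
    by (auto intro!: Re_field_derivative stirling_remainder_deriv)
  have b'': "\<bar>r'' x\<bar> \<le> 1 / (2 * x ^ 3)" if "x > 0" for x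
    using stirling_remainder''_bound[of "of_real x"] abs_Re_le_cmod[of "stirling_remainder'' (of_real x)"] that
    by (simp add: r''_def)
  have r_lim: "(r \<longlongrightarrow> 0) at_top"
    unfolding r_def by (rule stirling_remainder_real_tendsto)
  have r'_lim: "(r' \<longlongrightarrow> 0) at_top"
  proof (rule Lim_null_comparison)
    have shift: "((\<lambda>x. r (x + 1)) \<longlongrightarrow> 0) at_top"
      by (rule filterlim_compose[OF r_lim]) real_asymp
    have "((\<lambda>x::real. 1 / (2 * x ^ 3)) \<longlongrightarrow> 0) at_top" by real_asymp
    then show "((\<lambda>x. \<bar>r (x + 1) - r x\<bar> + 1 / (2 * x ^ 3)) \<longlongrightarrow> 0) at_top"
      using tendsto_add[OF tendsto_rabs_zero[OF tendsto_diff[OF shift r_lim, simplified]]] by fastforce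
    show "\<forall>\<^sub>F x in at_top. norm (r' x) \<le> \<bar>r (x + 1) - r x\<bar> + 1 / (2 * x ^ 3)"
      using eventually_gt_at_top[of 0]
    proof eventually_elim
      case (elim x)
      obtain \<xi> where \<xi>: "x < \<xi>" "\<xi> < x + 1" "r (x + 1) - r x = (x + 1 - x) * r' \<xi>"
        using MVT2[of x "x + 1" r r'] d(1) elim by auto
      obtain \<eta> where \<eta>: "x < \<eta>" "\<eta> < \<xi>" "r' \<xi> - r' x = (\<xi> - x) * r'' \<eta>"
        using MVT2[of x \<xi> r' r''] d(2) elim \<xi> by auto
      have "\<bar>r' \<xi> - r' x\<bar> \<le> 1 * (1 / (2 * \<eta> ^ 3))"
        unfolding \<eta>(3) abs_mult using \<xi> \<eta> b''[of \<eta>] elim by (intro mult_mono) auto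
      also have "\<dots> \<le> 1 / (2 * x ^ 3)"
        using \<eta> elim by (simp add: frac_le power_mono)
      finally show ?case using \<xi>(3) by simp
    qed
  qed
  have b': "\<bar>r' x\<bar> \<le> 1 / (4 * x\<^sup>2)" if "x > 0" for x
  proof (rule decay_from_derivative[where f = r' and f' = r'' and G = "\<lambda>x. 1 / (4 * x\<^sup>2)" and G' = "\<lambda>x. - 1 / (2 * x ^ 3)"])
    show "((\<lambda>x. 1 / (4 * x\<^sup>2)) has_real_derivative - 1 / (2 * x ^ 3)) (at x)" if "x > 0" for x :: real
      using that by (auto intro!: derivative_eq_intros simp: power2_eq_square power3_eq_cube field_simps)
    show "((\<lambda>x::real. 1 / (4 * x\<^sup>2)) \<longlongrightarrow> 0) at_top" by real_asymp
  qed (use d b'' r'_lim that in auto)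
  have b: "\<bar>r x\<bar> \<le> 1 / (4 * x)" if "x > 0" for x
  proof (rule decay_from_derivative[where f = r and f' = r' and G = "\<lambda>x. 1 / (4 * x)" and G' = "\<lambda>x. - 1 / (4 * x\<^sup>2)"])
    show "((\<lambda>x. 1 / (4 * x)) has_real_derivative - 1 / (4 * x\<^sup>2)) (at x)" if "x > 0" for x :: real
      using that by (auto intro!: derivative_eq_intros simp: power2_eq_square field_simps)
    show "((\<lambda>x::real. 1 / (4 * x)) \<longlongrightarrow> 0) at_top" by real_asymp
  qed (use d b' r_lim that in auto)
  show "cmod (stirling_remainder (of_real x)) \<le> 1 / (4 * x)"
    using b[OF x] in_Reals_norm[OF stirling_remainder_real(1)[OF x]] by (simp add: r_def)
  show "cmod (stirling_remainder' (of_real x)) \<le> 1 / (4 * x\<^sup>2)"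
    using b'[OF x] in_Reals_norm[OF stirling_remainder_real(2)[OF x]] by (simp add: r'_def)
qed

text \<open>The value needed below is \<open>R (x (1 + s)) - (1 + s) R x\<close>, whose linear part in \<open>s\<close> is
  \<open>x R' x - R x = O (1 / x)\<close> and whose second order part is controlled by \<open>R''\<close> on the disc of
  radius \<open>x / 2\<close> around \<open>x\<close>.\<close>

lemma stirling_remainder_dilation:
  assumes x: "x > 0" and s: "cmod s \<le> 1 / 2"
  shows "cmod (stirling_remainder (of_real x * (1 + s)) - (1 + s) * stirling_remainder (of_real x)) \<le> 3 * cmod s / x"
proof -
  let ?R = stirling_remainder and ?R' = stirling_remainder'
  let ?S = "cball (complex_of_real x) (x / 2)"
  define f where "f i = (if i = 0 then ?R else if i = 1 then ?R' else stirling_remainder'')" for i :: nat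
  have Re: "Re y \<ge> x / 2" if "y \<in> ?S" for y
    using that abs_Re_le_cmod[of "of_real x - y"] by (simp add: dist_norm)
  have T: "cmod (f 0 (of_real x * (1 + s)) - (\<Sum>i\<le>1. f i (of_real x) * (of_real x * (1 + s) - of_real x) ^ i / fact i))
      \<le> (4 / x ^ 3) * cmod (of_real x * (1 + s) - of_real x) ^ Suc 1 / fact 1"
  proof (rule complex_Taylor[of ?S])
    fix i y assume y: "y \<in> ?S" and i: "i \<le> (1::nat)"
    have "Re y > 0" using Re[OF y] x by linarith
    then show "(f i has_field_derivative f (Suc i) y) (at y within ?S)"
      using i stirling_remainder_deriv[of y] by (cases i) (auto simp: f_def intro: has_field_derivative_at_within)
  next
    fix y assume y: "y \<in> ?S"
    have "cmod (stirling_remainder'' y) \<le> 1 / (2 * Re y ^ 3)"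
      using Re[OF y] x by (intro stirling_remainder''_bound) auto
    also have "\<dots> \<le> 1 / (2 * (x / 2) ^ 3)"
      using Re[OF y] x by (intro divide_left_mono mult_left_mono power_mono mult_pos_pos zero_less_power) auto
    also have "\<dots> = 4 / x ^ 3" by (simp add: power_divide)
    finally show "cmod (f (Suc 1) y) \<le> 4 / x ^ 3" by (simp add: f_def)
  next
    show "of_real x * (1 + s) \<in> ?S"
      using s x by (simp add: dist_norm algebra_simps norm_mult)
  qed (use x in auto)
  have d: "of_real x * (1 + s) - of_real x = of_real x * s" by (simp add: algebra_simps)
  have "cmod (?R (of_real x * (1 + s)) - (?R (of_real x) + ?R' (of_real x) * (of_real x * s)))
      \<le> (4 / x ^ 3) * (x * cmod s)\<^sup>2"
    using T x unfolding d by (simp add: f_def norm_mult power2_eq_square)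
  also have "\<dots> = 4 * (cmod s)\<^sup>2 / x" using x by (simp add: power2_eq_square power3_eq_cube)
  also have "\<dots> \<le> 2 * cmod s / x"
    using mult_right_mono[OF s norm_ge_zero[of s]] x by (intro divide_right_mono) (auto simp: power2_eq_square)
  finally have 1: "cmod (?R (of_real x * (1 + s)) - (?R (of_real x) + ?R' (of_real x) * (of_real x * s))) \<le> 2 * cmod s / x" .
  have 2: "cmod (s * (of_real x * ?R' (of_real x) - ?R (of_real x))) \<le> cmod s / x"
  proof -
    have "cmod (of_real x * ?R' (of_real x) - ?R (of_real x)) \<le> x * (1 / (4 * x\<^sup>2)) + 1 / (4 * x)"
      using stirling_remainder_real_bounds(1)[OF x] x
        mult_left_mono[OF stirling_remainder_real_bounds(2)[OF x], of x]
      by (intro order_trans[OF norm_triangle_ineq4] add_mono) (simp_all add: norm_mult)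
    also have "\<dots> \<le> 1 / x" using x by (simp add: power2_eq_square field_simps)
    finally have "cmod s * cmod (of_real x * ?R' (of_real x) - ?R (of_real x)) \<le> cmod s * (1 / x)"
      by (rule mult_left_mono) simp
    then show ?thesis by (simp add: norm_mult)
  qed
  have "?R (of_real x * (1 + s)) - (1 + s) * ?R (of_real x)
      = (?R (of_real x * (1 + s)) - (?R (of_real x) + ?R' (of_real x) * (of_real x * s)))
        + s * (of_real x * ?R' (of_real x) - ?R (of_real x))"
    by (simp add: algebra_simps)
  also have "cmod \<dots> \<le> 2 * cmod s / x + cmod s / x"
    by (rule order_trans[OF norm_triangle_ineq add_mono[OF 1 2]])
  finally show ?thesis using x by (simp add: field_simps)
qed

section \<open>Expansion of the cumulant generating function\<close>

text \<open>The exponent in \<open>hermite_mgf\<close>: a branch of the logarithm of the moment generating function that is holomorphic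
in \<open>Re z > -1\<close>.\<close>

definition log_mgf :: "real \<Rightarrow> nat \<Rightarrow> complex \<Rightarrow> complex" where
  "log_mgf \<beta> n z = z * of_real (real n * hermite_E \<beta>) - (1 + z) * log_partition n (of_real (\<beta> / 2))
             + log_partition n (of_real (\<beta> / 2) * (1 + z))"

text \<open>The part of \<open>log_mgf\<close> that grows like \<open>n\<close>, per particle.\<close>

definition cumulant_density :: "real \<Rightarrow> complex \<Rightarrow> complex" where
  "cumulant_density b s = of_real b * ((1 + s) * Ln (1 + s) - s)
     - (ln_Gamma (1 + of_real b * (1 + s)) - ln_Gamma (1 + of_real b) - of_real b * s * Digamma (1 + of_real b))"

definition dilation_error :: "real \<Rightarrow> complex \<Rightarrow> complex" where
  "dilation_error x s = stirling_remainder (of_real x * (1 + s)) - (1 + s) * stirling_remainder (of_real x)"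

lemma ln_Gamma_stirling:
  assumes x: "x > 0" and s: "Re s > -1"
  shows "ln_Gamma (1 + of_real x * (1 + s)) = (of_real x * (1 + s) + 1 / 2) * (of_real (ln x) + Ln (1 + s))
     - of_real x * (1 + s) + of_real (ln (2 * pi) / 2) + stirling_remainder (of_real x * (1 + s))"
proof -
  have "1 + s \<noteq> 0" using Re_pos_nonpos(3)[of "1 + s"] s by simp
  then have "Ln (of_real x * (1 + s)) = of_real (ln x) + Ln (1 + s)" using x by (simp add: Ln_times_of_real Ln_of_real)
  then show ?thesis by (simp add: stirling_remainder_def)
qed

lemma ln_Gamma_dilation:
  assumes x: "x > 0" and s: "Re s > -1"
  shows "ln_Gamma (1 + of_real x * (1 + s)) - (1 + s) * ln_Gamma (1 + of_real x)
     = of_real x * ((1 + s) * Ln (1 + s)) + Ln (1 + s) / 2 - s / 2 * of_real (ln x) - s * of_real (ln (2 * pi) / 2)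
       + dilation_error x s"
proof -
  have e: "ln_Gamma (1 + complex_of_real x) = (of_real x + 1 / 2) * of_real (ln x)
     - of_real x + of_real (ln (2 * pi) / 2) + stirling_remainder (of_real x)"
    using ln_Gamma_stirling[OF x, of 0] by simp
  show ?thesis
    unfolding ln_Gamma_stirling[OF x s] e dilation_error_def by (simp add: field_simps)
qed

lemma sum_dilation:
  assumes b: "b > 0" and s: "Re s > -1"
  shows "(\<Sum>j\<in>{1..n}. ln_Gamma (1 + of_nat j * (of_real b * (1 + s)))) - (1 + s) * (\<Sum>j\<in>{1..n}. ln_Gamma (1 + of_nat j * of_real b))
     = of_real b * ((1 + s) * Ln (1 + s)) * (of_nat n * (of_nat n + 1) / 2) + of_nat n * Ln (1 + s) / 2
       - s / 2 * (of_nat n * of_real (ln b) + ln_Gamma (1 + of_nat n)) - s * of_nat n * of_real (ln (2 * pi) / 2)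
       + (\<Sum>j\<in>{1..n}. dilation_error (real j * b) s)"
proof (induction n)
  case 0
  have "ln_Gamma (1 :: complex) = 0" using ln_Gamma_complex_conv_fact[of 1] by simp
  then show ?case by simp
next
  case (Suc n)
  have lnG: "ln_Gamma (1 + complex_of_nat (Suc n)) = of_real (ln (real (Suc n))) + ln_Gamma (1 + of_nat n)"
  proof -
    have "ln (fact (Suc n) :: real) = ln (real (Suc n)) + ln (fact n)"
      by (simp add: ln_mult del: of_nat_Suc)
    moreover have lf: "ln_Gamma (1 + of_nat m :: complex) = of_real (ln (fact m))" for m
      using ln_Gamma_complex_of_real[of "real (Suc m)"] ln_Gamma_real_conv_fact[of "Suc m"] by simp
    ultimately show ?thesis unfolding lf by (simp only: of_real_add)
  qed
  have t: "ln_Gamma (1 + of_nat (Suc n) * (of_real b * (1 + s))) - (1 + s) * ln_Gamma (1 + of_nat (Suc n) * of_real b)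
     = of_real (real (Suc n) * b) * ((1 + s) * Ln (1 + s)) + Ln (1 + s) / 2
       - s / 2 * (of_real (ln (real (Suc n))) + of_real (ln b)) - s * of_real (ln (2 * pi) / 2) + dilation_error (real (Suc n) * b) s"
    using ln_Gamma_dilation[of "real (Suc n) * b" s] b s by (simp add: ln_mult mult.assoc del: of_nat_Suc)
  define X where "X = of_real b * ((1 + s) * Ln (1 + s))"
  have x: "of_real (real (Suc n) * b) * ((1 + s) * Ln (1 + s)) = (of_nat n + 1) * X" by (simp add: X_def algebra_simps)
  have "(\<Sum>j\<in>{1..Suc n}. ln_Gamma (1 + of_nat j * (of_real b * (1 + s)))) - (1 + s) * (\<Sum>j\<in>{1..Suc n}. ln_Gamma (1 + of_nat j * of_real b))
      = ((\<Sum>j\<in>{1..n}. ln_Gamma (1 + of_nat j * (of_real b * (1 + s)))) - (1 + s) * (\<Sum>j\<in>{1..n}. ln_Gamma (1 + of_nat j * of_real b)))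
        + (ln_Gamma (1 + of_nat (Suc n) * (of_real b * (1 + s))) - (1 + s) * ln_Gamma (1 + of_nat (Suc n) * of_real b))"
    unfolding sum.cl_ivl_Suc by (simp add: distrib_left del: of_nat_Suc)
  note eq = this[unfolded Suc.IH t]
  show ?case
    unfolding eq lnG x X_def[symmetric] by (simp add: sum.cl_ivl_Suc field_simps)
qed

text \<open>An exact identity: Stirling's formula is applied to every factor \<open>\<Gamma>(1 + j b)\<close> of the partition function and to
\<open>n!\<close>, and all terms that are not of order \<open>n\<close> cancel, except those collected in the second summand.\<close>

lemma log_mgf_eq:
  assumes \<beta>: "\<beta> > 0" and n: "n \<ge> 1" and s: "Re s > -1"
  defines "b \<equiv> \<beta> / 2"
  shows "log_mgf \<beta> n s = of_nat n * cumulant_density b s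
     + ((\<Sum>j\<in>{1..n}. dilation_error (real j * b) s) - s / 4 * of_real (ln (real n))
        - s / 2 * (of_real (ln (2 * pi) / 2) + stirling_remainder (of_nat n)))"
proof -
  define N B c lb L l where "N = complex_of_nat n" and "B = complex_of_real b" and "c = complex_of_real (ln (2 * pi) / 2)"
    and "lb = complex_of_real (ln b)" and "L = Ln (1 + s)" and "l = complex_of_real (ln (real n))"
  define S1 S0 G1 G0 D where "S1 = (\<Sum>j\<in>{1..n}. ln_Gamma (1 + of_nat j * (B * (1 + s))))"
    and "S0 = (\<Sum>j\<in>{1..n}. ln_Gamma (1 + of_nat j * B))"
    and "G1 = ln_Gamma (1 + B * (1 + s))" and "G0 = ln_Gamma (1 + B)" and "D = Digamma (1 + B)"
  define P Rn where "P = (\<Sum>j\<in>{1..n}. dilation_error (real j * b) s)" and "Rn = stirling_remainder (of_nat n)"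
  have b: "b > 0" using \<beta> by (simp add: b_def)
  have nn: "of_nat (n * (n - 1)) = N * (N - 1)" using n by (cases n) (auto simp: N_def algebra_simps)
  have s1: "1 + s \<noteq> 0" using Re_pos_nonpos(3)[of "1 + s"] s by simp
  have lp1: "log_partition n (B * (1 + s)) = - (N + B * (1 + s) * (N * (N - 1))) / 2 * (lb + L + l) + N * c + S1 - N * G1"
    unfolding log_partition_def nn using b s1
    by (simp add: B_def Ln_times_of_real Ln_of_real lb_def L_def l_def c_def S1_def G1_def N_def)
  have lp0: "log_partition n B = - (N + B * (N * (N - 1))) / 2 * (lb + l) + N * c + S0 - N * G0"
    unfolding log_partition_def nn using b
    by (simp add: B_def Ln_of_real lb_def l_def c_def S0_def G0_def N_def)
  have lnG: "ln_Gamma (1 + N) = (N + 1 / 2) * l - N + c + Rn"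
  proof -
    have "Ln (complex_of_nat n) = of_real (ln (real n))" using Ln_of_real[of "real n"] n by simp
    then show ?thesis unfolding N_def Rn_def stirling_remainder_def l_def c_def by simp
  qed
  have S1: "S1 = (1 + s) * S0 + B * ((1 + s) * L) * (N * (N + 1) / 2) + N * L / 2
      - s / 2 * (N * lb + ((N + 1 / 2) * l - N + c + Rn)) - s * N * c + P"
    using sum_dilation[OF b s, of n, folded N_def B_def L_def lb_def c_def P_def, folded S1_def S0_def] unfolding lnG
    by (simp add: algebra_simps)
  have E: "complex_of_real (real n * hermite_E \<beta>) = N * (2 * c - 1 / 2 - B + B * D - G0)"
  proof -
    have "D = of_real (Digamma (1 + b))" using Polygamma_of_real[of "1 + b" 0] b by (simp add: D_def B_def)
    moreover have "G0 = of_real (log_Gamma (1 + b))"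
      using ln_Gamma_complex_of_real[of "1 + b"] ln_Gamma_real_pos[of "1 + b"] b by (simp add: G0_def B_def log_Gamma_def)
    ultimately show ?thesis by (simp add: hermite_E_def Let_def b_def[symmetric] N_def B_def c_def)
  qed
  have "s * (N * (2 * c - 1 / 2 - B + B * D - G0)) - (1 + s) * log_partition n B + log_partition n (B * (1 + s))
      = N * (B * ((1 + s) * L - s) - (G1 - G0 - B * s * D)) + (P - s / 4 * l - s / 2 * (c + Rn))"
    unfolding lp1 lp0 S1 by (simp add: field_simps)
  then show ?thesis
    unfolding log_mgf_def cumulant_density_def E b_def[symmetric]
    by (simp only: N_def B_def L_def c_def l_def G0_def G1_def D_def P_def Rn_def)
qed

lemma cumulant_density_taylor:
  assumes b: "b > 0"
  obtains K where "\<And>s. cmod s \<le> 1 / 2 \<Longrightarrow>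
     cmod (cumulant_density b s - (of_real (b - b\<^sup>2 * Polygamma 1 (1 + b)) * s\<^sup>2 / 2
             - of_real (b ^ 3 * Polygamma 2 (1 + b) + b) * s ^ 3 / 6)) \<le> K * cmod s ^ 4"
proof -
  let ?B = "complex_of_real b" and ?S = "cball (0::complex) (1 / 2)"
  define f4 where "f4 s = 2 * ?B / (1 + s) ^ 3 - ?B ^ 4 * Polygamma 3 (1 + ?B * (1 + s))" for s
  define f where "f i = (if i = 0 then cumulant_density b
     else if i = 1 then (\<lambda>s. ?B * Ln (1 + s) - ?B * Digamma (1 + ?B * (1 + s)) + ?B * Digamma (1 + ?B))
     else if i = 2 then (\<lambda>s. ?B / (1 + s) - ?B\<^sup>2 * Polygamma 1 (1 + ?B * (1 + s)))
     else if i = 3 then (\<lambda>s. - ?B / (1 + s)\<^sup>2 - ?B ^ 3 * Polygamma 2 (1 + ?B * (1 + s)))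
     else f4)" for i :: nat
  have Re: "Re s \<ge> - 1 / 2" if "s \<in> ?S" for s
    using that abs_Re_le_cmod[of s] by simp
  have good: "1 + s \<noteq> 0" "1 + s \<notin> \<real>\<^sub>\<le>\<^sub>0" "1 + ?B * (1 + s) \<notin> \<real>\<^sub>\<le>\<^sub>0" "1 + ?B * (1 + s) \<notin> \<int>\<^sub>\<le>\<^sub>0" if "s \<in> ?S" for s
  proof -
    have "Re (1 + s) > 0" using Re[OF that] by simp
    moreover from this have "Re (1 + ?B * (1 + s)) > 0" using b by (simp add: add_pos_pos)
    ultimately show "1 + s \<noteq> 0" "1 + s \<notin> \<real>\<^sub>\<le>\<^sub>0" "1 + ?B * (1 + s) \<notin> \<real>\<^sub>\<le>\<^sub>0" "1 + ?B * (1 + s) \<notin> \<int>\<^sub>\<le>\<^sub>0"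
      using Re_pos_nonpos by blast+
  qed
  have P: "((\<lambda>s. Polygamma m (1 + ?B * (1 + s))) has_field_derivative Polygamma (Suc m) (1 + ?B * (1 + s)) * ?B) (at s within ?S)"
    if "s \<in> ?S" for m s
    by (rule DERIV_chain2[OF has_field_derivative_Polygamma]) (use good[OF that] in \<open>auto intro!: derivative_eq_intros\<close>)
  have G: "((\<lambda>s. ln_Gamma (1 + ?B * (1 + s))) has_field_derivative Digamma (1 + ?B * (1 + s)) * ?B) (at s within ?S)"
    if "s \<in> ?S" for s
    by (rule DERIV_chain2[OF has_field_derivative_ln_Gamma_complex]) (use good[OF that] in \<open>auto intro!: derivative_eq_intros\<close>)
  have L: "((\<lambda>s. Ln (1 + s)) has_field_derivative 1 / (1 + s)) (at s within ?S)" if "s \<in> ?S" for s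
  proof -
    have "((\<lambda>s. Ln (1 + s)) has_field_derivative inverse (1 + s) * 1) (at s within ?S)"
      by (rule DERIV_chain2[OF has_field_derivative_Ln]) (use good[OF that] in \<open>auto intro!: derivative_eq_intros\<close>)
    then show ?thesis by (simp only: inverse_eq_divide mult_1_right)
  qed
  have deriv: "(f i has_field_derivative f (Suc i) s) (at s within ?S)" if s: "s \<in> ?S" and i: "i \<le> 3" for i s
  proof -
    consider "i = 0" | "i = 1" | "i = 2" | "i = 3" using i by linarith
    then show ?thesis
    proof cases
      case 1
      show ?thesis unfolding f_def 1 using good[OF s]
        by (auto simp: cumulant_density_def[abs_def] intro!: derivative_eq_intros G[OF s])
    next
      case 2
      have "((\<lambda>s. ?B * Ln (1 + s) - ?B * Digamma (1 + ?B * (1 + s)) + ?B * Digamma (1 + ?B)) has_field_derivative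
          ?B * (1 / (1 + s)) - ?B * (Polygamma (Suc 0) (1 + ?B * (1 + s)) * ?B) + 0) (at s within ?S)"
        by (intro DERIV_add DERIV_diff DERIV_cmult DERIV_const L[OF s] P[OF s])
      then show ?thesis by (simp add: f_def 2 power2_eq_square mult_ac)
    next
      case 3
      have "((\<lambda>s. ?B / (1 + s)) has_field_derivative - ?B / (1 + s)\<^sup>2) (at s within ?S)"
        using good(1)[OF s] by (auto intro!: derivative_eq_intros simp: power2_eq_square)
      then have "((\<lambda>s. ?B / (1 + s) - ?B\<^sup>2 * Polygamma 1 (1 + ?B * (1 + s))) has_field_derivative
          - ?B / (1 + s)\<^sup>2 - ?B\<^sup>2 * (Polygamma (Suc 1) (1 + ?B * (1 + s)) * ?B)) (at s within ?S)"
        by (intro DERIV_diff DERIV_cmult P[OF s])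
      then show ?thesis by (simp add: f_def 3 power2_eq_square power3_eq_cube mult_ac numeral_2_eq_2)
    next
      case 4
      have "((\<lambda>s. - ?B / (1 + s)\<^sup>2) has_field_derivative 2 * ?B / (1 + s) ^ 3) (at s within ?S)"
        using good(1)[OF s]
        by (auto intro!: derivative_eq_intros simp: power2_eq_square power3_eq_cube divide_simps)
      then have "((\<lambda>s. - ?B / (1 + s)\<^sup>2 - ?B ^ 3 * Polygamma 2 (1 + ?B * (1 + s))) has_field_derivative
          2 * ?B / (1 + s) ^ 3 - ?B ^ 3 * (Polygamma (Suc 2) (1 + ?B * (1 + s)) * ?B)) (at s within ?S)"
        by (intro DERIV_diff DERIV_cmult P[OF s])
      moreover have "Suc 2 = 3" "?B ^ 4 = ?B ^ 3 * ?B" by (simp_all add: power4_eq_xxxx power3_eq_cube)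
      ultimately show ?thesis by (simp add: f_def 4 f4_def[abs_def] mult_ac)
    qed
  qed
  have "continuous_on ?S f4"
  proof -
    have "continuous_on ?S (\<lambda>s. Polygamma 3 (1 + ?B * (1 + s)))"
      unfolding continuous_on_eq_continuous_within using P[THEN DERIV_continuous] by blast
    then show ?thesis unfolding f4_def by (intro continuous_intros) (use good in auto)
  qed
  then have "compact (f4 ` ?S)" by (intro compact_continuous_image) auto
  then obtain C where C: "\<And>s. s \<in> ?S \<Longrightarrow> cmod (f4 s) \<le> C"
    by (meson compact_imp_bounded bounded_iff imageI)
  have "cmod (f 0 s - (\<Sum>i\<le>3. f i 0 * (s - 0) ^ i / fact i)) \<le> C * cmod (s - 0) ^ Suc 3 / fact 3" if "cmod s \<le> 1 / 2" for s
    by (rule complex_Taylor[of ?S 3 f C 0 s]) (use deriv C that in \<open>auto simp: f_def\<close>)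
  moreover have "(\<Sum>i\<le>3. f i 0 * (s - 0) ^ i / fact i)
      = of_real (b - b\<^sup>2 * Polygamma 1 (1 + b)) * s\<^sup>2 / 2 - of_real (b ^ 3 * Polygamma 2 (1 + b) + b) * s ^ 3 / 6" for s
  proof -
    have Pr: "Polygamma m (1 + ?B) = of_real (Polygamma m (1 + b))" for m
      using Polygamma_of_real[of "1 + b" m] b by simp
    have "(\<Sum>i\<le>3. f i 0 * (s - 0) ^ i / fact i) = f 0 0 + f 1 0 * s + f 2 0 * s\<^sup>2 / 2 + f 3 0 * s ^ 3 / 6"
      by (simp add: numeral_3_eq_3 numeral_2_eq_2 fact_numeral)
    also have "f 0 0 = 0" by (simp add: f_def cumulant_density_def)
    also have "f 1 0 = 0" by (simp add: f_def)
    also have "f 2 0 = of_real (b - b\<^sup>2 * Polygamma 1 (1 + b))" by (simp add: f_def Pr)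
    also have "f 3 0 = - of_real (b ^ 3 * Polygamma 2 (1 + b) + b)" by (simp add: f_def Pr)
    finally show ?thesis by (simp del: of_real_add of_real_diff of_real_mult)
  qed
  moreover have "f 0 = cumulant_density b" by (simp add: f_def)
  ultimately have "cmod (cumulant_density b s - (of_real (b - b\<^sup>2 * Polygamma 1 (1 + b)) * s\<^sup>2 / 2
             - of_real (b ^ 3 * Polygamma 2 (1 + b) + b) * s ^ 3 / 6)) \<le> C / fact 3 * cmod s ^ 4" if "cmod s \<le> 1 / 2" for s
    using that by simp
  then show ?thesis by (rule that)
qed

lemma deriv_log_Gamma:
  assumes "x > 0"
  shows "(deriv ^^ Suc m) log_Gamma x = Polygamma m x"
proof -
  have "(deriv ^^ Suc m) log_Gamma x = (deriv ^^ Suc m) ln_Gamma x"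
  proof (rule higher_deriv_cong_ev[OF _ refl])
    show "\<forall>\<^sub>F y in nhds x. log_Gamma y = ln_Gamma y"
      using eventually_nhds_in_open[of "{0<..}" x] assms
      by (auto elim!: eventually_mono simp: log_Gamma_def ln_Gamma_real_pos)
  qed
  then show ?thesis using higher_deriv_ln_Gamma_real[OF assms, of "Suc m"] by simp
qed

lemma hermite_sigma2_eq: "\<beta> > 0 \<Longrightarrow> hermite_sigma2 \<beta> = \<beta> / 2 - (\<beta> / 2)\<^sup>2 * Polygamma 1 (1 + \<beta> / 2)"
  using deriv_log_Gamma[of "1 + \<beta> / 2" 1] by (simp add: hermite_sigma2_def Let_def numeral_2_eq_2)

lemma hermite_A_eq: "\<beta> > 0 \<Longrightarrow> hermite_A \<beta> = (\<beta> / 2) ^ 3 * Polygamma 2 (1 + \<beta> / 2) + \<beta> / 2"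
  using deriv_log_Gamma[of "1 + \<beta> / 2" 2] by (simp add: hermite_A_def Let_def numeral_3_eq_3 numeral_2_eq_2)

text \<open>The claim is \<open>\<psi>'(1 + b) < 1 / b\<close>. The series of the left-hand side has the terms \<open>1 / (b + k + 1)\<^sup>2\<close>, which are smaller
than the telescoping terms \<open>1 / ((b + k) (b + k + 1))\<close>, whose sum is \<open>1 / b\<close>.\<close>

lemma hermite_sigma2_pos:
  assumes \<beta>: "\<beta> > 0"
  shows "hermite_sigma2 \<beta> > 0"
proof -
  define b where "b = \<beta> / 2"
  have b: "b > 0" using \<beta> by (simp add: b_def)
  define u where "u k = 1 / (b + real k)" for k
  have u: "u k > 0" for k using b by (simp add: u_def add_pos_nonneg)
  have "u \<longlonglongrightarrow> 0" unfolding u_def using b by real_asymp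
  from telescope_sums'[OF this] have s1: "(\<lambda>k. u k - u (Suc k)) sums (u 0 - 0)" .
  have s2: "(\<lambda>k. (u (Suc k))\<^sup>2) sums Polygamma 1 (1 + b)"
    using Polygamma_LIMSEQ[of "1 + b" 1] b
    by (simp add: u_def add_ac power2_eq_square divide_inverse)
  have s: "(\<lambda>k. u k - u (Suc k) - (u (Suc k))\<^sup>2) sums (u 0 - 0 - Polygamma 1 (1 + b))"
    by (intro sums_diff s1 s2)
  have "u k - u (Suc k) - (u (Suc k))\<^sup>2 > 0" for k
  proof -
    have "u k - u (Suc k) = u k * u (Suc k)"
      using b by (simp add: u_def field_simps add_pos_nonneg)
    moreover have "u (Suc k) < u k" using b unfolding u_def by (intro divide_strict_left_mono mult_pos_pos add_pos_nonneg) auto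
    ultimately show ?thesis using u[of "Suc k"] by (simp add: power2_eq_square)
  qed
  then have "u 0 - 0 - Polygamma 1 (1 + b) > 0"
    using suminf_pos[of "\<lambda>k. u k - u (Suc k) - (u (Suc k))\<^sup>2"] s by (simp add: sums_iff)
  then have "b\<^sup>2 * (1 / b - Polygamma 1 (1 + b)) > 0" using b by (simp add: u_def)
  moreover have "b\<^sup>2 * (1 / b - Polygamma 1 (1 + b)) = b - b\<^sup>2 * Polygamma 1 (1 + b)"
    using b by (simp add: power2_eq_square algebra_simps)
  ultimately show ?thesis unfolding hermite_sigma2_eq[OF \<beta>] b_def by simp
qed

lemma harm_le_ln:
  assumes "n \<ge> 1"
  shows "(\<Sum>j\<in>{1..n}. 1 / real j) \<le> 1 + ln (real n)"
proof -
  obtain m where m: "n = Suc m" using assms by (cases n) auto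
  have "harm (Suc m) - ln (real (Suc m)) \<le> harm (Suc 0) - ln (real (Suc 0))"
    using decseq_harm_diff_ln by (rule decseqD) simp
  then show ?thesis by (simp add: m harm_def divide_inverse)
qed

lemma log_mgf_error:
  assumes \<beta>: "\<beta> > 0"
  obtains K where "K \<ge> 0" "\<And>n s. n \<ge> 1 \<Longrightarrow> cmod s \<le> 1 / 2 \<Longrightarrow>
     cmod (log_mgf \<beta> n s - of_nat n * (of_real (hermite_sigma2 \<beta>) * s\<^sup>2 / 2 - of_real (hermite_A \<beta>) * s ^ 3 / 6))
       \<le> K * (real n * cmod s ^ 4 + cmod s * (1 + ln (real n)))"
proof -
  define b where "b = \<beta> / 2"
  have b: "b > 0" using \<beta> by (simp add: b_def)
  obtain K where K: "\<And>s. cmod s \<le> 1 / 2 \<Longrightarrow>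
     cmod (cumulant_density b s - (of_real (hermite_sigma2 \<beta>) * s\<^sup>2 / 2 - of_real (hermite_A \<beta>) * s ^ 3 / 6)) \<le> K * cmod s ^ 4"
    using cumulant_density_taylor[OF b] unfolding hermite_sigma2_eq[OF \<beta>] hermite_A_eq[OF \<beta>] b_def by metis
  define c where "c = \<bar>ln (2 * pi) / 2\<bar>"
  define C where "C = max 0 K + (3 / b + 1 / 4 + (c + 1 / 4) / 2)"
  have "3 / b + 1 / 4 + (c + 1 / 4) / 2 \<ge> 0" using b by (simp add: c_def)
  then have C: "C \<ge> 0" "K \<le> C" "3 / b + 1 / 4 + (c + 1 / 4) / 2 \<le> C" by (simp_all add: C_def max_def)
  show ?thesis
  proof (rule that[OF C(1)])
    fix n :: nat and s :: complex assume n: "n \<ge> 1" and s: "cmod s \<le> 1 / 2"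
    have Re: "Re s > -1" using abs_Re_le_cmod[of s] s by linarith
    have l: "ln (real n) \<ge> 0" using n by simp
    let ?Q = "of_real (hermite_sigma2 \<beta>) * s\<^sup>2 / 2 - of_real (hermite_A \<beta>) * s ^ 3 / 6"
    define e where "e = (\<Sum>j\<in>{1..n}. dilation_error (real j * b) s) - s / 4 * of_real (ln (real n))
        - s / 2 * (of_real (ln (2 * pi) / 2) + stirling_remainder (of_nat n))"
    have "log_mgf \<beta> n s - of_nat n * ?Q = of_nat n * (cumulant_density b s - ?Q) + e"
      using log_mgf_eq[OF \<beta> n Re] by (simp add: b_def e_def algebra_simps)
    then have "cmod (log_mgf \<beta> n s - of_nat n * ?Q) \<le> real n * cmod (cumulant_density b s - ?Q) + cmod e"
      by (metis norm_mult norm_of_nat norm_triangle_ineq)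
    moreover have "real n * cmod (cumulant_density b s - ?Q) \<le> real n * (C * cmod s ^ 4)"
      using K[OF s] C(2) by (intro mult_left_mono) (auto intro: order_trans[OF _ mult_right_mono])
    moreover have "cmod e \<le> C * (cmod s * (1 + ln (real n)))"
    proof -
      have e1: "cmod (\<Sum>j\<in>{1..n}. dilation_error (real j * b) s) \<le> (3 / b) * (cmod s * (1 + ln (real n)))"
      proof -
        have "cmod (\<Sum>j\<in>{1..n}. dilation_error (real j * b) s) \<le> (\<Sum>j\<in>{1..n}. 3 * cmod s / (real j * b))"
          unfolding dilation_error_def using b s by (intro sum_norm_le stirling_remainder_dilation) auto
        also have "\<dots> = (3 / b * cmod s) * (\<Sum>j\<in>{1..n}. 1 / real j)"
          unfolding sum_distrib_left by (intro sum.cong) (auto simp: field_simps)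
        also have "\<dots> \<le> (3 / b * cmod s) * (1 + ln (real n))"
          using harm_le_ln[OF n] b by (intro mult_left_mono) auto
        finally show ?thesis by (simp add: mult.assoc)
      qed
      have e2: "cmod (s / 4 * of_real (ln (real n))) \<le> 1 / 4 * (cmod s * (1 + ln (real n)))"
        using l by (simp add: norm_mult mult_left_mono)
      have e3: "cmod (s / 2 * (of_real (ln (2 * pi) / 2) + stirling_remainder (of_nat n))) \<le> (c + 1 / 4) / 2 * (cmod s * (1 + ln (real n)))"
      proof -
        have "cmod (stirling_remainder (of_nat n)) \<le> 1 / (4 * real n)"
          using stirling_remainder_real_bounds(1)[of "real n"] n by simp
        also have "\<dots> \<le> 1 / 4" using n by simp
        finally have "cmod (of_real (ln (2 * pi) / 2) + stirling_remainder (of_nat n)) \<le> c + 1 / 4"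
          unfolding c_def by (intro order_trans[OF norm_triangle_ineq] add_mono) (auto simp: norm_of_real)
        then have "cmod (s / 2 * (of_real (ln (2 * pi) / 2) + stirling_remainder (of_nat n))) \<le> cmod s / 2 * (c + 1 / 4)"
          unfolding norm_mult by (intro mult_mono) (auto simp: norm_divide)
        also have "\<dots> = (c + 1 / 4) / 2 * (cmod s * 1)" by simp
        also have "\<dots> \<le> (c + 1 / 4) / 2 * (cmod s * (1 + ln (real n)))"
          using l by (intro mult_left_mono) (auto simp: c_def)
        finally show ?thesis .
      qed
      have "cmod e \<le> (3 / b) * (cmod s * (1 + ln (real n))) + 1 / 4 * (cmod s * (1 + ln (real n)))
          + (c + 1 / 4) / 2 * (cmod s * (1 + ln (real n)))"
        unfolding e_def
        by (rule order_trans[OF norm_triangle_ineq4 add_mono[OF order_trans[OF norm_triangle_ineq4 add_mono[OF e1 e2]] e3]])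
      also have "\<dots> = (3 / b + 1 / 4 + (c + 1 / 4) / 2) * (cmod s * (1 + ln (real n)))"
        by (simp only: distrib_right)
      also have "\<dots> \<le> C * (cmod s * (1 + ln (real n)))"
        using C(3) l by (intro mult_right_mono) auto
      finally show ?thesis .
    qed
    ultimately show "cmod (log_mgf \<beta> n s - of_nat n * ?Q) \<le> C * (real n * cmod s ^ 4 + cmod s * (1 + ln (real n)))"
      by (simp add: algebra_simps)
  qed
qed

section \<open>Mod-Gaussian convergence\<close>

lemma cube_root_scaling:
  assumes n: "n \<ge> 1"
  defines "a \<equiv> real n powr (- 1 / 3)"
  shows "a > 0" "a \<le> 1" "real n * a\<^sup>2 = real n powr (1 / 3)" "real n * a ^ 3 = 1"
proof -
  have n0: "real n > 0" using n by simp
  show "a > 0" using n0 by (simp add: a_def)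
  show "a \<le> 1" using n powr_mono[of "- 1 / 3" 0 "real n"] by (simp add: a_def)
  have "real n * a\<^sup>2 = real n powr 1 * real n powr (- 1 / 3 * 2)"
    using n0 by (simp add: a_def powr_power)
  then show "real n * a\<^sup>2 = real n powr (1 / 3)" unfolding powr_add[symmetric] by simp
  have "real n * a ^ 3 = real n powr 1 * real n powr (- 1 / 3 * 3)"
    using n0 by (simp add: a_def powr_power)
  then show "real n * a ^ 3 = 1" unfolding powr_add[symmetric] using n0 by simp
qed

text \<open>With \<open>s = z / n\<^sup>1\<^sup>/\<^sup>3\<close> the quadratic and cubic terms are exactly the Gaussian exponent and the exponent of the
limiting function, and the error bound is uniform on bounded sets of \<open>z\<close>.\<close>

lemma log_mgf_scaled_limit:
  assumes \<beta>: "\<beta> > 0" and R: "R \<ge> 0"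
  obtains \<epsilon> where "\<epsilon> \<longlonglongrightarrow> 0" "\<forall>\<^sub>F n in sequentially. \<forall>z. cmod z \<le> R \<longrightarrow>
     cmod (log_mgf \<beta> n (z * of_real (real n powr (- 1 / 3))) - of_real (real n powr (1 / 3) * hermite_sigma2 \<beta>) * z\<^sup>2 / 2
            - (- of_real (hermite_A \<beta>) * z ^ 3 / 6)) \<le> \<epsilon> n"
proof -
  obtain K where K: "K \<ge> 0" "\<And>n s. n \<ge> 1 \<Longrightarrow> cmod s \<le> 1 / 2 \<Longrightarrow>
     cmod (log_mgf \<beta> n s - of_nat n * (of_real (hermite_sigma2 \<beta>) * s\<^sup>2 / 2 - of_real (hermite_A \<beta>) * s ^ 3 / 6))
       \<le> K * (real n * cmod s ^ 4 + cmod s * (1 + ln (real n)))"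
    by (rule log_mgf_error[OF \<beta>]) blast
  define \<epsilon> where "\<epsilon> n = K * (R ^ 4 * real n powr (- 1 / 3) + R * (real n powr (- 1 / 3) * (1 + ln (real n))))" for n
  show ?thesis
  proof (rule that)
    have "(\<lambda>n. real n powr (- 1 / 3)) \<longlonglongrightarrow> 0" by real_asymp
    moreover have "(\<lambda>n. real n powr (- 1 / 3) * (1 + ln (real n))) \<longlonglongrightarrow> 0" by real_asymp
    ultimately have "(\<lambda>n. K * (R ^ 4 * real n powr (- 1 / 3) + R * (real n powr (- 1 / 3) * (1 + ln (real n)))))
        \<longlonglongrightarrow> K * (R ^ 4 * 0 + R * 0)"
      by (intro tendsto_intros)
    then show "\<epsilon> \<longlonglongrightarrow> 0" by (simp add: \<epsilon>_def[abs_def])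
    have "(\<lambda>n. R * real n powr (- 1 / 3)) \<longlonglongrightarrow> R * 0" by (intro tendsto_mult_left) real_asymp
    then have "\<forall>\<^sub>F n in sequentially. R * real n powr (- 1 / 3) < 1 / 2" by (rule order_tendstoD) simp
    then show "\<forall>\<^sub>F n in sequentially. \<forall>z. cmod z \<le> R \<longrightarrow>
     cmod (log_mgf \<beta> n (z * of_real (real n powr (- 1 / 3))) - of_real (real n powr (1 / 3) * hermite_sigma2 \<beta>) * z\<^sup>2 / 2
            - (- of_real (hermite_A \<beta>) * z ^ 3 / 6)) \<le> \<epsilon> n"
      using eventually_ge_at_top[of 1]
    proof eventually_elim
      case (elim n)
      show ?case
      proof (intro allI impI)
        fix z assume z: "cmod z \<le> R"
        define a where "a = real n powr (- 1 / 3)"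
        define s where "s = z * of_real a"
        note a = cube_root_scaling[OF elim(2), folded a_def]
        have s: "cmod s = cmod z * a" using a(1) by (simp add: s_def norm_mult)
        have sR: "cmod s \<le> R * a" unfolding s using z a(1) by (intro mult_right_mono) auto
        have s12: "cmod s \<le> 1 / 2" using sR elim(1) by (simp add: a_def)
        have l: "ln (real n) \<ge> 0" using elim(2) by simp
        have "of_nat n * (of_real (hermite_sigma2 \<beta>) * s\<^sup>2 / 2 - of_real (hermite_A \<beta>) * s ^ 3 / 6)
            = of_real (hermite_sigma2 \<beta>) * (of_real (real n * a\<^sup>2) * z\<^sup>2) / 2 - of_real (hermite_A \<beta>) * (of_real (real n * a ^ 3) * z ^ 3) / 6"
          unfolding s_def by (simp add: power_mult_distrib algebra_simps)
        also have "\<dots> = of_real (real n powr (1 / 3) * hermite_sigma2 \<beta>) * z\<^sup>2 / 2 + - of_real (hermite_A \<beta>) * z ^ 3 / 6"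
          unfolding a(3,4) by simp
        finally have "log_mgf \<beta> n s - of_real (real n powr (1 / 3) * hermite_sigma2 \<beta>) * z\<^sup>2 / 2 - (- of_real (hermite_A \<beta>) * z ^ 3 / 6)
            = log_mgf \<beta> n s - of_nat n * (of_real (hermite_sigma2 \<beta>) * s\<^sup>2 / 2 - of_real (hermite_A \<beta>) * s ^ 3 / 6)"
          by simp
        also have "cmod \<dots> \<le> K * (real n * cmod s ^ 4 + cmod s * (1 + ln (real n)))"
          by (rule K(2)[OF elim(2) s12])
        also have "\<dots> \<le> K * (real n * (R * a) ^ 4 + (R * a) * (1 + ln (real n)))"
          using sR l K(1) by (intro mult_left_mono add_mono power_mono mult_right_mono) auto
        also have "real n * (R * a) ^ 4 = R ^ 4 * a"
        proof -
          have "real n * (R * a) ^ 4 = R ^ 4 * (real n * a ^ 3) * a"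
            by (simp add: power_mult_distrib power4_eq_xxxx power3_eq_cube)
          then show ?thesis unfolding a(4) by simp
        qed
        also have "K * (R ^ 4 * a + R * a * (1 + ln (real n))) = \<epsilon> n"
          by (simp add: \<epsilon>_def a_def)
        finally show "cmod (log_mgf \<beta> n (z * of_real (real n powr (- 1 / 3))) - of_real (real n powr (1 / 3) * hermite_sigma2 \<beta>) * z\<^sup>2 / 2
            - (- of_real (hermite_A \<beta>) * z ^ 3 / 6)) \<le> \<epsilon> n"
          by (simp only: s_def a_def)
      qed
    qed
  qed
qed

lemma uniform_limit_exp:
  fixes f :: "nat \<Rightarrow> complex \<Rightarrow> complex"
  assumes close: "\<forall>\<^sub>F n in sequentially. \<forall>z\<in>U. cmod (f n z - g z) \<le> \<epsilon> n" and \<epsilon>: "\<epsilon> \<longlonglongrightarrow> 0"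
    and bounded: "\<And>z. z \<in> U \<Longrightarrow> cmod (g z) \<le> B"
  shows "uniform_limit U (\<lambda>n z. exp (f n z)) (\<lambda>z. exp (g z)) sequentially"
proof (rule uniform_limitI)
  fix e :: real assume e: "e > 0"
  have "(\<lambda>n. exp B * (\<epsilon> n * exp (\<epsilon> n))) \<longlonglongrightarrow> exp B * (0 * exp 0)"
    by (intro tendsto_intros \<epsilon>)
  then have "\<forall>\<^sub>F n in sequentially. exp B * (\<epsilon> n * exp (\<epsilon> n)) < e"
    by (rule order_tendstoD) (use e in simp)
  with close show "\<forall>\<^sub>F n in sequentially. \<forall>z\<in>U. dist (exp (f n z)) (exp (g z)) < e"
  proof eventually_elim
    case (elim n)
    show ?case
    proof
      fix z assume z: "z \<in> U"
      define d where "d = f n z - g z"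
      have d: "cmod d \<le> \<epsilon> n" using elim(1) z by (simp add: d_def)
      then have \<epsilon>0: "\<epsilon> n \<ge> 0" using norm_ge_zero[of d] by linarith
      have "exp (f n z) - exp (g z) = exp (g z) * (exp d - 1)"
        by (simp add: d_def algebra_simps exp_add[symmetric])
      then have "dist (exp (f n z)) (exp (g z)) = exp (Re (g z)) * cmod (exp d - 1)"
        by (simp add: dist_norm norm_mult)
      also have "\<dots> \<le> exp B * (\<epsilon> n * exp (\<epsilon> n))"
      proof (rule mult_mono)
        show "exp (Re (g z)) \<le> exp B" using bounded[OF z] complex_Re_le_cmod[of "g z"] by simp
        have "cmod (exp d - 1) \<le> cmod d * exp (cmod d)" by (rule norm_exp_diff_one_le)
        also have "\<dots> \<le> \<epsilon> n * exp (\<epsilon> n)" using d \<epsilon>0 by (intro mult_mono) auto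
        finally show "cmod (exp d - 1) \<le> \<epsilon> n * exp (\<epsilon> n)" .
      qed auto
      finally show "dist (exp (f n z)) (exp (g z)) < e" using elim(2) by simp
    qed
  qed
qed

theorem theorem5p4:
  fixes \<beta> :: real
    and M :: "nat \<Rightarrow> 'a measure"
    and \<Lambda> :: "nat \<Rightarrow> 'a \<Rightarrow> (nat \<Rightarrow> real)"
  assumes "\<beta> > 0"
    and "\<And>n. n \<ge> 1 \<Longrightarrow> prob_space (M n)"
    and "\<And>n. n \<ge> 1 \<Longrightarrow>
           distributed (M n) (lebesgue_Rn n) (\<Lambda> n) (\<lambda>x. ennreal (hermite_density \<beta> n x))"
  shows "mod_gaussian_convergent (- 1) \<infinity> M
           (\<lambda>n \<omega>. real n powr (- 1 / 3) * hermite_Y \<beta> n (\<Lambda> n \<omega>))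
           (\<lambda>n. real n powr (1 / 3) * hermite_sigma2 \<beta>)
           (\<lambda>z. exp (- complex_of_real (hermite_A \<beta>) * z ^ 3 / 6))"
proof -
  note \<beta> = assms(1) and M = assms(2) and dist = assms(3)
  let ?S = "strip (- 1) \<infinity>"
  let ?a = "\<lambda>n. real n powr (- 1 / 3)" and ?A = "complex_of_real (hermite_A \<beta>)"
  let ?X = "\<lambda>n \<omega>. ?a n * hermite_Y \<beta> n (\<Lambda> n \<omega>)" and ?t = "\<lambda>n. real n powr (1 / 3) * hermite_sigma2 \<beta>"
  have S: "?S = {z. -1 < Re z}" by (auto simp: strip_def one_ereal_def)
  have openS: "open ?S" unfolding S by (rule open_halfspace_Re_gt)
  have Y_meas: "(\<lambda>\<omega>. hermite_Y \<beta> n (\<Lambda> n \<omega>)) \<in> borel_measurable (M n)" if "n \<ge> 1" for n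
    by (rule measurable_hermite_Y[OF dist[OF that]])
  have Re_s: "Re (z * of_real (?a n)) > -1" if "z \<in> ?S" "n \<ge> 1" for z n
  proof (cases "Re z \<ge> 0")
    case True
    then have "Re z * ?a n \<ge> 0" by simp
    then show ?thesis by simp
  next
    case False
    then have "Re z * 1 \<le> Re z * ?a n" using cube_root_scaling(2)[OF that(2)] by (intro mult_left_mono_neg) auto
    then show ?thesis using that(1) by (simp add: S)
  qed
  have int: "integrable (M n) (\<lambda>\<omega>. exp (z * complex_of_real (?X n \<omega>)))" if n: "n \<ge> 1" and z: "z \<in> ?S" for n z
    using integrable_exp_complex[OF Y_meas[OF n] hermite_mgf_real(1)[OF \<beta> n Re_s[OF z n] M[OF n] dist[OF n]]]
    by (simp add: mult.assoc)
  have mgf: "(LINT \<omega>|M n. exp (z * complex_of_real (?X n \<omega>))) = exp (log_mgf \<beta> n (z * of_real (?a n)))"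
    if n: "n \<ge> 1" and z: "z \<in> ?S" for n z
    using hermite_mgf[OF \<beta> n M[OF n] dist[OF n] Re_s[OF z n]] by (simp add: log_mgf_def mult.assoc)
  have unif_ball: "uniform_limit (ball z0 1 \<inter> ?S)
       (\<lambda>n z. (LINT \<omega>|M n. exp (z * complex_of_real (?X n \<omega>))) * exp (- (complex_of_real (?t n) * z\<^sup>2 / 2)))
       (\<lambda>z. exp (- ?A * z ^ 3 / 6)) sequentially" for z0
  proof -
    define R where "R = cmod z0 + 1"
    have R: "cmod z \<le> R" if "z \<in> ball z0 1 \<inter> ?S" for z
      using that norm_triangle_ineq2[of z z0] by (simp add: R_def dist_norm norm_minus_commute)
    have "R \<ge> 0" by (simp add: R_def)
    from \<beta> this obtain \<epsilon> where \<epsilon>: "\<epsilon> \<longlonglongrightarrow> 0" and close: "\<forall>\<^sub>F n in sequentially. \<forall>z. cmod z \<le> R \<longrightarrow>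
       cmod (log_mgf \<beta> n (z * of_real (?a n)) - of_real (?t n) * z\<^sup>2 / 2 - (- ?A * z ^ 3 / 6)) \<le> \<epsilon> n"
      by (rule log_mgf_scaled_limit)
    have lim: "uniform_limit (ball z0 1 \<inter> ?S) (\<lambda>n z. exp (log_mgf \<beta> n (z * of_real (?a n)) - of_real (?t n) * z\<^sup>2 / 2))
       (\<lambda>z. exp (- ?A * z ^ 3 / 6)) sequentially"
    proof (rule uniform_limit_exp[OF _ \<epsilon>])
      show "\<forall>\<^sub>F n in sequentially. \<forall>z\<in>ball z0 1 \<inter> ?S.
          cmod (log_mgf \<beta> n (z * of_real (?a n)) - of_real (?t n) * z\<^sup>2 / 2 - (- ?A * z ^ 3 / 6)) \<le> \<epsilon> n"
        using close by eventually_elim (use R in blast)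
      show "cmod (- ?A * z ^ 3 / 6) \<le> \<bar>hermite_A \<beta>\<bar> * R ^ 3 / 6" if "z \<in> ball z0 1 \<inter> ?S" for z
        using R[OF that] by (simp add: norm_mult norm_divide norm_power mult_left_mono power_mono)
    qed
    have "\<forall>\<^sub>F n in sequentially. \<forall>z\<in>ball z0 1 \<inter> ?S.
        (LINT \<omega>|M n. exp (z * complex_of_real (?X n \<omega>))) * exp (- (complex_of_real (?t n) * z\<^sup>2 / 2))
        = exp (log_mgf \<beta> n (z * of_real (?a n)) - of_real (?t n) * z\<^sup>2 / 2)"
      using eventually_ge_at_top[of 1]
    proof eventually_elim
      case (elim n)
      show ?case
      proof
        fix z assume "z \<in> ball z0 1 \<inter> ?S"
        then have z: "z \<in> ?S" by blast
        show "(LINT \<omega>|M n. exp (z * complex_of_real (?X n \<omega>))) * exp (- (complex_of_real (?t n) * z\<^sup>2 / 2))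
            = exp (log_mgf \<beta> n (z * of_real (?a n)) - of_real (?t n) * z\<^sup>2 / 2)"
          by (simp only: mgf[OF elim z] exp_add[symmetric] add_uminus_conv_diff)
      qed
    qed
    from uniform_limit_cong[OF this refl] lim show ?thesis by (rule iffD2)
  qed
  have unif: "locally_uniform_limit ?S
       (\<lambda>n z. (LINT \<omega>|M n. exp (z * complex_of_real (?X n \<omega>))) * exp (- (complex_of_real (?t n) * z\<^sup>2 / 2)))
       (\<lambda>z. exp (- ?A * z ^ 3 / 6))"
    unfolding locally_uniform_limit_def
  proof
    fix z0
    show "\<exists>U. open U \<and> z0 \<in> U \<and> uniform_limit (U \<inter> ?S)
       (\<lambda>n z. (LINT \<omega>|M n. exp (z * complex_of_real (?X n \<omega>))) * exp (- (complex_of_real (?t n) * z\<^sup>2 / 2)))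
       (\<lambda>z. exp (- ?A * z ^ 3 / 6)) sequentially"
      by (intro exI[of _ "ball z0 1"] conjI unif_ball open_ball) simp
  qed
  have "filterlim (\<lambda>n. real n powr (1 / 3)) at_top sequentially" by real_asymp
  then have t: "filterlim ?t at_top sequentially"
    by (rule filterlim_at_top_mult_tendsto_pos[OF tendsto_const hermite_sigma2_pos[OF \<beta>]])
  have an: "(\<lambda>z. exp (- ?A * z ^ 3 / 6)) analytic_on ?S"
    unfolding analytic_on_open[OF openS] by (intro holomorphic_intros) auto
  show ?thesis
    unfolding mod_gaussian_convergent_def
  proof (intro conjI allI impI ballI)
    show "?X n \<in> borel_measurable (M n)" if "n \<ge> 1" for n
      using Y_meas[OF that] by simp
  qed (use M int t an unif in simp_all)
qed

end
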